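(* Let $Y\in\mathcal Y$, $1\le k\le n$, and let $\pm$ be a fixed choice of sign. Then $F_k\mathbf 1_{X_Y^\pm}=\mathbf 1_{X_{Y'}^\pm}$ if there exists $Y'\in\mathcal Y$ with $\mathbf v_{Y'}^\pm=\mathbf v_Y^\pm+\mathbf e^k$, and $F_k\mathbf 1_{X_Y^\pm}=0$ otherwise. Also $E_k\mathbf 1_{X_Y^\pm}=\mathbf 1_{X_{Y''}^\pm}$ if there exists $Y''\in\mathcal Y$ with $\mathbf v_{Y''}^\pm=\mathbf v_Y^\pm-\mathbf e^k$, and $E_k\mathbf 1_{X_Y^\pm}=0$ otherwise.
   Context: Quiver varieties. Let $n\ge4$ and let $I=\{1,\dots,n\}$ be the vertex set of the Dynkin graph of type $D_n$, with edges $i - (i+1)$ for $1\le i\le n-2$ and $(n-2) - n$. $H$ is the set of edges with an orientation; $\mathrm{out}(h)$ is the source and $\mathrm{in}(h)$ the target of $h$; $\bar h$ is the reversed edge; $h_{i,j}$ goes from $i$ to $j$. $\Omega=\{h_{i,i+1}:1\le i\le n-2\}\cup\{h_{n-2,n}\}$; $\varepsilon=1$ on $\Omega$ and $-1$ on $H\setminus\Omega$. For a finite-dimensional $I$-graded complex vector space $\mathbf V$, $\mathbf E_{\mathbf V}=\bigoplus_{h\in H}\mathrm{Hom}(\mathbf V_{\mathrm{out}(h)},\mathbf V_{\mathrm{in}(h)})$, $G_{\mathbf V}=\prod_i\mathrm{Aut}(\mathbf V_i)$, and $\Lambda_{\mathbf V}$ is the set of $x\in\mathbf E_{\mathbf V}$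 that are nilpotent (for some $N\ge1$ all compositions of $N$ maps $x_h$ along composable oriented edges vanish) and satisfy $\sum_{h:\mathrm{in}(h)=i}\varepsilon(h)x_hx_{\bar h}=0$ for all $i$. For $\mathbf v,\mathbf w\in\mathbb Z_{\ge0}^I$ and $I$-graded spaces $\mathbf V,\mathbf W$ of these graded dimensions, $\Lambda(\mathbf v,\mathbf w)=\Lambda_{\mathbf V}\times\bigoplus_i\mathrm{Hom}(\mathbf V_i,\mathbf W_i)\ni(x,j)$; $\Lambda(\mathbf v,\mathbf w)^{\mathrm{st}}$ is the set of $(x,j)$ for which the only $I$-graded $x$-stable subspace $\mathbf S\subset\mathbf V$ with $j(\mathbf S)=0$ is $0$. $G_{\mathbf V}$ acts by $(x,j)\mapsto((g_{\mathrm{in}(h)}x_hg_{\mathrm{out}(h)}^{-1}),(j_ig_i^{-1}))$, freely on $\Lambda(\mathbf v,\mathbf w)^{\mathrm{st}}$, and $\mathcal L(\mathbf v,\mathbf w)=\Lambda(\mathbf v,\mathbf w)^{\mathrm{st}}/G_{\mathbf V}$. Let $\mathbf w^i_j=\delta_{ij}$ and $\mathbf e^k_j=\delta_{kj}$. Operators. $M(A)$ is the space of complex-valued constructible functions on a variety $A$; $\mathbf 1_Z$ is the indicator function of $Z$. For a map $\pi:A\to B$, $\pi^*f=f\circ\pi$ and $\pi_!$ is the linear map with $\pi_!(\mathbf 1_Z)(y)=\chi(\pi^{-1}(y)\cap Z)$, $\chi$ the Euler characteristic. For $\mathbf v''\le\mathbf v$, $\mathcal F(\mathbf v,\mathbf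 w;\mathbf v'')$ is the set of $G_{\mathbf V}$-orbits of triples $(x,j,\mathbf S)$ with $(x,j)\in\Lambda(\mathbf v,\mathbf w)^{\mathrm{st}}$ and $\mathbf S\subset\mathbf V$ an $I$-graded $x$-stable subspace of graded dimension $\mathbf v-\mathbf v''$; $\pi_1(x,j,\mathbf S)=(x|_{\mathbf S},j|_{\mathbf S})\in\mathcal L(\mathbf v-\mathbf v'',\mathbf w)$ and $\pi_2(x,j,\mathbf S)=(x,j)\in\mathcal L(\mathbf v,\mathbf w)$. With $\mathbf v''=\mathbf e^k$: $E_k:M(\mathcal L(\mathbf v,\mathbf w))\to M(\mathcal L(\mathbf v-\mathbf e^k,\mathbf w))$, $E_kf=(\pi_1)_!\pi_2^*f$, and $F_k:M(\mathcal L(\mathbf v-\mathbf e^k,\mathbf w))\to M(\mathcal L(\mathbf v,\mathbf w))$, $F_kg=(\pi_2)_!\pi_1^*g$ (zero where the relevant varieties are empty). Components. $\mathcal Y$ is the set of strictly decreasing sequences $Y=(l_1>\dots>l_s)$ of positive integers, $s\ge0$, $l_1\le n-1$. String representations of the quiver $(I,\Omega)$: for $1\le k'\le k\le n-1$, $(\mathbf V(k',k),x(k',k))$ has basis $e_r$ of degree $r$, $k'\le r\le k$, with $e_r\mapsto e_{r+1}$ along $h_{r,r+1}$ for $r<k$; for $k'\le n-2$ or $k'=n$, $(\mathbf V(k',n),x(k',n))$ has basis $e_r$ of degree $r$, $k'\le r\le n-2$ or $r=n$, with $e_r\mapsto e_{r+1}$ along $h_{r,r+1}$ for $r<n-2$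 and $e_{n-2}\mapsto e_n$ along $h_{n-2,n}$; other components are zero. For $Y\in\mathcal Y$, $A^+_{l_i}=(n-l_i,n)$ if $i$ odd and $l_i>1$; $(n,n)$ if $i$ odd and $l_i=1$; $(n-l_i,n-1)$ if $i$ even; $A^-_{l_i}$ is defined in the same way with "odd" and "even" interchanged; $A_Y^\pm=\{A_{l_i}^\pm\}_{i=1}^s$. Let $\mathbf v_Y^\pm$ be the graded dimension of $\bigoplus_{(k',k)\in A_Y^\pm}\mathbf V(k',k)$. The sign $+$ goes with $\mathbf w=\mathbf w^n$ and $-$ with $\mathbf w=\mathbf w^{n-1}$. $X_Y^\pm$ is the irreducible component $\big((\overline{\mathcal C}\times\bigoplus_i\mathrm{Hom}(\mathbf V_i,\mathbf W_i))\cap\Lambda^{\mathrm{st}}\big)/G_{\mathbf V}$ of $\mathcal L(\mathbf v_Y^\pm,\mathbf w)$, where $\mathcal C\subset\mathbf E_{\mathbf V}$ is the conormal bundle (with $\mathbf E_{\mathbf V}$ viewed as the cotangent bundle of $\mathbf E_{\mathbf V,\Omega}=\{x: x_h=0\ \forall h\notin\Omega\}$ via $\langle x,y\rangle=\sum_h\varepsilon(h)\mathrm{tr}(x_hy_{\bar h})$) to the $G_{\mathbf V}$-orbit of representations isomorphic to $\bigoplus_{(k',k)\in A_Y^\pm}(\mathbf V(k',k),x(k',k))$. It is known that each $\mathcal L(\mathbf v,\mathbf w^n)$ and each $\mathcal L(\mathbf v,\mathbf w^{n-1})$ is empty or a point, so that $X_Y^\pm=\mathcal L(\mathbf v_Y^\pm,\mathbf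 w)$ is a point and $\mathbf v_Y^\pm$ determines $Y$. *)

theory Defs
  imports
    "Jordan_Normal_Form.VS_Connect"
    "HOL-Homology.Homology"
    "HOL-Library.Function_Algebras"
begin

section \<open>Topological preliminaries\<close>

definition quotient_topology :: "'a topology \<Rightarrow> ('a \<Rightarrow> 'b) \<Rightarrow> 'b topology" where
  "quotient_topology X f =
     topology (\<lambda>U. U \<subseteq> f ` topspace X \<and> openin X {x \<in> topspace X. f x \<in> U})"

lemma openin_quotient_topology:
  "openin (quotient_topology X f) U \<longleftrightarrow>
     U \<subseteq> f ` topspace X \<and> openin X {x \<in> topspace X. f x \<in> U}"
proof -
  have "istopology (\<lambda>U. U \<subseteq> f ` topspace X \<and> openin X {x \<in> topspace X. f x \<in> U})"
    unfolding istopology_def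
  proof (intro conjI allI impI)
    fix S T
    assume S: "S \<subseteq> f ` topspace X \<and> openin X {x \<in> topspace X. f x \<in> S}"
      and T: "T \<subseteq> f ` topspace X \<and> openin X {x \<in> topspace X. f x \<in> T}"
    have eq: "{x \<in> topspace X. f x \<in> S \<inter> T} =
        {x \<in> topspace X. f x \<in> S} \<inter> {x \<in> topspace X. f x \<in> T}" by blast
    show "openin X {x \<in> topspace X. f x \<in> S \<inter> T}"
      unfolding eq by (rule openin_Int[OF conjunct2[OF S] conjunct2[OF T]])
    show "S \<inter> T \<subseteq> f ` topspace X"
      using conjunct1[OF S] by blast
  next
    fix K
    assume K: "\<forall>U\<in>K. U \<subseteq> f ` topspace X \<and> openin X {x \<in> topspace X. f x \<in> U}"
    have eq: "{x \<in> topspace X. f x \<in> \<Union>K} = \<Union>((\<lambda>U. {x \<in> topspace X. f x \<in> U}) ` K)"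
      by blast
    show "openin X {x \<in> topspace X. f x \<in> \<Union>K}"
      unfolding eq by (rule openin_Union) (use K in blast)
    show "\<Union>K \<subseteq> f ` topspace X"
      using K by blast
  qed
  then show ?thesis
    unfolding quotient_topology_def by (simp only: topology_inverse')
qed

lemma topspace_quotient_topology: "topspace (quotient_topology X f) = f ` topspace X"
proof
  show "topspace (quotient_topology X f) \<subseteq> f ` topspace X"
    using openin_topspace[of "quotient_topology X f"] unfolding openin_quotient_topology by (rule conjunct1)
  have "{x \<in> topspace X. f x \<in> f ` topspace X} = topspace X" by auto
  then have "openin (quotient_topology X f) (f ` topspace X)"
    by (simp add: openin_quotient_topology)
  then show "f ` topspace X \<subseteq> topspace (quotient_topology X f)"
    by (rule openin_subset)
qed

lemma quotient_map_quotient_topology: "quotient_map X (quotient_topology X f) f"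
  by (simp add: quotient_map_def topspace_quotient_topology openin_quotient_topology)

text \<open>The rank of an abelian group (written multiplicatively) is the largest cardinality of a
  finite subset that is linearly independent over the integers.\<close>

definition abelian_rank :: "('a, 'b) monoid_scheme \<Rightarrow> nat" where
  "abelian_rank G = Sup {card B | B. finite B \<and> B \<subseteq> carrier G \<and>
     (\<forall>c :: 'a \<Rightarrow> int. finprod G (\<lambda>b. b [^]\<^bsub>G\<^esub> c b) B = \<one>\<^bsub>G\<^esub> \<longrightarrow> (\<forall>b\<in>B. c b = 0))}"

text \<open>For complex algebraic varieties with their classical topology this agrees
  with the Euler characteristic with compact support.\<close>

definition euler_char :: "'a topology \<Rightarrow> int" where
  "euler_char X =
     (\<Sum>p | abelian_rank (homology_group (int p) X) \<noteq> 0.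
        (-1) ^ p * int (abelian_rank (homology_group (int p) X)))"

text \<open>\<open>pushforward X \<pi> f\<close> is \<open>\<pi>\<^sub>! f\<close> for \<open>f\<close> on the space \<open>X\<close>.  A constructible \<open>f\<close> is the
  finite sum of \<open>a\<close> times the indicator function of the level set of \<open>a\<close>, whence the formula.\<close>

definition pushforward :: "'a topology \<Rightarrow> ('a \<Rightarrow> 'b) \<Rightarrow> ('a \<Rightarrow> complex) \<Rightarrow> 'b \<Rightarrow> complex" where
  "pushforward X \<pi> f y =
     (\<Sum>a \<in> f ` topspace X - {0}.
        a * of_int (euler_char (subtopology X {q \<in> topspace X. \<pi> q = y \<and> f q = a})))"

section \<open>The classical topology on matrices and Grassmannians\<close>

definition mat_topology :: "nat \<Rightarrow> nat \<Rightarrow> complex mat topology" where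
  "mat_topology r c =
     pullback_topology (carrier_mat r c) (\<lambda>A. \<lambda>p\<in>{..<r} \<times> {..<c}. A $$ p)
       (product_topology (\<lambda>_. euclidean) ({..<r} \<times> {..<c}))"

definition col_span :: "nat \<Rightarrow> complex mat \<Rightarrow> complex Matrix.vec set" where
  "col_span d A = (\<lambda>u. A *\<^sub>v u) ` carrier_vec d"

definition frames :: "nat \<Rightarrow> nat \<Rightarrow> complex mat set" where
  "frames m d = {A \<in> carrier_mat m d. inj_on (\<lambda>u. A *\<^sub>v u) (carrier_vec d)}"

text \<open>The Grassmannian of \<open>d\<close>-dimensional subspaces of \<open>\<complex>\<^sup>m\<close>, as the quotient of the Stiefel
  manifold of injective linear maps from \<open>\<complex>\<^sup>d\<close>.\<close>

definition grassmannian :: "nat \<Rightarrow> nat \<Rightarrow> complex Matrix.vec set topology" where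
  "grassmannian m d =
     quotient_topology (subtopology (mat_topology m d) (frames m d)) (col_span d)"

section \<open>Quiver varieties of type D\<close>

text \<open>An oriented edge is the pair (source, target).  A graded dimension is a function on all of
  \<open>nat\<close> of which only the values on \<open>vertices n\<close> matter; degree \<open>i\<close> of \<open>V\<close> is \<open>carrier_vec (v i)\<close>.  Families indexed by
  vertices or edges are undefined outside the index set, so that they are determined by their
  components.\<close>

type_synonym edge = "nat \<times> nat"
type_synonym rep = "edge \<Rightarrow> complex mat"
type_synonym graded_mat = "nat \<Rightarrow> complex mat"
type_synonym graded_sub = "nat \<Rightarrow> complex Matrix.vec set"

definition vertices :: "nat \<Rightarrow> nat set" where
  "vertices n = {1..n}"

definition Omega :: "nat \<Rightarrow> edge set" where
  "Omega n = {(i, i + 1) | i. 1 \<le> i \<and> i \<le> n - 2} \<union> {(n - 2, n)}"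

definition opp :: "edge \<Rightarrow> edge" where
  "opp h = (snd h, fst h)"

definition edges :: "nat \<Rightarrow> edge set" where
  "edges n = Omega n \<union> opp ` Omega n"

definition eps :: "nat \<Rightarrow> edge \<Rightarrow> complex" where
  "eps n h = (if h \<in> Omega n then 1 else - 1)"

definition unit_dim :: "nat \<Rightarrow> nat \<Rightarrow> nat" where
  "unit_dim k = (\<lambda>i. if i = k then 1 else 0)"

definition rep_space :: "nat \<Rightarrow> (nat \<Rightarrow> nat) \<Rightarrow> rep set" where
  "rep_space n v = (\<Pi>\<^sub>E h\<in>edges n. carrier_mat (v (snd h)) (v (fst h)))"

definition framing_space :: "nat \<Rightarrow> (nat \<Rightarrow> nat) \<Rightarrow> (nat \<Rightarrow> nat) \<Rightarrow> graded_mat set" where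
  "framing_space n v w = (\<Pi>\<^sub>E i\<in>vertices n. carrier_mat (w i) (v i))"

definition GV :: "nat \<Rightarrow> (nat \<Rightarrow> nat) \<Rightarrow> graded_mat set" where
  "GV n v = (\<Pi>\<^sub>E i\<in>vertices n. Units (ring_mat TYPE(complex) (v i) ()))"

definition mat_inv :: "nat \<Rightarrow> complex mat \<Rightarrow> complex mat" where
  "mat_inv m A = inv\<^bsub>ring_mat TYPE(complex) m ()\<^esub> A"

definition act_rep :: "nat \<Rightarrow> (nat \<Rightarrow> nat) \<Rightarrow> graded_mat \<Rightarrow> rep \<Rightarrow> rep" where
  "act_rep n v g x =
     (\<lambda>h\<in>edges n. g (snd h) * x h * mat_inv (v (fst h)) (g (fst h)))"

definition act_framing :: "nat \<Rightarrow> (nat \<Rightarrow> nat) \<Rightarrow> graded_mat \<Rightarrow> graded_mat \<Rightarrow> graded_mat" where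
  "act_framing n v g j = (\<lambda>i\<in>vertices n. j i * mat_inv (v i) (g i))"

definition act_sub :: "nat \<Rightarrow> graded_mat \<Rightarrow> graded_sub \<Rightarrow> graded_sub" where
  "act_sub n g S = (\<lambda>i\<in>vertices n. (\<lambda>u. g i *\<^sub>v u) ` S i)"

definition nilpotent_rep :: "nat \<Rightarrow> (nat \<Rightarrow> nat) \<Rightarrow> rep \<Rightarrow> bool" where
  "nilpotent_rep n v x \<longleftrightarrow>
     (\<exists>N\<ge>1. \<forall>hs. length hs = N \<and> set hs \<subseteq> edges n \<and> successively (\<lambda>h h'. snd h = fst h') hs \<longrightarrow>
        fold (\<lambda>h A. x h * A) hs (1\<^sub>m (v (fst (hd hs)))) = 0\<^sub>m (v (snd (last hs))) (v (fst (hd hs))))"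

text \<open>The moment map equation is stated for matrix entries, because the sum of a family of
  matrices of given dimensions is not a class-based sum.\<close>

definition Lambda :: "nat \<Rightarrow> (nat \<Rightarrow> nat) \<Rightarrow> rep set" where
  "Lambda n v = {x \<in> rep_space n v. nilpotent_rep n v x \<and>
     (\<forall>i\<in>vertices n. \<forall>a<v i. \<forall>b<v i.
        (\<Sum>h\<in>{h \<in> edges n. snd h = i}. eps n h * (x h * x (opp h)) $$ (a, b)) = 0)}"

definition graded_subspace :: "nat \<Rightarrow> (nat \<Rightarrow> nat) \<Rightarrow> graded_sub \<Rightarrow> bool" where
  "graded_subspace n v S \<longleftrightarrow> S \<in> extensional (vertices n) \<and>
     (\<forall>i\<in>vertices n. VectorSpace.subspace class_ring (S i) (module_vec TYPE(complex) (v i)))"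

definition has_graded_dim :: "nat \<Rightarrow> (nat \<Rightarrow> nat) \<Rightarrow> graded_sub \<Rightarrow> (nat \<Rightarrow> nat) \<Rightarrow> bool" where
  "has_graded_dim n v S d \<longleftrightarrow> (\<forall>i\<in>vertices n.
     vectorspace.dim class_ring (module_vec TYPE(complex) (v i)\<lparr>carrier := S i\<rparr>) = d i)"

definition rep_stable :: "nat \<Rightarrow> rep \<Rightarrow> graded_sub \<Rightarrow> bool" where
  "rep_stable n x S \<longleftrightarrow> (\<forall>h\<in>edges n. \<forall>u\<in>S (fst h). x h *\<^sub>v u \<in> S (snd h))"

definition Lambda_st :: "nat \<Rightarrow> (nat \<Rightarrow> nat) \<Rightarrow> (nat \<Rightarrow> nat) \<Rightarrow> (rep \<times> graded_mat) set" where
  "Lambda_st n v w = {(x, j). x \<in> Lambda n v \<and> j \<in> framing_space n v w \<and>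
     (\<forall>S. graded_subspace n v S \<and> rep_stable n x S \<and>
          (\<forall>i\<in>vertices n. \<forall>u\<in>S i. j i *\<^sub>v u = 0\<^sub>v (w i)) \<longrightarrow>
        (\<forall>i\<in>vertices n. S i = {0\<^sub>v (v i)}))}"

definition orbit :: "nat \<Rightarrow> (nat \<Rightarrow> nat) \<Rightarrow> rep \<times> graded_mat \<Rightarrow> (rep \<times> graded_mat) set" where
  "orbit n v = (\<lambda>(x, j). {(act_rep n v g x, act_framing n v g j) | g. g \<in> GV n v})"

definition quiver_variety ::
    "nat \<Rightarrow> (nat \<Rightarrow> nat) \<Rightarrow> (nat \<Rightarrow> nat) \<Rightarrow> (rep \<times> graded_mat) set set" where
  "quiver_variety n v w = orbit n v ` Lambda_st n v w"

section \<open>Hecke correspondences and the operators\<close>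

definition flag_triples ::
    "nat \<Rightarrow> (nat \<Rightarrow> nat) \<Rightarrow> (nat \<Rightarrow> nat) \<Rightarrow> (nat \<Rightarrow> nat) \<Rightarrow> (rep \<times> graded_mat \<times> graded_sub) set" where
  "flag_triples n v w v'' = {(x, j, S). v'' \<le> v \<and> (x, j) \<in> Lambda_st n v w \<and>
     graded_subspace n v S \<and> has_graded_dim n v S (v - v'') \<and> rep_stable n x S}"

definition orbit3 :: "nat \<Rightarrow> (nat \<Rightarrow> nat) \<Rightarrow> rep \<times> graded_mat \<times> graded_sub \<Rightarrow>
    (rep \<times> graded_mat \<times> graded_sub) set" where
  "orbit3 n v = (\<lambda>(x, j, S).
     {(act_rep n v g x, act_framing n v g j, act_sub n g S) | g. g \<in> GV n v})"

text \<open>The variety \<open>F(v, w; v'')\<close>, with its underlying set \<open>orbit3 n v ` flag_triples n v w v''\<close>.\<close>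

definition flag_variety ::
    "nat \<Rightarrow> (nat \<Rightarrow> nat) \<Rightarrow> (nat \<Rightarrow> nat) \<Rightarrow> (nat \<Rightarrow> nat) \<Rightarrow>
      (rep \<times> graded_mat \<times> graded_sub) set topology" where
  "flag_variety n v w v'' = quotient_topology
     (subtopology
       (prod_topology (product_topology (\<lambda>h. mat_topology (v (snd h)) (v (fst h))) (edges n))
         (prod_topology (product_topology (\<lambda>i. mat_topology (w i) (v i)) (vertices n))
           (product_topology (\<lambda>i. grassmannian (v i) ((v - v'') i)) (vertices n))))
       (flag_triples n v w v''))
     (orbit3 n v)"

text \<open>The restrictions of \<open>x\<close> and \<open>j\<close> to \<open>S\<close> are transported to \<open>\<complex>\<^sup>d\<close>, \<open>d = v - v''\<close>, along all
  graded isomorphisms \<open>\<phi>\<close> from \<open>\<complex>\<^sup>d\<close> to \<open>S\<close>; the pairs so obtained form a single orbit.\<close>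

definition pi1 :: "nat \<Rightarrow> (nat \<Rightarrow> nat) \<Rightarrow> (nat \<Rightarrow> nat) \<Rightarrow> (nat \<Rightarrow> nat) \<Rightarrow>
    (rep \<times> graded_mat \<times> graded_sub) set \<Rightarrow> (rep \<times> graded_mat) set" where
  "pi1 n v w v'' q = {(x', j').
     x' \<in> rep_space n (v - v'') \<and> j' \<in> framing_space n (v - v'') w \<and>
     (\<exists>(x, j, S)\<in>q. \<exists>\<phi>.
        (\<forall>i\<in>vertices n. \<phi> i \<in> frames (v i) ((v - v'') i) \<and> col_span ((v - v'') i) (\<phi> i) = S i) \<and>
        (\<forall>h\<in>edges n. x h * \<phi> (fst h) = \<phi> (snd h) * x' h) \<and>
        (\<forall>i\<in>vertices n. j' i = j i * \<phi> i))}"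

definition pi2 :: "(rep \<times> graded_mat \<times> graded_sub) set \<Rightarrow> (rep \<times> graded_mat) set" where
  "pi2 q = (\<lambda>(x, j, S). (x, j)) ` q"

text \<open>Functions on a variety are extensional.\<close>

definition ind :: "'a set \<Rightarrow> 'a set \<Rightarrow> 'a \<Rightarrow> complex" where
  "ind A Z = (\<lambda>y\<in>A. indicator Z y)"

text \<open>Both operators are indexed by the larger dimension \<open>v\<close>: \<open>E_op n w v k\<close> maps functions on
  \<open>L(v, w)\<close> to functions on \<open>\<L>(v - e\<^sup>k, w)\<close>, and \<open>F_op n w v k\<close> goes the other way.  If
  \<open>v k = 0\<close>, then \<open>v - unit_dim k = v\<close> by truncation, but \<open>flag_variety\<close> is empty and both
  operators are zero.\<close>

definition E_op :: "nat \<Rightarrow> (nat \<Rightarrow> nat) \<Rightarrow> (nat \<Rightarrow> nat) \<Rightarrow> nat \<Rightarrow>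
    ((rep \<times> graded_mat) set \<Rightarrow> complex) \<Rightarrow> (rep \<times> graded_mat) set \<Rightarrow> complex" where
  "E_op n w v k f = (\<lambda>y\<in>quiver_variety n (v - unit_dim k) w.
     pushforward (flag_variety n v w (unit_dim k)) (pi1 n v w (unit_dim k)) (f \<circ> pi2) y)"

definition F_op :: "nat \<Rightarrow> (nat \<Rightarrow> nat) \<Rightarrow> (nat \<Rightarrow> nat) \<Rightarrow> nat \<Rightarrow>
    ((rep \<times> graded_mat) set \<Rightarrow> complex) \<Rightarrow> (rep \<times> graded_mat) set \<Rightarrow> complex" where
  "F_op n w v k g = (\<lambda>y\<in>quiver_variety n v w.
     pushforward (flag_variety n v w (unit_dim k)) pi2 (g \<circ> pi1 n v w (unit_dim k)) y)"

section \<open>String representations and irreducible components\<close>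

datatype spin_sign = Plus | Minus

definition spin_w :: "nat \<Rightarrow> spin_sign \<Rightarrow> nat \<Rightarrow> nat" where
  "spin_w n s = unit_dim (case s of Plus \<Rightarrow> n | Minus \<Rightarrow> n - 1)"

definition strict_partitions :: "nat \<Rightarrow> nat list set" where
  "strict_partitions n =
     {Y. sorted_wrt (>) Y \<and> (\<forall>l\<in>set Y. 0 < l) \<and> (Y \<noteq> [] \<longrightarrow> hd Y \<le> n - 1)}"

definition string_support :: "nat \<Rightarrow> nat \<times> nat \<Rightarrow> nat set" where
  "string_support n = (\<lambda>(k', k).
     if k \<le> n - 1 then {k'..k} else {k'..n - 2} \<union> {n})"

definition string_dim :: "nat \<Rightarrow> nat \<times> nat \<Rightarrow> nat \<Rightarrow> nat" where
  "string_dim n a i = (if i \<in> string_support n a then 1 else 0)"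

text \<open>In \<open>V(k', k)\<close> every edge of \<open>\<Omega>\<close> joining two degrees of the support carries one basis vector
  to the other; the matrix below is \<open>1 \<times> 1\<close> in that case and has no entries if an end point of the
  edge is outside the support.\<close>

definition string_rep :: "nat \<Rightarrow> nat \<times> nat \<Rightarrow> rep" where
  "string_rep n a = (\<lambda>h\<in>edges n.
     Matrix.mat (string_dim n a (snd h)) (string_dim n a (fst h))
       (\<lambda>_. if h \<in> Omega n then 1 else 0))"

definition string_of :: "nat \<Rightarrow> spin_sign \<Rightarrow> nat \<Rightarrow> nat \<Rightarrow> nat \<times> nat" where
  "string_of n s i l =
     (if (case s of Plus \<Rightarrow> odd i | Minus \<Rightarrow> even i)
      then (if l > 1 then (n - l, n) else (n, n))
      else (n - l, n - 1))"

text \<open>List positions start at \<open>0\<close>, the indices of \<open>l\<^sub>1 > \<dots> > l\<^sub>s\<close> at \<open>1\<close>.\<close>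

definition strings :: "nat \<Rightarrow> spin_sign \<Rightarrow> nat list \<Rightarrow> (nat \<times> nat) list" where
  "strings n s Y = map (\<lambda>t. string_of n s (t + 1) (Y ! t)) [0..<length Y]"

definition dim_of :: "nat \<Rightarrow> spin_sign \<Rightarrow> nat list \<Rightarrow> nat \<Rightarrow> nat" where
  "dim_of n s Y i = (\<Sum>a\<leftarrow>strings n s Y. string_dim n a i)"

definition strings_rep :: "nat \<Rightarrow> spin_sign \<Rightarrow> nat list \<Rightarrow> rep" where
  "strings_rep n s Y =
     (\<lambda>h\<in>edges n. diag_block_mat (map (\<lambda>a. string_rep n a h) (strings n s Y)))"

definition Omega_part :: "nat \<Rightarrow> (nat \<Rightarrow> nat) \<Rightarrow> rep \<Rightarrow> rep" where
  "Omega_part n v x =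
     (\<lambda>h\<in>edges n. if h \<in> Omega n then x h else 0\<^sub>m (v (snd h)) (v (fst h)))"

definition mat_trace :: "complex mat \<Rightarrow> complex" where
  "mat_trace A = (\<Sum>a<dim_row A. A $$ (a, a))"

definition symplectic_pairing :: "nat \<Rightarrow> rep \<Rightarrow> rep \<Rightarrow> complex" where
  "symplectic_pairing n x y = (\<Sum>h\<in>edges n. eps n h * mat_trace (x h * y (opp h)))"

text \<open>The tangent space at \<open>x\<close> of the \<open>G\<^sub>V\<close>-orbit through \<open>x\<close>: the image of the differential
  at \<open>1\<close> of \<open>g \<mapsto> g \<cdot> x\<close>.\<close>

definition orbit_tangent :: "nat \<Rightarrow> (nat \<Rightarrow> nat) \<Rightarrow> rep \<Rightarrow> rep set" where
  "orbit_tangent n v x =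
     {(\<lambda>h\<in>edges n. \<xi> (snd h) * x h - x h * \<xi> (fst h)) | \<xi>.
        \<xi> \<in> (\<Pi>\<^sub>E i\<in>vertices n. carrier_mat (v i) (v i))}"

text \<open>The fibre coordinate of \<open>x\<close> in the cotangent bundle is its part outside \<open>\<Omega>\<close>; pairing
  a tangent vector, which is supported on \<open>\<Omega>\<close>, with all of \<open>x\<close> sees only that part.\<close>

definition conormal_bundle :: "nat \<Rightarrow> (nat \<Rightarrow> nat) \<Rightarrow> rep \<Rightarrow> rep set" where
  "conormal_bundle n v x0 = {x \<in> rep_space n v.
     Omega_part n v x \<in> {act_rep n v g x0 | g. g \<in> GV n v} \<and>
     (\<forall>y\<in>orbit_tangent n v (Omega_part n v x). symplectic_pairing n y x = 0)}"

inductive_set rep_polynomials :: "nat \<Rightarrow> (nat \<Rightarrow> nat) \<Rightarrow> (rep \<Rightarrow> complex) set"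
  for n :: nat and v :: "nat \<Rightarrow> nat" where
  const: "(\<lambda>x. c) \<in> rep_polynomials n v"
| coord: "h \<in> edges n \<Longrightarrow> a < v (snd h) \<Longrightarrow> b < v (fst h) \<Longrightarrow>
    (\<lambda>x. x h $$ (a, b)) \<in> rep_polynomials n v"
| add: "p \<in> rep_polynomials n v \<Longrightarrow> q \<in> rep_polynomials n v \<Longrightarrow>
    (\<lambda>x. p x + q x) \<in> rep_polynomials n v"
| mult: "p \<in> rep_polynomials n v \<Longrightarrow> q \<in> rep_polynomials n v \<Longrightarrow>
    (\<lambda>x. p x * q x) \<in> rep_polynomials n v"

definition zariski_closure :: "nat \<Rightarrow> (nat \<Rightarrow> nat) \<Rightarrow> rep set \<Rightarrow> rep set" where
  "zariski_closure n v Z =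
     {x \<in> rep_space n v. \<forall>p\<in>rep_polynomials n v. (\<forall>z\<in>Z. p z = 0) \<longrightarrow> p x = 0}"

definition component :: "nat \<Rightarrow> spin_sign \<Rightarrow> nat list \<Rightarrow> (rep \<times> graded_mat) set set" where
  "component n s Y = (let v = dim_of n s Y; w = spin_w n s in
     orbit n v `
       ((zariski_closure n v (conormal_bundle n v (strings_rep n s Y)) \<times> framing_space n v w)
        \<inter> Lambda_st n v w))"

end

theory Submission
  imports Defs
begin

text \<open>Everything is controlled by the shifted staircase of boxes.  Number rows by \<open>r \<ge> 0\<close> and let \<open>t \<ge> 0\<close>
be the distance of a box from the diagonal; the box \<open>(r, t)\<close> is coloured by the vertex \<open>n - 1 - t\<close>
if \<open>t > 0\<close>, and diagonal boxes are coloured alternately by the two ends of the fork, beginning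
with the vertex that carries the framing (the tip).  A strict partition is an initial part of
this staircase, and its boxes, with the arrows ``one step left'' (along \<open>\<Omega>\<close>) and ``one step up''
(against \<open>\<Omega>\<close>), are a basis of a representation of the preprojective algebra whose part along
\<open>\<Omega>\<close> is the sum of the strings, one for each row.

Let \<open>(x, j)\<close> be any stable point for the framing at the tip.  Following the path from a box to the
first diagonal box and then applying \<open>j\<close> gives one linear functional for every box, and the
preprojective relations imply that these functionals (\<open>coord\<close> below) intertwine \<open>x\<close> with
the arrows between boxes (\<open>coord_arrow\<close>, \<open>coord_no_arrow\<close>).  Stability says that they are jointly
injective (\<open>coord_faithful\<close>).  At each vertex the path ``up and left again'' acts on
coordinates by the shift, and a space of sequences of bounded length that is invariant under the
shift consists of all sequences up to some length (\<open>shift_invariant_subspace\<close>).  Hence a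
subrepresentation of a stable point is cut out by coordinates and depends only on its graded
dimension, which is the colour count of an order ideal of the staircase (\<open>stable_subspace_eq\<close>,
\<open>stable_subspace_admissible\<close>).  Three things follow.

\<^item> Two stable points of the same dimension are conjugate, and stable points of dimension \<open>v\<close> exist
  if and only if \<open>v\<close> comes from a strict partition; so \<open>\<L>(v, w)\<close> is a point or empty
  (\<open>transporter\<close>, \<open>Lambda_st_nonempty_iff\<close>, \<open>admissible_dim_exists\<close>).
\<^item> The component \<open>X\<^sub>Y\<close> is this point, because the staircase representation lies in the conormal bundle
  (\<open>component_eq\<close>).
\<^item> If \<open>\<L>(v, w)\<close> and \<open>\<L>(v - v'', w)\<close> are both points, then there is exactly one orbit of flags
  between them (\<open>topspace_flag_variety\<close>, \<open>flag_triples_exists\<close>), and it projects to these points.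

So \<open>E\<^sub>k\<close> and \<open>F\<^sub>k\<close> integrate the constant \<open>1\<close> over a one-point space, whose Euler characteristic
is \<open>1\<close>, whenever source and target are points.  Otherwise the target is empty, or, for \<open>E\<^sub>k\<close> with
\<open>v\<^sub>k = 0\<close>, there are no flags at all.\<close>

unbundle no vec_syntax

section \<open>The Euler characteristic of a point\<close>

lemma abelian_rank_trivial:
  fixes G :: "('a, 'b) monoid_scheme" (structure)
  assumes "comm_group G" and triv: "carrier G = {\<one>\<^bsub>G\<^esub>}"
  shows "abelian_rank G = 0"
proof -
  interpret comm_group G by fact
  have "card B = 0" if B: "B \<subseteq> carrier G"
      and indep: "\<forall>c :: 'a \<Rightarrow> int. finprod G (\<lambda>b. b [^] c b) B = \<one> \<longrightarrow> (\<forall>b\<in>B. c b = 0)" for B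
  proof -
    have "finprod G (\<lambda>b. b [^] (1::int)) B = \<one>"
      by (rule finprod_one_eqI) (use B triv in auto)
    then have "\<forall>b\<in>B. (1::int) = 0" using indep by (auto dest: spec[of _ "\<lambda>_. 1"])
    then show ?thesis by auto
  qed
  moreover have "\<forall>c :: 'a \<Rightarrow> int. finprod G (\<lambda>b. b [^] c b) {} = \<one> \<longrightarrow> (\<forall>b\<in>{}. c b = 0)" by simp
  ultimately show ?thesis
    unfolding abelian_rank_def
    by (intro cSup_eq_maximum) (auto intro!: exI[of _ "{}"])
qed

text \<open>Two different elements of \<open>\<int>\<close> are dependent because each of them, taken as the coefficient of the
other with opposite signs, gives a relation; a generator is independent.\<close>

lemma abelian_rank_integer:
  fixes G :: "('a, 'b) monoid_scheme" (structure)
  assumes "comm_group G" and iso: "G \<cong> integer_group"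
  shows "abelian_rank G = 1"
proof -
  interpret comm_group G by fact
  obtain f where f: "f \<in> iso G integer_group" using iso by (auto simp: is_iso_def)
  interpret f: group_hom G integer_group f
    using f is_group group_integer_group
    by (auto simp: group_hom_def group_hom_axioms_def iso_def)
  have inj: "a = b" if "a \<in> carrier G" "b \<in> carrier G" "f a = f b" for a b
    using f that by (auto simp: iso_def bij_betw_def inj_on_def)
  have f_one: "f \<one> = 0" using f.hom_one by simp
  have f_pow: "f (a [^] (k::int)) = k * f a" if "a \<in> carrier G" for a k
    using f.hom_int_pow[OF that, of k] by (simp add: mult.commute)
  have le1: "card B \<le> 1" if fin: "finite B" and B: "B \<subseteq> carrier G"
      and indep: "\<forall>c :: 'a \<Rightarrow> int. finprod G (\<lambda>b. b [^] c b) B = \<one> \<longrightarrow> (\<forall>b\<in>B. c b = 0)" for B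
  proof (rule ccontr)
    assume "\<not> card B \<le> 1"
    then obtain a b where ab: "a \<in> B" "b \<in> B" "a \<noteq> b"
      using card_le_Suc0_iff_eq[OF fin] by auto
    \<comment> \<open>the relation \<open>f b * f a - f a * f b = 0\<close>\<close>
  define c :: "'a \<Rightarrow> int" where "c = (\<lambda>_. 0)(a := f b, b := - f a)"
    have carr: "a \<in> carrier G" "b \<in> carrier G" using ab B by auto
    have "finprod G (\<lambda>x. x [^] c x) B = finprod G (\<lambda>x. x [^] c x) {a, b}"
      by (rule finprod_mono_neutral_cong_right) (use fin B ab in \<open>auto simp: c_def\<close>)
    also have "\<dots> = a [^] f b \<otimes> b [^] (- f a)"
      using ab carr by (subst finprod_insert) (auto simp: c_def)
    finally have e: "finprod G (\<lambda>x. x [^] c x) B = a [^] f b \<otimes> b [^] (- f a)" .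
    have "f (a [^] f b \<otimes> b [^] (- f a)) = f (a [^] f b) + f (b [^] (- f a))"
      using f.hom_mult carr by simp
    also have "\<dots> = f \<one>" using carr by (simp only: f_pow f_one) simp
    finally have "a [^] f b \<otimes> b [^] (- f a) = \<one>"
      by (intro inj) (use carr in auto)
    then have "\<forall>x\<in>B. c x = 0" using indep e by auto
    then have "c a = 0" "c b = 0" using ab by auto
    then have "f a = f b" using ab(3) by (simp add: c_def)
    then show False using inj carr ab by auto
  qed
  obtain g where g: "g \<in> carrier G" "f g = 1"
    using f by (auto simp: iso_def bij_betw_def image_iff) (metis UNIV_I imageE)
  have "c g = 0" if "finprod G (\<lambda>b. b [^] c b) {g} = \<one>" for c :: "'a \<Rightarrow> int"
  proof -
    have "g [^] c g = \<one>" using that g(1) by (subst (asm) finprod_insert) auto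
    then have "f (g [^] c g) = 0" by (simp add: f_one)
    then show ?thesis using f_pow[OF g(1)] g(2) by simp
  qed
  then have "\<exists>B. card {g} = card B \<and> finite B \<and> B \<subseteq> carrier G \<and>
     (\<forall>c :: 'a \<Rightarrow> int. finprod G (\<lambda>b. b [^] c b) B = \<one> \<longrightarrow> (\<forall>b\<in>B. c b = 0))"
    using g(1) by (intro exI[of _ "{g}"]) auto
  then show ?thesis
    unfolding abelian_rank_def
    by (intro cSup_eq_maximum) (use le1 in auto)
qed

lemma euler_char_point:
  assumes "topspace X = {q}"
  shows "euler_char X = 1"
proof -
  have r0: "abelian_rank (homology_group 0 X) = 1"
    by (intro abelian_rank_integer abelian_homology_group homology_coefficients[OF assms])
  have rp: "abelian_rank (homology_group (int p) X) = 0" if "p \<noteq> 0" for p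
    using homology_dimension_axiom[OF assms, of "int p"] that
    by (intro abelian_rank_trivial abelian_homology_group) (auto simp: trivial_group_def)
  have "{p. abelian_rank (homology_group (int p) X) \<noteq> 0} = {0}"
    using r0 rp by (force simp: set_eq_iff)
  then show ?thesis by (simp add: euler_char_def r0)
qed

text \<open>On a one-point space only one level set is non-empty, and it is the whole space.\<close>

lemma pushforward_point:
  assumes "topspace X = {q}" and "\<pi> q = y" and "f q = 1"
  shows "pushforward X \<pi> f y = 1"
proof -
  have "topspace (subtopology X {r \<in> topspace X. \<pi> r = y \<and> f r = 1}) = {q}"
    using assms by auto
  from euler_char_point[OF this] show ?thesis
    using assms by (simp add: pushforward_def)
qed

lemma pushforward_empty: "topspace X = {} \<Longrightarrow> pushforward X \<pi> f y = 0"
  by (simp add: pushforward_def)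

section \<open>Subspaces, frames and coordinate functionals\<close>

abbreviation vec_subspace :: "nat \<Rightarrow> complex Matrix.vec set \<Rightarrow> bool" where
  "vec_subspace m S \<equiv> VectorSpace.subspace class_ring S (module_vec TYPE(complex) m)"

lemma vec_subspace_iff:
  "vec_subspace m S \<longleftrightarrow> S \<subseteq> carrier_vec m \<and> 0\<^sub>v m \<in> S \<and>
     (\<forall>u\<in>S. \<forall>w\<in>S. u + w \<in> S) \<and> (\<forall>c. \<forall>u\<in>S. c \<cdot>\<^sub>v u \<in> S)"
  using vec_vs[of m, where ?'a = complex] vec_module[of m, where ?'a = complex]
  by (auto simp: VectorSpace.subspace_def LinearCombinations.submodule_def module_vec_simps class_ring_simps)

lemma frame_linear_map:
  assumes A: "A \<in> carrier_mat m d"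
  shows "linear_map class_ring (module_vec TYPE(complex) d) (module_vec TYPE(complex) m) (\<lambda>u. A *\<^sub>v u)"
  using vec_vs[of m, where ?'a = complex] vec_module[of m, where ?'a = complex]
    vec_vs[of d, where ?'a = complex] vec_module[of d, where ?'a = complex] A
  by (auto simp: linear_map_def mod_hom_def mod_hom_axioms_def LinearCombinations.module_hom_def
      module_vec_simps class_ring_simps mult_add_distrib_mat_vec[OF A] mult_mat_vec[OF A])

lemma col_span_subspace:
  assumes A: "A \<in> carrier_mat m d"
  shows "vec_subspace m (col_span d A)"
proof -
  have "A *\<^sub>v 0\<^sub>v d = 0\<^sub>v m" using A by auto
  then have "0\<^sub>v m \<in> col_span d A" unfolding col_span_def by (metis imageI zero_carrier_vec)
  moreover have "u + w \<in> col_span d A" if "u \<in> col_span d A" "w \<in> col_span d A" for u w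
    using that mult_add_distrib_mat_vec[OF A] unfolding col_span_def
    by (smt (verit, best) add_carrier_vec image_iff)
  moreover have "c \<cdot>\<^sub>v u \<in> col_span d A" if "u \<in> col_span d A" for u c
    using that mult_mat_vec[OF A] unfolding col_span_def
    by (smt (verit, best) smult_carrier_vec image_iff)
  moreover have "col_span d A \<subseteq> carrier_vec m" using A unfolding col_span_def by auto
  ultimately show ?thesis by (simp add: vec_subspace_iff)
qed

text \<open>Frames take the place of bases: every subspace whose dimension is needed below is exhibited as the
column span of an injective matrix.\<close>

lemma dim_col_span_frame:
  assumes "A \<in> frames m d"
  shows "vectorspace.dim class_ring (module_vec TYPE(complex) m\<lparr>carrier := col_span d A\<rparr>) = d"
proof -
  have A: "A \<in> carrier_mat m d" and inj: "inj_on (\<lambda>u. A *\<^sub>v u) (carrier_vec d)"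
    using assms by (auto simp: frames_def)
  interpret T: linear_map class_ring "module_vec TYPE(complex) d" "module_vec TYPE(complex) m" "\<lambda>u. A *\<^sub>v u"
    by (rule frame_linear_map[OF A])
  interpret d: vec_space "TYPE(complex)" d .
  have fd: "T.V.fin_dim" by (rule d.fin_dim)
  have "vectorspace.dim class_ring (module_vec TYPE(complex) m\<lparr>carrier := T.im\<rparr>) = T.V.dim"
    using T.rank_nullity[OF fd] T.inj_imp_dim_ker0 inj by (simp add: module_vec_simps)
  moreover have "T.im = col_span d A"
    by (simp add: T.im_def col_span_def module_vec_simps)
  ultimately show ?thesis using d.dim_is_n by simp
qed

lemma frame_cancel_left:
  assumes A: "A \<in> frames m d" and B: "B \<in> carrier_mat d r" and C: "C \<in> carrier_mat d r"
    and eq: "A * B = A * C"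
  shows "B = C"
proof -
  have A': "A \<in> carrier_mat m d" using A by (simp add: frames_def)
  have "col B k = col C k" if k: "k < r" for k
  proof -
    have "A *\<^sub>v col B k = A *\<^sub>v col C k"
      using eq A' B C k by (metis carrier_matD(2) col_mult2)
    then show ?thesis using A B C k by (auto simp: frames_def inj_on_def)
  qed
  then show ?thesis using B C by (intro mat_col_eqI) auto
qed

definition linear_form :: "nat \<Rightarrow> (complex Matrix.vec \<Rightarrow> complex) \<Rightarrow> bool" where
  "linear_form m f \<longleftrightarrow>
     (\<forall>u\<in>carrier_vec m. \<forall>w\<in>carrier_vec m. f (u + w) = f u + f w) \<and>
     (\<forall>c. \<forall>u\<in>carrier_vec m. f (c \<cdot>\<^sub>v u) = c * f u)"

lemma linear_formD:
  assumes "linear_form m f" "u \<in> carrier_vec m"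
  shows "w \<in> carrier_vec m \<Longrightarrow> f (u + w) = f u + f w" and "f (c \<cdot>\<^sub>v u) = c * f u"
  using assms by (auto simp: linear_form_def)

lemma linear_form_zero: "linear_form m f \<Longrightarrow> f (0\<^sub>v m) = 0"
proof -
  assume f: "linear_form m f"
  have "0 \<cdot>\<^sub>v 0\<^sub>v m = (0\<^sub>v m :: complex Matrix.vec)" by auto
  then show ?thesis using linear_formD(2)[OF f, of "0\<^sub>v m" 0] by simp
qed

lemma linear_form_minus:
  assumes f: "linear_form m f" and u: "u \<in> carrier_vec m" and w: "w \<in> carrier_vec m"
  shows "f (u - w) = f u - f w"
proof -
  have "u - w = u + (-1) \<cdot>\<^sub>v w" using u w by auto
  then show ?thesis using linear_formD(1)[OF f u, of "(-1) \<cdot>\<^sub>v w"] linear_formD(2)[OF f w, of "-1"] w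
    by simp
qed

lemma linear_form_index: "i < m \<Longrightarrow> linear_form m (\<lambda>u. vec_index u i)"
  by (auto simp: linear_form_def)

lemma linear_form_mult_mat:
  assumes f: "linear_form m f" and A: "A \<in> carrier_mat m d"
  shows "linear_form d (\<lambda>u. f (A *\<^sub>v u))"
proof -
  have "A *\<^sub>v u \<in> carrier_vec m" if "u \<in> carrier_vec d" for u using A that by auto
  then show ?thesis
    unfolding linear_form_def
    by (auto simp: mult_add_distrib_mat_vec[OF A] mult_mat_vec[OF A] linear_formD[OF f])
qed

text \<open>The product of a matrix and a vector is the last partial sum of the columns, each scaled
  by its entry of the vector; this is the form in which linear combinations are built up below.\<close>

lemma mult_mat_vec_induct:
  fixes A :: "complex mat"
  assumes A: "A \<in> carrier_mat m d" and c: "c \<in> carrier_vec d"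
    and zero: "P 0 (0\<^sub>v m)"
    and step: "\<And>k u. k < d \<Longrightarrow> u \<in> carrier_vec m \<Longrightarrow> P k u \<Longrightarrow> P (Suc k) (u + vec_index c k \<cdot>\<^sub>v col A k)"
  shows "P d (A *\<^sub>v c)"
proof -
  define part where "part t = Matrix.vec m (\<lambda>i. \<Sum>k<t. vec_index c k * A $$ (i, k))" for t
  have "P t (part t)" if "t \<le> d" for t
    using that
  proof (induction t)
    case 0
    have "part 0 = 0\<^sub>v m" by (auto simp: part_def)
    then show ?case using zero by simp
  next
    case (Suc t)
    have "part (Suc t) = part t + vec_index c t \<cdot>\<^sub>v col A t"
      using Suc.prems A by (intro eq_vecI) (auto simp: part_def)
    then show ?case using step[of t "part t"] Suc by (simp add: part_def)
  qed
  moreover have "part d = A *\<^sub>v c"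
    using A c by (intro eq_vecI) (auto simp: part_def scalar_prod_def lessThan_atLeast0 mult.commute intro!: sum.cong)
  ultimately show ?thesis by (metis order_refl)
qed

lemma linear_form_mult_mat_vec:
  assumes f: "linear_form m f" and A: "A \<in> carrier_mat m d" and c: "c \<in> carrier_vec d"
  shows "f (A *\<^sub>v c) = (\<Sum>k<d. vec_index c k * f (col A k))"
proof (rule mult_mat_vec_induct[OF A c, where P = "\<lambda>t u. f u = (\<Sum>k<t. vec_index c k * f (col A k))"])
  show "f (0\<^sub>v m) = (\<Sum>k<0. vec_index c k * f (col A k))" using linear_form_zero[OF f] by simp
  show "f (u + vec_index c k \<cdot>\<^sub>v col A k) = (\<Sum>k<Suc k. vec_index c k * f (col A k))"
    if "k < d" "u \<in> carrier_vec m" "f u = (\<Sum>k<k. vec_index c k * f (col A k))" for k u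
    using that A by (simp add: linear_formD[OF f])
qed

lemma mult_mat_vec_in_subspace:
  assumes S: "vec_subspace m S" and A: "A \<in> carrier_mat m d" and c: "c \<in> carrier_vec d"
    and cols: "\<And>k. k < d \<Longrightarrow> col A k \<in> S"
  shows "A *\<^sub>v c \<in> S"
  by (rule mult_mat_vec_induct[OF A c, where P = "\<lambda>_ u. u \<in> S"])
    (use S cols in \<open>auto simp: vec_subspace_iff\<close>)

text \<open>If \<open>d - 1\<close> is the last coordinate that does not vanish on \<open>S\<close>, then shifting a vector on
  which it does not vanish gives, for every \<open>k < d\<close>, a vector in \<open>S\<close> whose last non-zero coordinate is
  number \<open>k\<close>.  These vectors are triangular with respect to the coordinates, so all sequences
  of length \<open>d\<close> occur as coordinates of vectors in \<open>S\<close>.\<close>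

lemma shift_invariant_subspace:
  assumes S: "vec_subspace m S"
    and lin: "\<And>i. linear_form m (\<phi> i)"
    and faithful: "\<And>u. u \<in> S \<Longrightarrow> (\<And>i. \<phi> i u = 0) \<Longrightarrow> u = 0\<^sub>v m"
    and shift: "\<And>u. u \<in> S \<Longrightarrow> \<exists>u'\<in>S. \<forall>i. \<phi> i u' = \<phi> (Suc i) u"
    and bound: "\<And>i u. u \<in> S \<Longrightarrow> N \<le> i \<Longrightarrow> \<phi> i u = 0"
  obtains d A where "A \<in> frames m d" and "col_span d A = S"
    and "\<And>i k. k < d \<Longrightarrow> \<phi> i (col A k) = (if i = k then 1 else 0)"
    and "\<And>i u. u \<in> S \<Longrightarrow> d \<le> i \<Longrightarrow> \<phi> i u = 0"
proof -
  have S_carr: "S \<subseteq> carrier_vec m" and S0: "0\<^sub>v m \<in> S"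
    and S_add: "\<And>u w. u \<in> S \<Longrightarrow> w \<in> S \<Longrightarrow> u + w \<in> S"
    and S_smult: "\<And>c u. u \<in> S \<Longrightarrow> c \<cdot>\<^sub>v u \<in> S"
    using S by (auto simp: vec_subspace_iff)
  \<comment> \<open>the length of the initial segment: one more than the last coordinate that occurs on \<open>S\<close>\<close>
  define d where "d = (LEAST d. \<forall>u\<in>S. \<forall>i\<ge>d. \<phi> i u = 0)"
  have d: "\<forall>u\<in>S. \<forall>i\<ge>d. \<phi> i u = 0"
    unfolding d_def by (rule LeastI[of _ N]) (use bound in auto)
  have shifts: "\<exists>u'\<in>S. \<forall>i. \<phi> i u' = \<phi> (i + r) u" if "u \<in> S" for u r
  proof (induction r)
    case 0
    then show ?case using that by auto
  next
    case (Suc r)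
    then obtain u' where "u' \<in> S" "\<forall>i. \<phi> i u' = \<phi> (i + r) u" by auto
    then show ?case using shift[of u'] by fastforce
  qed
  have leading: "\<exists>u\<in>S. \<phi> k u \<noteq> 0 \<and> (\<forall>i>k. \<phi> i u = 0)" if k: "k < d" for k
  proof -
    have "\<not> (\<forall>u\<in>S. \<forall>i\<ge>d - 1. \<phi> i u = 0)"
      using not_less_Least[of "d - 1" "\<lambda>d. \<forall>u\<in>S. \<forall>i\<ge>d. \<phi> i u = 0"] k unfolding d_def by linarith
    then obtain u i where u: "u \<in> S" "d - 1 \<le> i" "\<phi> i u \<noteq> 0" by auto
    have "i = d - 1"
    proof (rule ccontr)
      assume "i \<noteq> d - 1"
      then have "d \<le> i" using u(2) by simp
      then show False using d u by auto
    qed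
    obtain u' where u': "u' \<in> S" "\<forall>i. \<phi> i u' = \<phi> (i + (d - 1 - k)) u"
      using shifts[OF u(1)] by blast
    have "\<phi> k u' \<noteq> 0" using u' u k \<open>i = d - 1\<close> by simp
    moreover have "\<phi> i' u' = 0" if "i' > k" for i'
    proof -
      have "d \<le> i' + (d - 1 - k)" using that k by simp
      then show ?thesis using u'(2) d u(1) by auto
    qed
    ultimately show ?thesis using u'(1) by auto
  qed
  \<comment> \<open>back substitution in the triangular system given by the vectors above\<close>
  have solve: "\<exists>u\<in>S. \<forall>i. \<phi> i u = (if i < t then c i else 0)" if "t \<le> d" for t and c :: "nat \<Rightarrow> complex"
    using that
  proof (induction t arbitrary: c)
    case 0
    have "\<forall>i. \<phi> i (0\<^sub>v m) = 0" using linear_form_zero[OF lin] by blast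
    then show ?case using S0 by auto
  next
    case (Suc t)
    obtain u where u: "u \<in> S" "\<phi> t u \<noteq> 0" "\<forall>i>t. \<phi> i u = 0"
      using leading[of t] Suc.prems by auto
    define u' where "u' = (c t / \<phi> t u) \<cdot>\<^sub>v u"
    have u': "u' \<in> S" "\<phi> t u' = c t" "\<forall>i>t. \<phi> i u' = 0"
      using u S_smult S_carr by (auto simp: u'_def linear_formD(2)[OF lin])
    obtain z where z: "z \<in> S" "\<forall>i. \<phi> i z = (if i < t then c i - \<phi> i u' else 0)"
      using Suc.IH[of "\<lambda>i. c i - \<phi> i u'"] Suc.prems by auto
    have "\<phi> i (z + u') = (if i < Suc t then c i else 0)" for i
    proof -
      have "z \<in> carrier_vec m" "u' \<in> carrier_vec m" using z(1) u'(1) S_carr by auto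
      then have "\<phi> i (z + u') = \<phi> i z + \<phi> i u'" by (rule linear_formD(1)[OF lin])
      then show ?thesis using z u' by (auto simp: less_Suc_eq)
    qed
    then show ?case using S_add[OF z(1) u'(1)] by blast
  qed
  have "\<exists>b. \<forall>k<d. b k \<in> S \<and> (\<forall>i. \<phi> i (b k) = (if i = k then 1 else 0))"
  proof (intro choice allI)
    fix k
    show "\<exists>u. k < d \<longrightarrow> u \<in> S \<and> (\<forall>i. \<phi> i u = (if i = k then 1 else 0))"
    proof (cases "k < d")
      case True
      obtain u where "u \<in> S" "\<forall>i. \<phi> i u = (if i < d then (if i = k then 1 else 0) else 0)"
        using solve[of d "\<lambda>i. if i = k then 1 else 0"] by auto
      then show ?thesis using True by auto
    qed simp
  qed
  then obtain b where b: "\<And>k. k < d \<Longrightarrow> b k \<in> S"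
    "\<And>k i. k < d \<Longrightarrow> \<phi> i (b k) = (if i = k then 1 else 0)" by auto
  define A where "A = Matrix.mat m d (\<lambda>(i, k). vec_index (b k) i)"
  have A: "A \<in> carrier_mat m d" by (simp add: A_def)
  have col: "col A k = b k" if "k < d" for k
    using b(1)[OF that] S_carr that by (intro eq_vecI) (auto simp: A_def)
  have coord: "\<phi> i (A *\<^sub>v c) = (if i < d then vec_index c i else 0)" if "c \<in> carrier_vec d" for c i
  proof -
    have "\<phi> i (A *\<^sub>v c) = (\<Sum>k<d. vec_index c k * (if i = k then 1 else 0))"
      unfolding linear_form_mult_mat_vec[OF lin A that] by (rule sum.cong) (auto simp: col b(2))
    then show ?thesis by (simp add: if_distrib[of "\<lambda>x. _ * x"] cong: if_cong)
  qed
  have inS: "A *\<^sub>v c \<in> S" if "c \<in> carrier_vec d" for c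
    by (rule mult_mat_vec_in_subspace[OF S A that]) (simp add: col b(1))
  have "inj_on (\<lambda>u. A *\<^sub>v u) (carrier_vec d)"
  proof (rule inj_onI)
    fix u w assume u: "u \<in> carrier_vec d" and w: "w \<in> carrier_vec d" and eq: "A *\<^sub>v u = A *\<^sub>v w"
    show "u = w"
    proof (rule eq_vecI)
      show "vec_index u i = vec_index w i" if "i < dim_vec w" for i
        using coord[OF u, of i] coord[OF w, of i] eq that w by auto
    qed (use u w in auto)
  qed
  then have fr: "A \<in> frames m d" using A by (simp add: frames_def)
  have span: "col_span d A = S"
  proof
    show "col_span d A \<subseteq> S" using inS by (auto simp: col_span_def)
    show "S \<subseteq> col_span d A"
    proof
      fix u assume u: "u \<in> S"
      define c where "c = Matrix.vec d (\<lambda>i. \<phi> i u)"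
      have c: "c \<in> carrier_vec d" by (simp add: c_def)
      have uc: "u \<in> carrier_vec m" and Ac: "A *\<^sub>v c \<in> carrier_vec m" using u S_carr A c by auto
      have diff: "u + (-1) \<cdot>\<^sub>v (A *\<^sub>v c) \<in> S" by (intro S_add S_smult u inS c)
      have eq: "u + (-1) \<cdot>\<^sub>v (A *\<^sub>v c) = u - A *\<^sub>v c" using uc Ac by auto
      have "\<phi> i (u - A *\<^sub>v c) = 0" for i
      proof -
        have "\<phi> i (A *\<^sub>v c) = \<phi> i u" using coord[OF c, of i] d u by (auto simp: c_def)
        then show ?thesis by (simp add: linear_form_minus[OF lin uc Ac])
      qed
      then have z: "u - A *\<^sub>v c = 0\<^sub>v m" using faithful[OF diff] eq by simp
      have "u = A *\<^sub>v c"
      proof (rule eq_vecI)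
        show "vec_index u i = vec_index (A *\<^sub>v c) i" if "i < dim_vec (A *\<^sub>v c)" for i
        proof -
          have "i < m" using that A by simp
          then have "vec_index (u - A *\<^sub>v c) i = 0" using z by simp
          then show ?thesis using that by simp
        qed
      qed (use uc A in auto)
      then show "u \<in> col_span d A" using c by (auto simp: col_span_def)
    qed
  qed
  show thesis
    by (rule that[OF fr span]) (use col b(2) d in auto)
qed

section \<open>The staircase of boxes\<close>

lemma edges_iff: "h \<in> edges n \<longleftrightarrow> h \<in> Omega n \<or> opp h \<in> Omega n"
  by (cases h) (force simp: edges_def opp_def image_iff)

lemma opp_opp [simp]: "opp (opp h) = h" and fst_opp [simp]: "fst (opp h) = snd h"
  and snd_opp [simp]: "snd (opp h) = fst h"
  by (simp_all add: opp_def)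

lemma opp_edge [simp]: "opp h \<in> edges n \<longleftrightarrow> h \<in> edges n"
  by (auto simp: edges_iff)

lemma sum_of_bool_unique:
  fixes f :: "nat \<Rightarrow> complex"
  assumes "P b" "b < N" "\<And>c. P c \<Longrightarrow> c = b"
  shows "(\<Sum>c<N. of_bool (P c) * f c) = f b"
proof -
  have "(\<Sum>c<N. of_bool (P c) * f c) = (\<Sum>c<N. if c = b then f c else 0)"
  proof (rule sum.cong[OF refl])
    fix c
    show "of_bool (P c) * f c = (if c = b then f c else 0)"
      using assms(1) assms(3)[of c] by (cases "P c") auto
  qed
  then show ?thesis using assms(2) by simp
qed

lemma path_product_carrier:
  assumes "x \<in> rep_space n v" and "hs \<noteq> []" and "set hs \<subseteq> edges n"
    and "successively (\<lambda>h h'. snd h = fst h') hs"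
  shows "fold (\<lambda>h A. x h * A) hs (1\<^sub>m (v (fst (hd hs)))) \<in> carrier_mat (v (snd (last hs))) (v (fst (hd hs)))"
  using assms(2-)
proof (induction hs rule: rev_nonempty_induct)
  case (single h)
  then show ?case using assms(1) by (auto simp: rep_space_def PiE_iff)
next
  case (snoc h hs)
  have "x h \<in> carrier_mat (v (snd h)) (v (fst h))"
    using assms(1) snoc.prems by (auto simp: rep_space_def PiE_iff)
  then show ?case using snoc by (auto simp: successively_append_iff)
qed

text \<open>The hub is the vertex of valency three.  The tip is the end of the fork that carries the framing and
the cotip is the other end; since the two signs differ by the diagram automorphism that exchanges
the ends, all arguments are made once, in terms of tip and cotip.\<close>

locale type_D =
  fixes n :: nat and s :: spin_sign
  assumes n4: "4 \<le> n"
begin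

definition hub :: nat where "hub = n - 2"
definition tip :: nat where "tip = (case s of Plus \<Rightarrow> n | Minus \<Rightarrow> n - 1)"
definition cotip :: nat where "cotip = (case s of Plus \<Rightarrow> n - 1 | Minus \<Rightarrow> n)"

lemma hub_ge: "2 \<le> hub" and n_minus: "n - 2 = hub" "n - 1 = Suc hub" and Suc_hub: "Suc (Suc hub) = n"
  using n4 by (simp_all add: hub_def)

lemma tips: "tip = n \<and> cotip = Suc hub \<or> tip = Suc hub \<and> cotip = n"
  using n_minus(2) by (auto simp: tip_def cotip_def split: spin_sign.split)

lemma tips_gt: "hub < tip" "hub < cotip" and tips_neq [simp]: "tip \<noteq> cotip" "cotip \<noteq> tip"
  using tips Suc_hub by auto

lemma spin_w_eq: "spin_w n s = unit_dim tip"
  by (simp add: spin_w_def tip_def)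

lemma vertices_iff: "m \<in> vertices n \<longleftrightarrow> 1 \<le> m \<and> m \<le> hub \<or> m = tip \<or> m = cotip"
proof -
  have "m \<in> vertices n \<longleftrightarrow> 1 \<le> m \<and> m \<le> hub \<or> m = Suc hub \<or> m = n"
    using Suc_hub unfolding vertices_def atLeastAtMost_iff by linarith
  then show ?thesis using tips by auto
qed

lemma Omega_iff:
  "h \<in> Omega n \<longleftrightarrow> (\<exists>m. 1 \<le> m \<and> m < hub \<and> h = (m, Suc m)) \<or> h = (hub, tip) \<or> h = (hub, cotip)"
proof -
  have "Omega n = {(m, Suc m) | m. 1 \<le> m \<and> m < hub} \<union> {(hub, Suc hub), (hub, n)}"
    using hub_ge by (auto simp: Omega_def n_minus le_less)
  then show ?thesis using tips by auto
qed

lemma edges_cases_iff: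
  "h \<in> edges n \<longleftrightarrow>
     (\<exists>m. 1 \<le> m \<and> m < hub \<and> (h = (m, Suc m) \<or> h = (Suc m, m))) \<or>
     h \<in> {(hub, tip), (hub, cotip), (tip, hub), (cotip, hub)}"
  by (cases h) (auto simp: edges_iff opp_def Omega_iff)

lemma edge_vertices:
  assumes "h \<in> edges n"
  shows "fst h \<in> vertices n" "snd h \<in> vertices n"
  using assms hub_ge by (auto simp: edges_cases_iff vertices_iff)

lemma finite_edges [simp]: "finite (edges n)"
proof (rule finite_subset)
  show "edges n \<subseteq> vertices n \<times> vertices n" using edge_vertices by (auto simp: mem_Times_iff)
qed (simp add: vertices_def)

lemma OmegaI:
  "1 \<le> m \<Longrightarrow> m < hub \<Longrightarrow> (m, Suc m) \<in> Omega n" "(Suc m, m) \<notin> Omega n"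
  "(hub, tip) \<in> Omega n" "(hub, cotip) \<in> Omega n"
  "(tip, hub) \<notin> Omega n" "(cotip, hub) \<notin> Omega n"
  using tips_gt by (auto simp: Omega_iff)

lemma edgeI:
  "1 \<le> m \<Longrightarrow> m < hub \<Longrightarrow> (m, Suc m) \<in> edges n"
  "1 \<le> m \<Longrightarrow> m < hub \<Longrightarrow> (Suc m, m) \<in> edges n"
  "(hub, tip) \<in> edges n" "(hub, cotip) \<in> edges n"
  "(tip, hub) \<in> edges n" "(cotip, hub) \<in> edges n"
  by (auto simp: edges_cases_iff)

lemma edge_cases [consumes 1, case_names right left to_tip to_cotip from_tip from_cotip]:
  assumes "h \<in> edges n"
  obtains m where "1 \<le> m" "m < hub" "h = (m, Suc m)"
  | m where "1 \<le> m" "m < hub" "h = (Suc m, m)"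
  | "h = (hub, tip)" | "h = (hub, cotip)" | "h = (tip, hub)" | "h = (cotip, hub)"
  using assms unfolding edges_cases_iff by blast

lemma opp_Omega: "h \<in> edges n \<Longrightarrow> opp h \<in> Omega n \<longleftrightarrow> h \<notin> Omega n"
  by (cases rule: edge_cases) (auto simp: opp_def OmegaI)

lemma edge_iff:
  "(a, b) \<in> edges n \<longleftrightarrow>
     1 \<le> a \<and> a < hub \<and> b = Suc a \<or> 1 \<le> b \<and> b < hub \<and> a = Suc b \<or>
     a = hub \<and> (b = tip \<or> b = cotip) \<or> b = hub \<and> (a = tip \<or> a = cotip)"
  by (auto simp: edges_cases_iff)

lemma incoming:
  "{h \<in> edges n. snd h = 1} = {(2, 1)}"
  "1 \<le> i \<Longrightarrow> Suc i < hub \<Longrightarrow> {h \<in> edges n. snd h = Suc i} = {(i, Suc i), (Suc (Suc i), Suc i)}"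
  "{h \<in> edges n. snd h = hub} = {(hub - 1, hub), (tip, hub), (cotip, hub)}"
  "{h \<in> edges n. snd h = tip} = {(hub, tip)}"
  "{h \<in> edges n. snd h = cotip} = {(hub, cotip)}"
  using hub_ge tips_gt by (auto simp: edge_iff numeral_2_eq_2)

lemma eps_simps:
  "1 \<le> m \<Longrightarrow> m < hub \<Longrightarrow> eps n (m, Suc m) = 1" "eps n (Suc m, m) = - 1"
  "eps n (hub, tip) = 1" "eps n (hub, cotip) = 1"
  "eps n (tip, hub) = - 1" "eps n (cotip, hub) = - 1"
  by (simp_all add: eps_def OmegaI)

text \<open>At each vertex the boxes of its colour are numbered by \<open>a = 0, 1, \<dots>\<close> from the top.  On the arm every row
contains one box of each colour, while the colours of the diagonal boxes alternate between tip and
cotip.  So a pair \<open>(m, a)\<close> of a vertex and a number is a box, and its row is the following one.\<close>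

definition box_row :: "nat \<Rightarrow> nat \<Rightarrow> nat" where
  "box_row m a = (if m = tip then 2 * a else if m = cotip then Suc (2 * a) else a)"

lemma box_row_simps: "box_row tip a = 2 * a" "box_row cotip a = Suc (2 * a)" "m \<le> hub \<Longrightarrow> box_row m a = a"
  using tips_gt by (auto simp: box_row_def)

lemma box_row_inj: "box_row m a = box_row m b \<Longrightarrow> a = b"
  by (auto simp: box_row_def split: if_splits)

text \<open>There is an arrow along \<open>h\<close> from the box \<open>(fst h, b)\<close> to the box \<open>(snd h, a)\<close> if they are adjacent:
along \<open>\<Omega>\<close> the arrow goes one step left within a row, against \<open>\<Omega>\<close> one step up within a column.\<close>

definition arrow :: "edge \<Rightarrow> nat \<Rightarrow> nat \<Rightarrow> bool" where
  "arrow h a b \<longleftrightarrow>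
     (if h \<in> Omega n then box_row (snd h) a = box_row (fst h) b else box_row (fst h) b = Suc (box_row (snd h) a))"

lemma arrow_inj: "arrow h a b \<Longrightarrow> arrow h a c \<Longrightarrow> b = c"
  by (metis arrow_def box_row_inj)

lemma arrow_simps:
  "1 \<le> m \<Longrightarrow> m < hub \<Longrightarrow> arrow (m, Suc m) a b \<longleftrightarrow> b = a"
  "m < hub \<Longrightarrow> arrow (Suc m, m) a b \<longleftrightarrow> b = Suc a"
  "arrow (hub, tip) a b \<longleftrightarrow> b = 2 * a" "arrow (hub, cotip) a b \<longleftrightarrow> b = Suc (2 * a)"
  "arrow (tip, hub) a b \<longleftrightarrow> 2 * b = Suc a" "arrow (cotip, hub) a b \<longleftrightarrow> 2 * b = a"
  by (auto simp: arrow_def box_row_simps OmegaI)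

text \<open>These are the colour counts of the order ideals: the first \<open>d m\<close> boxes of each colour \<open>m\<close> are closed
under arrows.  The bound at the vertex \<open>1\<close> says that only the first row of the staircase is long enough to
contain a box of that colour.\<close>

definition admissible :: "(nat \<Rightarrow> nat) \<Rightarrow> bool" where
  "admissible d \<longleftrightarrow>
     d 1 \<le> 1 \<and> (\<forall>h\<in>edges n. \<forall>a b. arrow h a b \<and> b < d (fst h) \<longrightarrow> a < d (snd h))"

lemma admissibleD:
  assumes "admissible d"
  shows "d 1 \<le> 1" and "h \<in> edges n \<Longrightarrow> arrow h a b \<Longrightarrow> b < d (fst h) \<Longrightarrow> a < d (snd h)"
  using assms by (auto simp: admissible_def)

text \<open>The number of arrows on any path from a box to the first diagonal box; for \<open>m \<le> hub\<close> the second
summand is the distance from the diagonal.\<close>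

definition level :: "nat \<Rightarrow> nat \<Rightarrow> nat" where
  "level m a = 2 * box_row m a + (if m \<le> hub then Suc hub - m else 0)"

lemma level_simps: "m \<le> hub \<Longrightarrow> level m a = 2 * a + (Suc hub - m)"
  "level tip a = 4 * a" "level cotip a = 4 * a + 2"
  using tips_gt by (simp_all add: level_def box_row_simps)

lemma level_arrow:
  assumes "h \<in> edges n" "arrow h a b"
  shows "level (fst h) b = Suc (level (snd h) a)"
  using assms by (cases rule: edge_cases) (auto simp: level_simps arrow_simps)

section \<open>The point defined by the staircase\<close>

definition staircase_rep :: "(nat \<Rightarrow> nat) \<Rightarrow> rep" where
  "staircase_rep v = (\<lambda>h\<in>edges n. Matrix.mat (v (snd h)) (v (fst h)) (\<lambda>(a, b). of_bool (arrow h a b)))"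

definition staircase_framing :: "(nat \<Rightarrow> nat) \<Rightarrow> graded_mat" where
  "staircase_framing v =
     (\<lambda>i\<in>vertices n. Matrix.mat (unit_dim tip i) (v i) (\<lambda>(a, b). of_bool (b = 0)))"

lemma staircase_rep_space: "staircase_rep v \<in> rep_space n v"
  by (auto simp: staircase_rep_def rep_space_def)

lemma staircase_framing_space: "staircase_framing v \<in> framing_space n v (unit_dim tip)"
  by (auto simp: staircase_framing_def framing_space_def)

text \<open>A loop of length two at \<open>i\<close> moves a box to the box of the same colour in the previous row.  At
the tip, the cotip and the vertex \<open>1\<close> there is none.  Inside the arm there are two loops, ``left, then up'' and
``up, then left'', which have opposite signs; at the hub the loop through the arm is cancelled by the
loop through the tip or through the cotip, according to the parity of the row.\<close>

lemma staircase_moment: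
  assumes adm: "admissible v" and i: "i \<in> vertices n" and a: "a < v i" and b: "b < v i"
  shows "(\<Sum>h\<in>{h \<in> edges n. snd h = i}.
            eps n h * (staircase_rep v h * staircase_rep v (opp h)) $$ (a, b)) = 0"
proof -
  \<comment> \<open>whether the loop \<open>opp h\<close>, then \<open>h\<close>, leads from box number \<open>b\<close> to box number \<open>a\<close>\<close>
  define through where "through h \<longleftrightarrow> (\<exists>c. arrow h a c \<and> arrow (opp h) c b)" for h
  have entry: "(staircase_rep v h * staircase_rep v (opp h)) $$ (a, b) = of_bool (through h)"
    if h: "h \<in> edges n" "snd h = i" for h
  proof -
    have "(staircase_rep v h * staircase_rep v (opp h)) $$ (a, b)
        = (\<Sum>c<v (fst h). of_bool (arrow h a c) * of_bool (arrow (opp h) c b))"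
      using h a b by (auto simp: staircase_rep_def scalar_prod_def lessThan_atLeast0)
    also have "\<dots> = of_bool (through h)"
    proof (cases "through h")
      case True
      then obtain c where c: "arrow h a c" "arrow (opp h) c b" by (auto simp: through_def)
      have "c < v (fst h)" using admissibleD(2)[OF adm, of "opp h" c b] c h b by simp
      then have "(\<Sum>c<v (fst h). of_bool (arrow h a c) * of_bool (arrow (opp h) c b))
          = (of_bool (arrow (opp h) c b) :: complex)"
        using c arrow_inj by (intro sum_of_bool_unique) auto
      then show ?thesis using c True by simp
    next
      case False
      then have "of_bool (arrow h a c) * of_bool (arrow (opp h) c b) = (0 :: complex)" for c
        by (auto simp: through_def)
      then show ?thesis using False by (simp only: sum.neutral_const of_bool_eq)
    qed
    finally show ?thesis .
  qed
  have sum_eq: "(\<Sum>h\<in>{h \<in> edges n. snd h = i}.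
        eps n h * (staircase_rep v h * staircase_rep v (opp h)) $$ (a, b))
      = (\<Sum>h\<in>{h \<in> edges n. snd h = i}. eps n h * of_bool (through h))"
    by (intro sum.cong) (auto simp: entry)
  have through_iff: "through h \<longleftrightarrow> box_row i b = Suc (box_row i a) \<and>
      (\<exists>c. box_row (fst h) c = (if h \<in> Omega n then box_row i a else box_row i b))"
    if "h \<in> edges n" "snd h = i" for h
    using that opp_Omega[OF that(1)]
    by (cases "h \<in> Omega n") (simp_all add: through_def arrow_def, metis+)
  show ?thesis
  proof (cases "box_row i b = Suc (box_row i a)")
    case False
    then have "\<not> through h" if "h \<in> edges n" "snd h = i" for h
      using through_iff[OF that] by simp
    then show ?thesis unfolding sum_eq by (intro sum.neutral) auto
  next
    case True
    have "i \<noteq> 1"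
    proof
      assume "i = 1"
      then have "a = 0" "b = 0" using admissibleD(1)[OF adm] a b by auto
      then show False using True by simp
    qed
    moreover have "i \<noteq> tip" "i \<noteq> cotip" using True by (auto simp: box_row_simps) presburger+
    ultimately have i2: "1 < i" "i \<le> hub" using i by (auto simp: vertices_iff)
    obtain m where m: "i = Suc m" "1 \<le> m" "m < hub" using i2 by (cases i) auto
    have left: "through (m, Suc m)"
      using through_iff[of "(m, Suc m)"] True m by (simp add: edgeI OmegaI box_row_simps)
    show ?thesis
    proof (cases "i = hub")
      case False
      then have m': "Suc m < hub" using i2 m by simp
      have "through (Suc (Suc m), Suc m)"
        using through_iff[of "(Suc (Suc m), Suc m)"] True m m' by (simp add: edgeI OmegaI box_row_simps)
      then show ?thesis
        unfolding sum_eq unfolding m(1) incoming(2)[OF m(2) m'] using left m by (simp add: eps_simps)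
    next
      case i_hub: True
      have parity: "even b \<longleftrightarrow> (\<exists>c. 2 * c = b)" "odd b \<longleftrightarrow> (\<exists>c. Suc (2 * c) = b)"
        by presburger+
      have "through (tip, hub) \<longleftrightarrow> even b"
        unfolding parity(1) using through_iff[of "(tip, hub)"] True i_hub
        by (simp add: edgeI OmegaI box_row_simps)
      moreover have "through (cotip, hub) \<longleftrightarrow> odd b"
        unfolding parity(2) using through_iff[of "(cotip, hub)"] True i_hub
        by (simp add: edgeI OmegaI box_row_simps)
      moreover have "through (hub - 1, hub)" "eps n (hub - 1, hub) = 1"
        using left m i_hub eps_simps(1)[of m] by auto
      ultimately show ?thesis
        unfolding sum_eq unfolding i_hub incoming(3) using tips_gt
        by (cases "even b") (simp_all add: eps_simps)
    qed
  qed
qed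

lemma staircase_path_product:
  assumes "hs \<noteq> []" and "set hs \<subseteq> edges n" and "successively (\<lambda>h h'. snd h = fst h') hs"
    and "a < v (snd (last hs))" and "b < v (fst (hd hs))"
    and "fold (\<lambda>h A. staircase_rep v h * A) hs (1\<^sub>m (v (fst (hd hs)))) $$ (a, b) \<noteq> 0"
  shows "level (fst (hd hs)) b = level (snd (last hs)) a + length hs"
  using assms
proof (induction hs arbitrary: a rule: rev_nonempty_induct)
  case (single h)
  then have "arrow h a b" by (auto simp: staircase_rep_def)
  then show ?case using level_arrow[of h a b] single by simp
next
  case (snoc h hs)
  let ?A = "fold (\<lambda>h A. staircase_rep v h * A) hs (1\<^sub>m (v (fst (hd hs))))"
  have hs: "set hs \<subseteq> edges n" "successively (\<lambda>h h'. snd h = fst h') hs" "h \<in> edges n"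
    "snd (last hs) = fst h"
    using snoc.prems snoc.hyps by (auto simp: successively_append_iff)
  have A: "?A \<in> carrier_mat (v (fst h)) (v (fst (hd hs)))"
    using path_product_carrier[OF staircase_rep_space snoc.hyps hs(1,2)] hs(4) by simp
  have "(staircase_rep v h * ?A) $$ (a, b) \<noteq> 0" using snoc.prems(5) snoc.hyps by simp
  moreover have "(staircase_rep v h * ?A) $$ (a, b) = (\<Sum>c<v (fst h). of_bool (arrow h a c) * ?A $$ (c, b))"
    using A hs(3) snoc.prems(3,4) snoc.hyps
    by (auto simp: staircase_rep_def scalar_prod_def lessThan_atLeast0)
  ultimately obtain c where c: "c < v (fst h)" "of_bool (arrow h a c) * ?A $$ (c, b) \<noteq> 0"
    by (metis (no_types, lifting) lessThan_iff sum.neutral)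
  then have "arrow h a c" "?A $$ (c, b) \<noteq> 0" by auto
  then have "level (fst (hd hs)) b = level (snd (last hs)) c + length hs"
    using snoc.IH[of c] hs c(1) snoc.prems(4) snoc.hyps by simp
  then show ?case using level_arrow[OF hs(3) \<open>arrow h a c\<close>] hs(4) snoc.hyps by simp
qed

text \<open>Every arrow lowers the level by one, and the level is bounded on the boxes in use.\<close>

lemma staircase_nilpotent: "nilpotent_rep n v (staircase_rep v)"
proof -
  \<comment> \<open>a bound for the level of the boxes \<open>(m, b)\<close> with \<open>b < v m\<close>\<close>
  define N where "N = Suc (2 * Suc (2 * (\<Sum>m\<in>vertices n. v m)) + n)"
  have "fold (\<lambda>h A. staircase_rep v h * A) hs (1\<^sub>m (v (fst (hd hs)))) = 0\<^sub>m (v (snd (last hs))) (v (fst (hd hs)))"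
    if hs: "length hs = N" "set hs \<subseteq> edges n" "successively (\<lambda>h h'. snd h = fst h') hs" for hs
  proof (rule eq_matI)
    have ne: "hs \<noteq> []" using hs(1) by (auto simp: N_def)
    have carr: "fold (\<lambda>h A. staircase_rep v h * A) hs (1\<^sub>m (v (fst (hd hs)))) \<in> carrier_mat (v (snd (last hs))) (v (fst (hd hs)))"
      by (rule path_product_carrier[OF staircase_rep_space ne hs(2,3)])
    then show "dim_row (fold (\<lambda>h A. staircase_rep v h * A) hs (1\<^sub>m (v (fst (hd hs))))) = dim_row (0\<^sub>m (v (snd (last hs))) (v (fst (hd hs))))"
      "dim_col (fold (\<lambda>h A. staircase_rep v h * A) hs (1\<^sub>m (v (fst (hd hs))))) = dim_col (0\<^sub>m (v (snd (last hs))) (v (fst (hd hs))))"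
      by auto
    fix a b assume "a < dim_row (0\<^sub>m (v (snd (last hs))) (v (fst (hd hs))))" "b < dim_col (0\<^sub>m (v (snd (last hs))) (v (fst (hd hs))))"
    then have ab: "a < v (snd (last hs))" "b < v (fst (hd hs))" by auto
    have hd: "hd hs \<in> edges n" using ne hs(2) by auto
    have "level (fst (hd hs)) b < N"
    proof -
      have "v (fst (hd hs)) \<le> (\<Sum>m\<in>vertices n. v m)"
        by (rule member_le_sum) (use edge_vertices[OF hd] in \<open>auto simp: vertices_def\<close>)
      moreover have "box_row (fst (hd hs)) b \<le> Suc (2 * b)" by (auto simp: box_row_def)
      ultimately show ?thesis using ab(2) Suc_hub by (auto simp: level_def N_def)
    qed
    then show "fold (\<lambda>h A. staircase_rep v h * A) hs (1\<^sub>m (v (fst (hd hs)))) $$ (a, b)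
        = 0\<^sub>m (v (snd (last hs))) (v (fst (hd hs))) $$ (a, b)"
      using staircase_path_product[OF ne hs(2,3) ab] hs(1) ab by fastforce
  qed
  then show ?thesis unfolding nilpotent_rep_def by (intro exI[of _ N]) (auto simp: N_def)
qed

text \<open>That no arrow starts at the first diagonal box, and only there, is the reason why stability requires
\<open>j\<close> to detect exactly that box.\<close>

lemma arrow_from_box:
  assumes m: "m \<in> vertices n" and ne: "\<not> (m = tip \<and> a = 0)"
  obtains h a' where "h \<in> edges n" "fst h = m" "arrow h a' a"
proof -
  consider "1 \<le> m" "m < hub" | "m = hub" "even a" | "m = hub" "odd a"
    | "m = tip" | "m = cotip"
    using m by (auto simp: vertices_iff le_less)
  then show thesis
  proof cases
    case 1
    then show ?thesis using that[of "(m, Suc m)" a] by (simp add: edgeI arrow_simps)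
  next
    case 2
    then show ?thesis using that[of "(hub, tip)" "a div 2"] by (simp add: edgeI arrow_simps)
  next
    case 3
    then show ?thesis using that[of "(hub, cotip)" "a div 2"] by (simp add: edgeI arrow_simps)
  next
    case 4
    then show ?thesis using that[of "(tip, hub)" "2 * a - 1"] ne by (simp add: edgeI arrow_simps)
  next
    case 5
    then show ?thesis using that[of "(cotip, hub)" "2 * a"] by (simp add: edgeI arrow_simps)
  qed
qed

text \<open>The coordinates of a vector in a stable subspace of the kernel of \<open>j\<close> vanish by induction on the
level of the box: an arrow from that box carries the coordinate to a box of smaller level.\<close>

lemma staircase_stable:
  assumes adm: "admissible v" and S: "graded_subspace n v S" and st: "rep_stable n (staircase_rep v) S"
    and j: "\<forall>i\<in>vertices n. \<forall>u\<in>S i. staircase_framing v i *\<^sub>v u = 0\<^sub>v (unit_dim tip i)"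
    and m: "m \<in> vertices n"
  shows "S m = {0\<^sub>v (v m)}"
proof -
  have sub: "vec_subspace (v m) (S m)" if "m \<in> vertices n" for m
    using S that by (auto simp: graded_subspace_def)
  have entry: "vec_index u a = 0" if "m \<in> vertices n" "u \<in> S m" "a < v m" for m a u
    using that
  proof (induction "level m a" arbitrary: m a u rule: less_induct)
    case less
    have u: "u \<in> carrier_vec (v m)" using sub[OF less.prems(1)] less.prems(2) by (auto simp: vec_subspace_iff)
    show ?case
    proof (cases "m = tip \<and> a = 0")
      case True
      then have "vec_index (staircase_framing v tip *\<^sub>v u) 0 = 0"
        using j less.prems(1,2) by (auto simp: unit_dim_def)
      moreover have "vec_index (staircase_framing v tip *\<^sub>v u) 0 = (\<Sum>b<v tip. of_bool (b = 0) * vec_index u b)"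
        using less.prems(1) u True
        by (auto simp: staircase_framing_def unit_dim_def scalar_prod_def lessThan_atLeast0)
      moreover have "\<dots> = vec_index u 0"
        by (rule sum_of_bool_unique) (use True less.prems in auto)
      ultimately show ?thesis using True by simp
    next
      case False
      then obtain h a' where h: "h \<in> edges n" "fst h = m" "arrow h a' a"
        using arrow_from_box less.prems(1) by blast
      have a': "a' < v (snd h)" using admissibleD(2)[OF adm h(1,3)] h(2) less.prems(3) by simp
      have "staircase_rep v h *\<^sub>v u \<in> S (snd h)"
        using st h(1,2) less.prems(2) by (auto simp: rep_stable_def)
      then have "vec_index (staircase_rep v h *\<^sub>v u) a' = 0"
        using less.hyps[of "snd h" a'] level_arrow[OF h(1,3)] h(2) edge_vertices[OF h(1)] a' by simp
      moreover have "vec_index (staircase_rep v h *\<^sub>v u) a' = (\<Sum>b<v m. of_bool (arrow h a' b) * vec_index u b)"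
        using h a' u by (auto simp: staircase_rep_def scalar_prod_def lessThan_atLeast0)
      moreover have "\<dots> = vec_index u a"
        by (rule sum_of_bool_unique) (use h(3) arrow_inj less.prems(3) in auto)
      ultimately show ?thesis by simp
    qed
  qed
  show ?thesis
  proof
    show "S m \<subseteq> {0\<^sub>v (v m)}"
      using entry[OF m] sub[OF m] by (auto simp: vec_subspace_iff intro!: eq_vecI)
    show "{0\<^sub>v (v m)} \<subseteq> S m" using sub[OF m] by (auto simp: vec_subspace_iff)
  qed
qed

lemma staircase_in_Lambda_st:
  assumes "admissible v"
  shows "(staircase_rep v, staircase_framing v) \<in> Lambda_st n v (unit_dim tip)"
  using staircase_rep_space staircase_framing_space staircase_nilpotent staircase_moment[OF assms]
    staircase_stable[OF assms]
  unfolding Lambda_st_def Lambda_def by blast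

end

section \<open>Coordinates on a stable point\<close>

lemma rep_carrier:
  "x \<in> rep_space n v \<Longrightarrow> h \<in> edges n \<Longrightarrow> x h \<in> carrier_mat (v (snd h)) (v (fst h))"
  by (auto simp: rep_space_def PiE_iff)

lemma framing_carrier:
  "j \<in> framing_space n v w \<Longrightarrow> i \<in> vertices n \<Longrightarrow> j i \<in> carrier_mat (w i) (v i)"
  by (auto simp: framing_space_def PiE_iff)

lemma mat_eq_by_vectors:
  fixes A :: "complex mat"
  assumes A: "A \<in> carrier_mat m d" and B: "B \<in> carrier_mat m d"
    and eq: "\<And>u. u \<in> carrier_vec d \<Longrightarrow> A *\<^sub>v u = B *\<^sub>v u"
  shows "A = B"
proof (rule mat_col_eqI)
  fix k assume "k < dim_col B"
  then have k: "k < d" using B by simp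
  have "col A k = A *\<^sub>v unit_vec d k"
    using A k col_mult2[OF A one_carrier_mat k] by simp
  moreover have "col B k = B *\<^sub>v unit_vec d k"
    using B k col_mult2[OF B one_carrier_mat k] by simp
  ultimately show "col A k = col B k" using eq[of "unit_vec d k"] by simp
qed (use A B in auto)

lemma mult_mat_entry:
  fixes A :: "complex mat"
  assumes "A \<in> carrier_mat m d" "B \<in> carrier_mat d r" "a < m" "c < r"
  shows "(A * B) $$ (a, c) = (\<Sum>b<d. A $$ (a, b) * B $$ (b, c))"
  using assms by (simp add: scalar_prod_def lessThan_atLeast0)

lemma mult_mat_zero_vec: "A \<in> carrier_mat m d \<Longrightarrow> (A :: complex mat) *\<^sub>v 0\<^sub>v d = 0\<^sub>v m"
  by auto

lemma Lambda_moment_vec: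
  assumes x: "x \<in> Lambda n v" and i: "i \<in> vertices n" and a: "a < v i" and u: "u \<in> carrier_vec (v i)"
  shows "(\<Sum>h\<in>{h \<in> edges n. snd h = i}. eps n h * vec_index (x h *\<^sub>v (x (opp h) *\<^sub>v u)) a) = 0"
proof -
  have X: "x h \<in> carrier_mat (v (snd h)) (v (fst h))" if "h \<in> edges n" for h
    using x that by (auto simp: Lambda_def intro: rep_carrier)
  have entry: "vec_index (x h *\<^sub>v (x (opp h) *\<^sub>v u)) a
      = (\<Sum>b<v i. (x h * x (opp h)) $$ (a, b) * vec_index u b)" if h: "h \<in> edges n" "snd h = i" for h
  proof -
    have c: "x h \<in> carrier_mat (v i) (v (fst h))" "x (opp h) \<in> carrier_mat (v (fst h)) (v i)"
      using X[of h] X[of "opp h"] h by auto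
    have "x h *\<^sub>v (x (opp h) *\<^sub>v u) = (x h * x (opp h)) *\<^sub>v u"
      by (rule assoc_mult_mat_vec[symmetric, OF c u])
    moreover have "dim_row (x h * x (opp h)) = v i" "dim_col (x h * x (opp h)) = v i" using c by auto
    ultimately show ?thesis using a u by (simp add: scalar_prod_def lessThan_atLeast0)
  qed
  have "(\<Sum>h\<in>{h \<in> edges n. snd h = i}. eps n h * vec_index (x h *\<^sub>v (x (opp h) *\<^sub>v u)) a)
      = (\<Sum>h\<in>{h \<in> edges n. snd h = i}. \<Sum>b<v i. eps n h * (x h * x (opp h)) $$ (a, b) * vec_index u b)"
    by (rule sum.cong) (auto simp: entry sum_distrib_left mult.assoc)
  also have "\<dots> = (\<Sum>b<v i. (\<Sum>h\<in>{h \<in> edges n. snd h = i}. eps n h * (x h * x (opp h)) $$ (a, b)) * vec_index u b)"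
    by (subst sum.swap) (simp add: sum_distrib_right)
  also have "\<dots> = 0"
    using x i a by (intro sum.neutral) (auto simp: Lambda_def)
  finally show ?thesis .
qed

locale stable_point = type_D +
  fixes v :: "nat \<Rightarrow> nat" and x :: rep and j :: graded_mat
  assumes stable: "(x, j) \<in> Lambda_st n v (unit_dim tip)"
begin

lemma x_Lambda: "x \<in> Lambda n v" and j_framing: "j \<in> framing_space n v (unit_dim tip)"
  using stable by (auto simp: Lambda_st_def)

lemma x_rep: "x \<in> rep_space n v"
  using x_Lambda by (simp add: Lambda_def)

lemma x_carrier: "(a, b) \<in> edges n \<Longrightarrow> x (a, b) \<in> carrier_mat (v b) (v a)"
  using rep_carrier[OF x_rep, of "(a, b)"] by simp

lemma x_vec: "(a, b) \<in> edges n \<Longrightarrow> u \<in> carrier_vec (v a) \<Longrightarrow> x (a, b) *\<^sub>v u \<in> carrier_vec (v b)"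
  using x_carrier by (meson mult_mat_vec_carrier)

lemma x_zero: "(a, b) \<in> edges n \<Longrightarrow> x (a, b) *\<^sub>v 0\<^sub>v (v a) = 0\<^sub>v (v b)"
  using x_carrier by (rule mult_mat_zero_vec)

lemma hub_pred: "1 \<le> hub - 1" "hub - 1 < hub" "Suc (hub - 1) = hub"
  using hub_ge by auto

lemma hub_pred_edges: "(hub - 1, hub) \<in> edges n" "(hub, hub - 1) \<in> edges n"
  using edgeI(1,2)[OF hub_pred(1,2)] unfolding hub_pred(3) by auto

lemmas edges_intro = edgeI hub_pred_edges

lemma hub_moment:
  assumes u: "u \<in> carrier_vec (v hub)"
  shows "x (hub - 1, hub) *\<^sub>v (x (hub, hub - 1) *\<^sub>v u) =
    x (tip, hub) *\<^sub>v (x (hub, tip) *\<^sub>v u) + x (cotip, hub) *\<^sub>v (x (hub, cotip) *\<^sub>v u)"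
proof (rule eq_vecI)
  have hv: "hub \<in> vertices n" using hub_ge by (simp add: vertices_iff)
  have c: "x (hub - 1, hub) *\<^sub>v (x (hub, hub - 1) *\<^sub>v u) \<in> carrier_vec (v hub)"
    "x (tip, hub) *\<^sub>v (x (hub, tip) *\<^sub>v u) \<in> carrier_vec (v hub)"
    "x (cotip, hub) *\<^sub>v (x (hub, cotip) *\<^sub>v u) \<in> carrier_vec (v hub)"
    by (intro add_carrier_vec x_vec edges_intro u)+
  have e: "eps n (hub - 1, hub) = 1" using eps_simps(1)[OF hub_pred(1,2)] unfolding hub_pred(3) .
  show "dim_vec (x (hub - 1, hub) *\<^sub>v (x (hub, hub - 1) *\<^sub>v u)) =
    dim_vec (x (tip, hub) *\<^sub>v (x (hub, tip) *\<^sub>v u) + x (cotip, hub) *\<^sub>v (x (hub, cotip) *\<^sub>v u))"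
    using c by (simp only: c[THEN carrier_vecD] index_add_vec)
  fix a assume "a < dim_vec (x (tip, hub) *\<^sub>v (x (hub, tip) *\<^sub>v u) + x (cotip, hub) *\<^sub>v (x (hub, cotip) *\<^sub>v u))"
  then have a: "a < v hub" by (simp only: c[THEN carrier_vecD] index_add_vec)
  let ?L = "x (hub - 1, hub) *\<^sub>v (x (hub, hub - 1) *\<^sub>v u)"
  let ?M = "x (tip, hub) *\<^sub>v (x (hub, tip) *\<^sub>v u)"
  let ?N = "x (cotip, hub) *\<^sub>v (x (hub, cotip) *\<^sub>v u)"
  have ne: "(hub - 1, hub) \<notin> {(tip, hub), (cotip, hub)}" "(tip, hub) \<notin> {(cotip, hub)}"
    using tips_gt by auto
  have "vec_index ?L a - vec_index ?M a - vec_index ?N a = 0"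
    using Lambda_moment_vec[OF x_Lambda hv a u] unfolding incoming(3)
    by (simp only: sum.insert[OF _ ne(1)] sum.insert[OF _ ne(2)] finite.intros sum.empty
        opp_def fst_conv snd_conv eps_simps e) (simp add: eps_simps algebra_simps)
  moreover have "vec_index (?M + ?N) a = vec_index ?M a + vec_index ?N a"
    by (rule index_add_vec(1)) (simp only: c[THEN carrier_vecD] a)
  ultimately show "vec_index ?L a = vec_index (?M + ?N) a" by (simp add: algebra_simps)
qed

lemma arm_moment:
  assumes i: "1 \<le> i" "Suc i < hub" and u: "u \<in> carrier_vec (v (Suc i))"
  shows "x (i, Suc i) *\<^sub>v (x (Suc i, i) *\<^sub>v u) = x (Suc (Suc i), Suc i) *\<^sub>v (x (Suc i, Suc (Suc i)) *\<^sub>v u)"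
proof (rule eq_vecI)
  have hv: "Suc i \<in> vertices n" using i by (simp add: vertices_iff)
  have c: "x (i, Suc i) *\<^sub>v (x (Suc i, i) *\<^sub>v u) \<in> carrier_vec (v (Suc i))"
    "x (Suc (Suc i), Suc i) *\<^sub>v (x (Suc i, Suc (Suc i)) *\<^sub>v u) \<in> carrier_vec (v (Suc i))"
    using i by (auto intro!: x_vec edges_intro u)
  show "dim_vec (x (i, Suc i) *\<^sub>v (x (Suc i, i) *\<^sub>v u)) =
    dim_vec (x (Suc (Suc i), Suc i) *\<^sub>v (x (Suc i, Suc (Suc i)) *\<^sub>v u))" by (simp only: c[THEN carrier_vecD])
  fix a assume "a < dim_vec (x (Suc (Suc i), Suc i) *\<^sub>v (x (Suc i, Suc (Suc i)) *\<^sub>v u))"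
  then have a: "a < v (Suc i)" by (simp only: c[THEN carrier_vecD])
  show "vec_index (x (i, Suc i) *\<^sub>v (x (Suc i, i) *\<^sub>v u)) a =
    vec_index (x (Suc (Suc i), Suc i) *\<^sub>v (x (Suc i, Suc (Suc i)) *\<^sub>v u)) a"
    using Lambda_moment_vec[OF x_Lambda hv a u] c a i
    unfolding incoming(2)[OF i] by (simp add: opp_def eps_simps)
qed

text \<open>The moment map equation at a vertex with a single neighbour.\<close>

lemma end_moment:
  assumes i: "(i, t) \<in> edges n" and inc: "{h \<in> edges n. snd h = t} = {(i, t)}"
    and u: "u \<in> carrier_vec (v t)"
  shows "x (i, t) *\<^sub>v (x (t, i) *\<^sub>v u) = 0\<^sub>v (v t)"
proof (rule eq_vecI)
  have hv: "t \<in> vertices n" using edge_vertices(2)[OF i] by simp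
  have "(t, i) \<in> edges n" using i opp_edge[of "(i, t)" n] by (simp add: opp_def)
  then have c: "x (i, t) *\<^sub>v (x (t, i) *\<^sub>v u) \<in> carrier_vec (v t)"
    using i by (auto intro!: x_vec u)
  show "dim_vec (x (i, t) *\<^sub>v (x (t, i) *\<^sub>v u)) = dim_vec (0\<^sub>v (v t))" by (simp only: c[THEN carrier_vecD] index_zero_vec)
  fix a assume "a < dim_vec (0\<^sub>v (v t) :: complex Matrix.vec)"
  then have a: "a < v t" by auto
  show "vec_index (x (i, t) *\<^sub>v (x (t, i) *\<^sub>v u)) a = vec_index (0\<^sub>v (v t)) a"
    using Lambda_moment_vec[OF x_Lambda hv a u] c a
    unfolding inc by (auto simp: opp_def eps_def split: if_splits)
qed

text \<open>The coordinates are \<open>j\<close> composed with \<open>x\<close> along a path from a box to the first diagonal box.  At the hub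
such a path repeats ``up, then left'' until it arrives in the first row.\<close>

primrec hub_coord :: "nat \<Rightarrow> complex Matrix.vec \<Rightarrow> complex" where
  "hub_coord 0 u = vec_index (j tip *\<^sub>v (x (hub, tip) *\<^sub>v u)) 0"
| "hub_coord (Suc r) u = hub_coord r (x (hub - 1, hub) *\<^sub>v (x (hub, hub - 1) *\<^sub>v u))"

text \<open>The argument \<open>k\<close> is the distance of the vertex from the hub; the path first runs left to the hub.\<close>

primrec arm_coord :: "nat \<Rightarrow> nat \<Rightarrow> complex Matrix.vec \<Rightarrow> complex" where
  "arm_coord 0 r u = hub_coord r u"
| "arm_coord (Suc k) r u = arm_coord k r (x (hub - Suc k, hub - k) *\<^sub>v u)"

definition coord :: "nat \<Rightarrow> nat \<Rightarrow> complex Matrix.vec \<Rightarrow> complex" where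
  "coord m i u =
     (if m = tip
      then if i = 0 then vec_index (j tip *\<^sub>v u) 0 else hub_coord (2 * i - 1) (x (tip, hub) *\<^sub>v u)
      else if m = cotip then hub_coord (2 * i) (x (cotip, hub) *\<^sub>v u)
      else arm_coord (hub - m) i u)"

lemma coord_simps:
  "coord tip 0 u = vec_index (j tip *\<^sub>v u) 0"
  "0 < i \<Longrightarrow> coord tip i u = hub_coord (2 * i - 1) (x (tip, hub) *\<^sub>v u)"
  "coord cotip i u = hub_coord (2 * i) (x (cotip, hub) *\<^sub>v u)"
  "coord hub i u = hub_coord i u"
  "m \<le> hub \<Longrightarrow> coord m i u = arm_coord (hub - m) i u"
  using tips_gt by (auto simp: coord_def)

lemma j_tip: "j tip \<in> carrier_mat 1 (v tip)"
  using framing_carrier[OF j_framing, of tip] by (simp add: vertices_iff unit_dim_def)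

lemma linear_form_framing: "linear_form (v tip) (\<lambda>u. vec_index (j tip *\<^sub>v u) 0)"
  by (rule linear_form_mult_mat[OF linear_form_index j_tip]) simp

lemma linear_form_hub_coord: "linear_form (v hub) (hub_coord r)"
proof (induction r)
  case 0
  have "linear_form (v hub) (\<lambda>u. vec_index (j tip *\<^sub>v (x (hub, tip) *\<^sub>v u)) 0)"
    by (rule linear_form_mult_mat[OF linear_form_framing x_carrier[OF edgeI(3)]])
  then show ?case by simp
next
  case (Suc r)
  show ?case
    using linear_form_mult_mat[OF linear_form_mult_mat[OF Suc x_carrier[OF hub_pred_edges(1)]]
        x_carrier[OF hub_pred_edges(2)]] by simp
qed

lemma linear_form_arm_coord: "k < hub \<Longrightarrow> linear_form (v (hub - k)) (arm_coord k r)"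
proof (induction k)
  case 0
  then show ?case using linear_form_hub_coord[of r] by simp
next
  case (Suc k)
  have e: "(hub - Suc k, hub - k) \<in> edges n"
    using edgeI(1)[of "hub - Suc k"] Suc.prems by (simp add: Suc_diff_Suc)
  show ?case using linear_form_mult_mat[OF Suc.IH x_carrier[OF e]] Suc.prems by simp
qed

lemma linear_form_coord:
  assumes "m \<in> vertices n"
  shows "linear_form (v m) (coord m i)"
proof -
  consider "1 \<le> m" "m \<le> hub" | "m = tip" "i = 0" | "m = tip" "0 < i" | "m = cotip"
    using assms by (auto simp: vertices_iff)
  then show ?thesis
  proof cases
    case 1
    then have "coord m i = arm_coord (hub - m) i" by (intro ext) (simp add: coord_simps)
    then show ?thesis using linear_form_arm_coord[of "hub - m" i] 1 by simp
  next
    case 2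
    then have "coord m i = (\<lambda>u. vec_index (j tip *\<^sub>v u) 0)" by (intro ext) (simp add: coord_simps)
    then show ?thesis using linear_form_framing 2 by simp
  next
    case 3
    then have "coord m i = (\<lambda>u. hub_coord (2 * i - 1) (x (tip, hub) *\<^sub>v u))"
      by (intro ext) (simp add: coord_simps)
    then show ?thesis
      using linear_form_mult_mat[OF linear_form_hub_coord x_carrier[OF edgeI(5)]] 3 by simp
  next
    case 4
    then have "coord m i = (\<lambda>u. hub_coord (2 * i) (x (cotip, hub) *\<^sub>v u))"
      by (intro ext) (simp add: coord_simps)
    then show ?thesis
      using linear_form_mult_mat[OF linear_form_hub_coord x_carrier[OF edgeI(6)]] 4 by simp
  qed
qed

lemma coord_zero: "m \<in> vertices n \<Longrightarrow> coord m i (0\<^sub>v (v m)) = 0"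
  by (rule linear_form_zero[OF linear_form_coord])

lemma hub_coord_zero: "hub_coord r (0\<^sub>v (v hub)) = 0"
  by (rule linear_form_zero[OF linear_form_hub_coord])

lemma hub_coord_Suc:
  assumes "u \<in> carrier_vec (v hub)"
  shows "hub_coord (Suc r) u =
    hub_coord r (x (tip, hub) *\<^sub>v (x (hub, tip) *\<^sub>v u)) +
    hub_coord r (x (cotip, hub) *\<^sub>v (x (hub, cotip) *\<^sub>v u))"
  unfolding hub_coord.simps hub_moment[OF assms]
  by (intro linear_formD(1)[OF linear_form_hub_coord] x_vec edges_intro assms)

text \<open>By the moment map equation at the hub, each loop through the arm is the sum of the loops through the
tip and the cotip, and each of the two squares to zero by the equations at the ends.  Hence, in the functionals
above, only the summand in which the loops through tip and cotip alternate survives; the last loop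
before \<open>j\<close> has to pass through the cotip, since \<open>j\<close> is applied at the tip.\<close>

lemma hub_coord_loop_zero:
  assumes "u \<in> carrier_vec (v hub)"
  shows "even r \<Longrightarrow> hub_coord r (x (tip, hub) *\<^sub>v (x (hub, tip) *\<^sub>v u)) = 0"
    and "odd r \<Longrightarrow> hub_coord r (x (cotip, hub) *\<^sub>v (x (hub, cotip) *\<^sub>v u)) = 0"
  using assms
proof (induction r arbitrary: u)
  case 0
  {
    case 1
    have "x (hub, tip) *\<^sub>v (x (tip, hub) *\<^sub>v (x (hub, tip) *\<^sub>v u)) = 0\<^sub>v (v tip)"
      by (intro end_moment edges_intro incoming x_vec 1)
    then show ?case using mult_mat_zero_vec[OF j_tip] by simp
  next
    case 2
    then show ?case by simp
  }
next
  case (Suc r)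
  {
    case 1
    let ?w = "x (tip, hub) *\<^sub>v (x (hub, tip) *\<^sub>v u)"
    have w: "?w \<in> carrier_vec (v hub)" by (intro x_vec edges_intro 1)
    have "x (hub, tip) *\<^sub>v ?w = 0\<^sub>v (v tip)"
      by (intro end_moment edges_intro incoming x_vec 1)
    then show ?case
      unfolding hub_coord_Suc[OF w] using Suc.IH(2)[OF _ w] 1
      by (simp add: x_zero edgeI hub_coord_zero)
  next
    case 2
    let ?w = "x (cotip, hub) *\<^sub>v (x (hub, cotip) *\<^sub>v u)"
    have w: "?w \<in> carrier_vec (v hub)" by (intro x_vec edges_intro 2)
    have "x (hub, cotip) *\<^sub>v ?w = 0\<^sub>v (v cotip)"
      by (intro end_moment edges_intro incoming x_vec 2)
    then show ?case
      unfolding hub_coord_Suc[OF w] using Suc.IH(1)[OF _ w] 2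
      by (simp add: x_zero edgeI hub_coord_zero)
  }
qed

lemma coord_to_tip:
  assumes u: "u \<in> carrier_vec (v hub)"
  shows "coord tip a (x (hub, tip) *\<^sub>v u) = hub_coord (2 * a) u"
proof (cases a)
  case 0
  then show ?thesis by (simp add: coord_simps)
next
  case (Suc b)
  then show ?thesis
    using hub_coord_Suc[OF u, of "Suc (2 * b)"] hub_coord_loop_zero(2)[OF u, of "Suc (2 * b)"]
    by (simp add: coord_simps del: hub_coord.simps)
qed

lemma coord_to_cotip:
  assumes u: "u \<in> carrier_vec (v hub)"
  shows "coord cotip a (x (hub, cotip) *\<^sub>v u) = hub_coord (Suc (2 * a)) u"
  using hub_coord_Suc[OF u, of "2 * a"] hub_coord_loop_zero(1)[OF u, of "2 * a"]
  by (simp add: coord_simps del: hub_coord.simps)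

lemma coord_right:
  assumes "1 \<le> m" "m < hub"
  shows "coord (Suc m) a (x (m, Suc m) *\<^sub>v u) = coord m a u"
proof -
  obtain k where k: "hub = Suc (m + k)" using assms(2) less_iff_Suc_add by auto
  then have "hub - m = Suc k" "hub - Suc m = k" "hub - Suc k = m" "hub - k = Suc m" by auto
  then show ?thesis using assms by (simp add: coord_simps)
qed

text \<open>The equations along the arm push the loop ``up, then left'' towards the hub, where it is
absorbed into the definition of the coordinates.\<close>

lemma coord_left:
  assumes "1 \<le> m" "m < hub" and "u \<in> carrier_vec (v (Suc m))"
  shows "coord m a (x (Suc m, m) *\<^sub>v u) = coord (Suc m) (Suc a) u"
  using assms
proof (induction "hub - Suc m" arbitrary: m u)
  case 0
  then have m: "Suc m = hub" "m = hub - 1" by auto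
  have "coord m a (x (Suc m, m) *\<^sub>v u) = coord (Suc m) a (x (m, Suc m) *\<^sub>v (x (Suc m, m) *\<^sub>v u))"
    using coord_right[OF 0(2,3)] by simp
  then show ?case unfolding m(1) using m by (simp add: coord_simps)
next
  case (Suc k)
  have m: "Suc m < hub" using Suc.hyps(2) by simp
  have "coord m a (x (Suc m, m) *\<^sub>v u) = coord (Suc m) a (x (m, Suc m) *\<^sub>v (x (Suc m, m) *\<^sub>v u))"
    using coord_right[OF Suc.prems(1,2)] by simp
  also have "\<dots> = coord (Suc m) a (x (Suc (Suc m), Suc m) *\<^sub>v (x (Suc m, Suc (Suc m)) *\<^sub>v u))"
    using arm_moment[OF Suc.prems(1) m Suc.prems(3)] by simp
  also have "\<dots> = coord (Suc (Suc m)) (Suc a) (x (Suc m, Suc (Suc m)) *\<^sub>v u)"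
    by (rule Suc.hyps(1)) (use Suc m in \<open>auto intro!: x_vec edges_intro\<close>)
  also have "\<dots> = coord (Suc m) (Suc a) u" using coord_right[of "Suc m"] m by simp
  finally show ?case .
qed

text \<open>Together with the next lemma: the coordinates are a morphism of representations from \<open>V\<close> to the
space with basis all boxes.\<close>

lemma coord_arrow:
  assumes h: "h \<in> edges n" and u: "u \<in> carrier_vec (v (fst h))" and ar: "arrow h a b"
  shows "coord (snd h) a (x h *\<^sub>v u) = coord (fst h) b u"
  using h
proof (cases rule: edge_cases)
  case (right m)
  then show ?thesis using coord_right[of m a u] ar by (simp add: arrow_simps)
next
  case (left m)
  then show ?thesis using coord_left[of m u a] ar u by (simp add: arrow_simps)
next
  case to_tip
  then show ?thesis using coord_to_tip[of u a] ar u by (simp add: arrow_simps coord_simps)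
next
  case to_cotip
  then show ?thesis using coord_to_cotip[of u a] ar u by (simp add: arrow_simps coord_simps)
next
  case from_tip
  then have "2 * b = Suc a" using ar by (simp add: arrow_simps)
  then have "0 < b" "2 * b - 1 = a" by auto
  then show ?thesis using from_tip by (simp add: coord_simps)
next
  case from_cotip
  then show ?thesis using ar u by (auto simp: arrow_simps coord_simps)
qed

lemma coord_no_arrow:
  assumes h: "h \<in> edges n" and u: "u \<in> carrier_vec (v (fst h))" and ar: "\<And>b. \<not> arrow h a b"
  shows "coord (snd h) a (x h *\<^sub>v u) = 0"
  using h
proof (cases rule: edge_cases)
  case from_tip
  then have "2 * b \<noteq> Suc a" for b using ar[of b] by (simp add: arrow_simps)
  then have "even a" by presburger
  then obtain c where c: "a = 2 * c" by (auto elim: evenE)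
  have ut: "u \<in> carrier_vec (v tip)" using u from_tip by simp
  have w: "x (tip, hub) *\<^sub>v u \<in> carrier_vec (v hub)" by (intro x_vec edges_intro ut)
  have "x (hub, tip) *\<^sub>v (x (tip, hub) *\<^sub>v u) = 0\<^sub>v (v tip)"
    by (intro end_moment edges_intro incoming ut)
  then show ?thesis
    using coord_to_tip[OF w, of c] from_tip c coord_zero[of tip c]
    by (simp add: coord_simps vertices_iff)
next
  case from_cotip
  then have "2 * b \<noteq> a" for b using ar[of b] by (simp add: arrow_simps)
  then have "odd a" by auto
  then obtain c where c: "a = Suc (2 * c)" by (auto elim: oddE)
  have ut: "u \<in> carrier_vec (v cotip)" using u from_cotip by simp
  have w: "x (cotip, hub) *\<^sub>v u \<in> carrier_vec (v hub)" by (intro x_vec edges_intro ut)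
  have "x (hub, cotip) *\<^sub>v (x (cotip, hub) *\<^sub>v u) = 0\<^sub>v (v cotip)"
    by (intro end_moment edges_intro incoming ut)
  then show ?thesis
    using coord_to_cotip[OF w, of c] from_cotip c coord_zero[of cotip c]
    by (simp add: coord_simps vertices_iff del: hub_coord.simps)
qed (use ar in \<open>auto simp: arrow_simps\<close>)

text \<open>The equation at the vertex \<open>1\<close> annihilates all coordinates at that vertex but the first one, and
arrows against \<open>\<Omega>\<close> carry this to the other vertices of the arm.\<close>

lemma coord_arm_bound:
  assumes "1 \<le> m" "m \<le> hub" "m \<le> i" "u \<in> carrier_vec (v m)"
  shows "coord m i u = 0"
  using assms
proof (induction m arbitrary: i u)
  case 0
  then show ?case by simp
next
  case (Suc m)
  obtain a where a: "i = Suc a" using Suc.prems(3) by (cases i) auto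
  show ?case
  proof (cases "m = 0")
    case True
    have one: "1 < hub" using hub_ge by simp
    have u: "u \<in> carrier_vec (v 1)" using Suc.prems(4) True by simp
    have e: "(1, 2) \<in> edges n" "(2, 1) \<in> edges n"
      using edgeI(1,2)[of 1] one by (simp_all add: numeral_2_eq_2)
    have "coord 1 (Suc a) u = coord 2 (Suc a) (x (1, 2) *\<^sub>v u)"
      using coord_right[of 1] one by (simp add: numeral_2_eq_2)
    also have "\<dots> = coord 1 a (x (2, 1) *\<^sub>v (x (1, 2) *\<^sub>v u))"
      using coord_left[of 1 "x (1, 2) *\<^sub>v u" a] x_vec[OF e(1) u] one by (simp add: numeral_2_eq_2)
    also have "\<dots> = 0"
      unfolding end_moment[OF e(2) incoming(1) u] using hub_ge by (intro coord_zero) (auto simp: vertices_iff)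
    finally show ?thesis using True a by simp
  next
    case False
    then have m: "1 \<le> m" "m < hub" using Suc.prems by auto
    have "coord m a (x (Suc m, m) *\<^sub>v u) = 0"
      by (rule Suc.IH) (use m Suc.prems a in \<open>auto intro!: x_vec edges_intro\<close>)
    then show ?thesis using coord_left[OF m Suc.prems(4), of a] a by simp
  qed
qed

lemma coord_bound:
  assumes m: "m \<in> vertices n" and i: "n \<le> i" and u: "u \<in> carrier_vec (v m)"
  shows "coord m i u = 0"
proof -
  consider "1 \<le> m" "m \<le> hub" | "m = tip" | "m = cotip" using m by (auto simp: vertices_iff)
  then show ?thesis
  proof cases
    case 1
    then show ?thesis using coord_arm_bound[of m i u] i u Suc_hub by simp
  next
    case 2
    have "coord hub (2 * i - 1) (x (tip, hub) *\<^sub>v u) = 0"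
      by (rule coord_arm_bound) (use 2 u i hub_ge Suc_hub in \<open>auto intro!: x_vec edges_intro\<close>)
    then show ?thesis using 2 i n4 by (simp add: coord_simps)
  next
    case 3
    have "coord hub (2 * i) (x (cotip, hub) *\<^sub>v u) = 0"
      by (rule coord_arm_bound) (use 3 u i hub_ge Suc_hub in \<open>auto intro!: x_vec edges_intro\<close>)
    then show ?thesis using 3 by (simp add: coord_simps)
  qed
qed

text \<open>The common kernel of all coordinates is a stable subspace, and \<open>j\<close> vanishes on it because \<open>j\<close> is
the first coordinate at the tip.\<close>

lemma coord_faithful:
  assumes m: "m \<in> vertices n" and u: "u \<in> carrier_vec (v m)" and z: "\<And>i. coord m i u = 0"
  shows "u = 0\<^sub>v (v m)"
proof -
  define K where "K = (\<lambda>m\<in>vertices n. {u \<in> carrier_vec (v m). \<forall>i. coord m i u = 0})"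
  have "vec_subspace (v m) (K m)" if "m \<in> vertices n" for m
    using that by (auto simp: K_def vec_subspace_iff coord_zero linear_formD[OF linear_form_coord])
  then have 1: "graded_subspace n v K" by (auto simp: graded_subspace_def K_def)
  have 2: "rep_stable n x K"
    unfolding rep_stable_def
  proof (intro ballI)
    fix h u assume h: "h \<in> edges n" and u: "u \<in> K (fst h)"
    then have u: "u \<in> carrier_vec (v (fst h))" "\<And>i. coord (fst h) i u = 0"
      using edge_vertices[OF h] by (auto simp: K_def)
    have "coord (snd h) a (x h *\<^sub>v u) = 0" for a
      using coord_arrow[OF h u(1), of a] coord_no_arrow[OF h u(1), of a] u(2) by metis
    moreover have "x h *\<^sub>v u \<in> carrier_vec (v (snd h))" using x_vec[of "fst h" "snd h"] h u by simp
    ultimately show "x h *\<^sub>v u \<in> K (snd h)" using edge_vertices[OF h] by (simp add: K_def)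
  qed
  have 3: "j i *\<^sub>v u = 0\<^sub>v (unit_dim tip i)" if "i \<in> vertices n" "u \<in> K i" for i u
  proof (rule eq_vecI)
    have ji: "j i \<in> carrier_mat (unit_dim tip i) (v i)" by (rule framing_carrier[OF j_framing that(1)])
    then show "dim_vec (j i *\<^sub>v u) = dim_vec (0\<^sub>v (unit_dim tip i))" by auto
    fix a assume "a < dim_vec (0\<^sub>v (unit_dim tip i) :: complex Matrix.vec)"
    then have "i = tip" "a = 0" by (auto simp: unit_dim_def split: if_splits)
    moreover have "coord i 0 u = 0" using that by (auto simp: K_def)
    ultimately show "vec_index (j i *\<^sub>v u) a = vec_index (0\<^sub>v (unit_dim tip i)) a"
      by (simp add: coord_simps unit_dim_def)
  qed
  have "\<forall>i\<in>vertices n. K i = {0\<^sub>v (v i)}"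
    using stable 1 2 3 unfolding Lambda_st_def by blast
  moreover have "u \<in> K m" using m u z by (simp add: K_def)
  ultimately show ?thesis using m by blast
qed

lemma coord_separates:
  assumes m: "m \<in> vertices n" and u: "u \<in> carrier_vec (v m)" and w: "w \<in> carrier_vec (v m)"
    and eq: "\<And>i. coord m i u = coord m i w"
  shows "u = w"
proof -
  have "u - w = 0\<^sub>v (v m)"
    by (rule coord_faithful[OF m])
      (use u w eq in \<open>auto simp: linear_form_minus[OF linear_form_coord[OF m] u w]\<close>)
  show ?thesis
  proof (rule eq_vecI)
    show "vec_index u i = vec_index w i" if "i < dim_vec w" for i
    proof -
      have "vec_index (u - w) i = 0" using \<open>u - w = 0\<^sub>v (v m)\<close> that w by simp
      then show ?thesis using that by simp
    qed
  qed (use u w in auto)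
qed

text \<open>The shift is realised by going up to the previous row and left back to the same colour.  At the
ends of the fork this takes four steps, because the next diagonal box has the other colour.  At the
vertex \<open>1\<close>, where only one coordinate is non-zero, the zero vector serves.\<close>

lemma coord_shift:
  assumes m: "m \<in> vertices n" and S: "graded_subspace n v S" and st: "rep_stable n x S" and u: "u \<in> S m"
  shows "\<exists>u'\<in>S m. \<forall>i. coord m i u' = coord m (Suc i) u"
proof -
  have sub: "vec_subspace (v k) (S k)" if "k \<in> vertices n" for k
    using S that by (auto simp: graded_subspace_def)
  have Sc: "w \<in> carrier_vec (v k)" if "k \<in> vertices n" "w \<in> S k" for k w
    using sub[OF that(1)] that(2) by (auto simp: vec_subspace_iff)
  have step: "x (a, b) *\<^sub>v w \<in> S b" if "(a, b) \<in> edges n" "w \<in> S a" for a b w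
    using st that by (auto simp: rep_stable_def)
  have coord_step: "coord b i (x (a, b) *\<^sub>v w) = coord a i' w"
    if "(a, b) \<in> edges n" "w \<in> S a" "arrow (a, b) i i'" for a b i i' w
    using coord_arrow[OF that(1) _ that(3)] Sc edge_vertices[OF that(1)] that(2) by simp
  consider "m = 1" | k where "m = Suc k" "1 \<le> k" "k < hub" | "m = tip" | "m = cotip"
    using m by (cases m) (auto simp: vertices_iff Suc_le_eq)
  then show ?thesis
  proof cases
    case 1
    have "coord m (Suc i) u = 0" for i
      using coord_arm_bound[of m "Suc i" u] 1 hub_ge Sc[OF m u] by simp
    moreover have "0\<^sub>v (v m) \<in> S m" using sub[OF m] by (auto simp: vec_subspace_iff)
    ultimately show ?thesis using coord_zero[OF m] by auto
  next
    case (2 k)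
    have e: "(Suc k, k) \<in> edges n" "(k, Suc k) \<in> edges n" using 2 edgeI by auto
    show ?thesis
    proof (intro bexI allI)
      show "x (k, Suc k) *\<^sub>v (x (Suc k, k) *\<^sub>v u) \<in> S m" using step e u 2 by simp
      show "coord m i (x (k, Suc k) *\<^sub>v (x (Suc k, k) *\<^sub>v u)) = coord m (Suc i) u" for i
        using coord_step[OF e(2) step[OF e(1)], of u i i] coord_step[OF e(1), of u i "Suc i"] u 2
        by (simp add: arrow_simps)
    qed
  next
    case 3
    define k where "k = hub - 1"
    have k: "hub = Suc k" "1 \<le> k" "k < hub" using hub_ge by (auto simp: k_def)
    have e: "(tip, hub) \<in> edges n" "(hub, k) \<in> edges n" "(k, hub) \<in> edges n" "(hub, tip) \<in> edges n"
      using edgeI edgeI(1,2)[OF k(2,3)] by (auto simp: k(1)[symmetric])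
    have ar: "arrow (hub, k) a b \<longleftrightarrow> b = Suc a" "arrow (k, hub) a b \<longleftrightarrow> b = a" for a b
      using arrow_simps(1)[OF k(2,3)] arrow_simps(2)[OF k(3)] by (auto simp: k(1)[symmetric])
    have s1: "x (tip, hub) *\<^sub>v u \<in> S hub" using step[OF e(1)] u 3 by simp
    note s2 = step[OF e(2) s1] note s3 = step[OF e(3) s2] note s4 = step[OF e(4) s3]
    show ?thesis
    proof (intro bexI allI)
      show "x (hub, tip) *\<^sub>v (x (k, hub) *\<^sub>v (x (hub, k) *\<^sub>v (x (tip, hub) *\<^sub>v u))) \<in> S m" using s4 3 by simp
      show "coord m i (x (hub, tip) *\<^sub>v (x (k, hub) *\<^sub>v (x (hub, k) *\<^sub>v (x (tip, hub) *\<^sub>v u)))) = coord m (Suc i) u" for i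
        using coord_step[OF e(4) s3, of i "2 * i"] coord_step[OF e(3) s2, of "2 * i" "2 * i"]
          coord_step[OF e(2) s1, of "2 * i" "Suc (2 * i)"] coord_step[OF e(1), of u "Suc (2 * i)" "Suc i"] u 3
        by (simp add: arrow_simps ar)
    qed
  next
    case 4
    define k where "k = hub - 1"
    have k: "hub = Suc k" "1 \<le> k" "k < hub" using hub_ge by (auto simp: k_def)
    have e: "(cotip, hub) \<in> edges n" "(hub, k) \<in> edges n" "(k, hub) \<in> edges n" "(hub, cotip) \<in> edges n"
      using edgeI edgeI(1,2)[OF k(2,3)] by (auto simp: k(1)[symmetric])
    have ar: "arrow (hub, k) a b \<longleftrightarrow> b = Suc a" "arrow (k, hub) a b \<longleftrightarrow> b = a" for a b
      using arrow_simps(1)[OF k(2,3)] arrow_simps(2)[OF k(3)] by (auto simp: k(1)[symmetric])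
    have s1: "x (cotip, hub) *\<^sub>v u \<in> S hub" using step[OF e(1)] u 4 by simp
    note s2 = step[OF e(2) s1] note s3 = step[OF e(3) s2] note s4 = step[OF e(4) s3]
    show ?thesis
    proof (intro bexI allI)
      show "x (hub, cotip) *\<^sub>v (x (k, hub) *\<^sub>v (x (hub, k) *\<^sub>v (x (cotip, hub) *\<^sub>v u))) \<in> S m" using s4 4 by simp
      show "coord m i (x (hub, cotip) *\<^sub>v (x (k, hub) *\<^sub>v (x (hub, k) *\<^sub>v (x (cotip, hub) *\<^sub>v u)))) = coord m (Suc i) u" for i
        using coord_step[OF e(4) s3, of i "Suc (2 * i)"] coord_step[OF e(3) s2, of "Suc (2 * i)" "Suc (2 * i)"]
          coord_step[OF e(2) s1, of "Suc (2 * i)" "Suc (Suc (2 * i))"]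
          coord_step[OF e(1), of u "Suc (Suc (2 * i))" "Suc i"] u 4
        by (simp add: arrow_simps ar)
    qed
  qed
qed

end

context stable_point
begin

definition adapted_frame :: "nat \<Rightarrow> nat \<Rightarrow> complex Matrix.vec set \<Rightarrow> complex mat \<Rightarrow> bool" where
  "adapted_frame m d S A \<longleftrightarrow> A \<in> frames (v m) d \<and> col_span d A = S \<and>
     (\<forall>k<d. \<forall>i. coord m i (col A k) = (if i = k then 1 else 0)) \<and>
     (\<forall>u\<in>S. \<forall>i\<ge>d. coord m i u = 0)"

lemma adapted_frameD:
  assumes "adapted_frame m d S A"
  shows "A \<in> frames (v m) d" and "A \<in> carrier_mat (v m) d" and "col_span d A = S"
    and "k < d \<Longrightarrow> coord m i (col A k) = (if i = k then 1 else 0)"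
    and "u \<in> S \<Longrightarrow> d \<le> i \<Longrightarrow> coord m i u = 0"
  using assms by (auto simp: adapted_frame_def frames_def)

lemma adapted_frame_exists:
  assumes S: "graded_subspace n v S" and st: "rep_stable n x S" and m: "m \<in> vertices n"
  shows "\<exists>d A. adapted_frame m d (S m) A"
proof -
  have sub: "vec_subspace (v m) (S m)" using S m by (auto simp: graded_subspace_def)
  then have carr: "u \<in> carrier_vec (v m)" if "u \<in> S m" for u
    using that by (auto simp: vec_subspace_iff)
  show ?thesis
  proof (rule shift_invariant_subspace[OF sub, of "coord m" n])
    show "linear_form (v m) (coord m i)" for i by (rule linear_form_coord[OF m])
    show "u = 0\<^sub>v (v m)" if "u \<in> S m" "\<And>i. coord m i u = 0" for u
      by (rule coord_faithful[OF m carr[OF that(1)] that(2)])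
    show "\<exists>u'\<in>S m. \<forall>i. coord m i u' = coord m (Suc i) u" if "u \<in> S m" for u
      by (rule coord_shift[OF m S st that])
    show "coord m i u = 0" if "u \<in> S m" "n \<le> i" for i u
      by (rule coord_bound[OF m that(2) carr[OF that(1)]])
    fix d A
    assume "A \<in> frames (v m) d" "col_span d A = S m"
      "\<And>i k. k < d \<Longrightarrow> coord m i (col A k) = (if i = k then 1 else 0)"
      "\<And>i u. u \<in> S m \<Longrightarrow> d \<le> i \<Longrightarrow> coord m i u = 0"
    then show ?thesis unfolding adapted_frame_def by blast
  qed
qed

lemma adapted_frame_of_dim:
  assumes S: "graded_subspace n v S" and st: "rep_stable n x S" and dim: "has_graded_dim n v S d"
    and m: "m \<in> vertices n"
  shows "\<exists>A. adapted_frame m (d m) (S m) A"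
proof -
  obtain e A where A: "adapted_frame m e (S m) A" using adapted_frame_exists[OF S st m] by blast
  have "e = d m"
    using dim_col_span_frame[OF adapted_frameD(1)[OF A]] adapted_frameD(3)[OF A] dim m
    by (simp add: has_graded_dim_def)
  then show ?thesis using A by blast
qed

lemma frame_coordinates:
  assumes m: "m \<in> vertices n" and A: "A \<in> carrier_mat (v m) d" and c: "c \<in> carrier_vec d"
    and basis: "\<And>i k. k < d \<Longrightarrow> coord m i (col A k) = (if i = k then 1 else 0)"
  shows "coord m i (A *\<^sub>v c) = (if i < d then vec_index c i else 0)"
proof -
  have "coord m i (A *\<^sub>v c) = (\<Sum>k<d. if i = k then vec_index c k else 0)"
    unfolding linear_form_mult_mat_vec[OF linear_form_coord[OF m] A c]
    by (rule sum.cong) (auto simp: basis)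
  then show ?thesis by simp
qed

text \<open>A vector whose coordinates from \<open>d m\<close> on vanish has the same coordinates as a combination of the columns
of an adapted frame, so it is that combination.  In particular \<open>S\<close> is determined by its graded
dimension, which is why the fibres of the flag varieties have at most one point.\<close>

lemma stable_subspace_eq:
  assumes S: "graded_subspace n v S" and st: "rep_stable n x S" and dim: "has_graded_dim n v S d"
    and m: "m \<in> vertices n"
  shows "S m = {u \<in> carrier_vec (v m). \<forall>i\<ge>d m. coord m i u = 0}"
proof -
  obtain A where A: "adapted_frame m (d m) (S m) A" using adapted_frame_of_dim[OF S st dim m] by blast
  note A = adapted_frameD[OF A]
  have "u \<in> S m" if u: "u \<in> carrier_vec (v m)" "\<forall>i\<ge>d m. coord m i u = 0" for u
  proof -
    define c where "c = Matrix.vec (d m) (\<lambda>i. coord m i u)"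
    have c: "c \<in> carrier_vec (d m)" by (simp add: c_def)
    have "u = A *\<^sub>v c"
    proof (rule coord_separates[OF m u(1)])
      show "A *\<^sub>v c \<in> carrier_vec (v m)" using A(2) c by auto
      show "coord m i u = coord m i (A *\<^sub>v c)" for i
        using frame_coordinates[OF m A(2) c A(4)] u(2) by (auto simp: c_def)
    qed
    then show ?thesis using A(3) c by (auto simp: col_span_def)
  qed
  moreover have "S m \<subseteq> carrier_vec (v m)" using S m by (auto simp: graded_subspace_def vec_subspace_iff)
  ultimately show ?thesis using A(5) by auto
qed

text \<open>An arrow from a box that occurs in a stable subspace leads to a box that occurs as well, since it
preserves the coordinate.\<close>

lemma stable_subspace_admissible:
  assumes S: "graded_subspace n v S" and st: "rep_stable n x S" and dim: "has_graded_dim n v S d"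
  shows "admissible d"
proof -
  have basis: "\<exists>u\<in>S m. u \<in> carrier_vec (v m) \<and> coord m k u = 1" if m: "m \<in> vertices n" and k: "k < d m" for m k
  proof -
    obtain A where A: "adapted_frame m (d m) (S m) A" using adapted_frame_of_dim[OF S st dim m] by blast
    note A = adapted_frameD[OF A]
    have "col A k = A *\<^sub>v unit_vec (d m) k"
      using k A(2) col_mult2[OF A(2) one_carrier_mat k] by simp
    then have "col A k \<in> S m" unfolding A(3)[symmetric] by (auto simp: col_span_def)
    moreover have "col A k \<in> carrier_vec (v m)" using A(2) k by auto
    ultimately show ?thesis using A(4)[OF k, of k] by auto
  qed
  have bound: "coord m i u = 0" if "m \<in> vertices n" "u \<in> S m" "d m \<le> i" for m i u
    using adapted_frame_of_dim[OF S st dim that(1)] adapted_frameD(5) that(2,3) by blast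
  have "d 1 \<le> 1"
  proof (rule ccontr)
    assume "\<not> d 1 \<le> 1"
    then have k: "1 < d 1" by simp
    have one: "1 \<in> vertices n" using hub_ge by (simp add: vertices_iff)
    obtain u where "u \<in> carrier_vec (v 1)" "coord 1 1 u = 1" using basis[OF one k] by blast
    then show False using coord_arm_bound[of 1 1 u] hub_ge by simp
  qed
  moreover have "a < d (snd h)" if h: "h \<in> edges n" "arrow h a b" "b < d (fst h)" for h a b
  proof (rule ccontr)
    assume a: "\<not> a < d (snd h)"
    note V = edge_vertices[OF h(1)]
    obtain u where u: "u \<in> S (fst h)" "u \<in> carrier_vec (v (fst h))" "coord (fst h) b u = 1"
      using basis[OF V(1) h(3)] by blast
    have "x h *\<^sub>v u \<in> S (snd h)" using st h(1) u(1) by (auto simp: rep_stable_def)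
    then have "coord (snd h) a (x h *\<^sub>v u) = 0" using bound[OF V(2)] a by simp
    then show False using coord_arrow[OF h(1) u(2) h(2)] u(3) by simp
  qed
  ultimately show ?thesis by (auto simp: admissible_def)
qed

definition whole :: graded_sub where
  "whole = (\<lambda>m\<in>vertices n. carrier_vec (v m))"

lemma whole_subspace: "graded_subspace n v whole"
  by (auto simp: graded_subspace_def whole_def vec_subspace_iff)

lemma whole_stable: "rep_stable n x whole"
  unfolding rep_stable_def
proof (intro ballI)
  fix h u assume h: "h \<in> edges n" and "u \<in> whole (fst h)"
  then have "u \<in> carrier_vec (v (fst h))" using edge_vertices[OF h] by (simp add: whole_def)
  then show "x h *\<^sub>v u \<in> whole (snd h)"
    using x_vec[of "fst h" "snd h"] h edge_vertices[OF h] by (simp add: whole_def)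
qed

lemma whole_dim: "has_graded_dim n v whole v"
proof -
  have "vectorspace.dim class_ring (module_vec TYPE(complex) (v m)\<lparr>carrier := carrier_vec (v m)\<rparr>) = v m" for m
  proof -
    interpret vec_space "TYPE(complex)" "v m" .
    have "module_vec TYPE(complex) (v m)\<lparr>carrier := carrier_vec (v m)\<rparr> = module_vec TYPE(complex) (v m)"
      by (simp add: module_vec_def)
    then show ?thesis by (simp only: dim_is_n)
  qed
  then show ?thesis by (simp add: has_graded_dim_def whole_def)
qed

lemma dim_admissible: "admissible v"
  by (rule stable_subspace_admissible[OF whole_subspace whole_stable whole_dim])

lemma coord_basis:
  obtains B where "\<And>m. m \<in> vertices n \<Longrightarrow> B m \<in> carrier_mat (v m) (v m)"
    and "\<And>m c i. m \<in> vertices n \<Longrightarrow> c \<in> carrier_vec (v m) \<Longrightarrow>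
      coord m i (B m *\<^sub>v c) = (if i < v m then vec_index c i else 0)"
    and "\<And>m i u. m \<in> vertices n \<Longrightarrow> u \<in> carrier_vec (v m) \<Longrightarrow> v m \<le> i \<Longrightarrow> coord m i u = 0"
proof -
  obtain A where "\<forall>m\<in>vertices n. adapted_frame m (v m) (whole m) (A m)"
    using bchoice[of "vertices n" "\<lambda>m A. adapted_frame m (v m) (whole m) A"]
      adapted_frame_of_dim[OF whole_subspace whole_stable whole_dim] by blast
  then have A: "adapted_frame m (v m) (whole m) (A m)" if "m \<in> vertices n" for m using that by blast
  show thesis
  proof (rule that[of A])
    show "A m \<in> carrier_mat (v m) (v m)" if "m \<in> vertices n" for m
      by (rule adapted_frameD(2)[OF A[OF that]])
    show "coord m i (A m *\<^sub>v c) = (if i < v m then vec_index c i else 0)"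
      if "m \<in> vertices n" "c \<in> carrier_vec (v m)" for m c i
      by (rule frame_coordinates[OF that(1) adapted_frameD(2)[OF A[OF that(1)]] that(2)
          adapted_frameD(4)[OF A[OF that(1)]]])
    show "coord m i u = 0" if "m \<in> vertices n" "u \<in> carrier_vec (v m)" "v m \<le> i" for m i u
      using adapted_frameD(5)[OF A[OF that(1)], of u i] that by (simp add: whole_def)
  qed
qed

end

section \<open>Comparing stable points\<close>

context type_D
begin

text \<open>The coordinates identify a stable point with an initial part of the boxes, so a stable point of
smaller dimension embeds in one of larger dimension by matching coordinates.  The image consists of
the vectors whose other coordinates vanish.  For equal dimensions this gives conjugacy of stable points; for unequal
ones it gives the flags and computes their first projection.\<close>

lemma comparison:
  assumes A: "stable_point n s v x j" and B: "stable_point n s v' x' j'"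
    and le: "\<And>m. m \<in> vertices n \<Longrightarrow> v' m \<le> v m"
  obtains \<phi> where "\<And>m. m \<in> vertices n \<Longrightarrow> \<phi> m \<in> frames (v m) (v' m)"
    and "\<And>m u i. m \<in> vertices n \<Longrightarrow> u \<in> carrier_vec (v' m) \<Longrightarrow>
      stable_point.coord n s x j m i (\<phi> m *\<^sub>v u) = stable_point.coord n s x' j' m i u"
    and "\<And>m. m \<in> vertices n \<Longrightarrow> col_span (v' m) (\<phi> m) =
      {u \<in> carrier_vec (v m). \<forall>i\<ge>v' m. stable_point.coord n s x j m i u = 0}"
    and "\<And>h. h \<in> edges n \<Longrightarrow> x h * \<phi> (fst h) = \<phi> (snd h) * x' h"
    and "\<And>m. m \<in> vertices n \<Longrightarrow> j' m = j m * \<phi> m"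
proof -
  interpret A: stable_point n s v x j by fact
  interpret B: stable_point n s v' x' j' by fact
  obtain P where P: "\<And>m. m \<in> vertices n \<Longrightarrow> P m \<in> carrier_mat (v m) (v m)"
    "\<And>m c i. m \<in> vertices n \<Longrightarrow> c \<in> carrier_vec (v m) \<Longrightarrow>
      A.coord m i (P m *\<^sub>v c) = (if i < v m then vec_index c i else 0)"
    by (rule A.coord_basis) blast
  obtain Q where Q: "\<And>m. m \<in> vertices n \<Longrightarrow> Q m \<in> carrier_mat (v' m) (v' m)"
    "\<And>m c i. m \<in> vertices n \<Longrightarrow> c \<in> carrier_vec (v' m) \<Longrightarrow>
      B.coord m i (Q m *\<^sub>v c) = (if i < v' m then vec_index c i else 0)"
    and Q0: "\<And>m i u. m \<in> vertices n \<Longrightarrow> u \<in> carrier_vec (v' m) \<Longrightarrow> v' m \<le> i \<Longrightarrow> B.coord m i u = 0"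
    by (rule B.coord_basis) blast
  define M where "M m = Matrix.mat (v m) (v' m) (\<lambda>(i, k). B.coord m i (unit_vec (v' m) k))" for m
  define \<phi> where "\<phi> m = P m * M m" for m
  have M: "M m \<in> carrier_mat (v m) (v' m)" for m by (simp add: M_def)
  have \<phi>c: "\<phi> m \<in> carrier_mat (v m) (v' m)" if "m \<in> vertices n" for m
    using P(1)[OF that] M by (simp add: \<phi>_def)
  have Mu: "vec_index (M m *\<^sub>v u) i = B.coord m i u"
    if m: "m \<in> vertices n" and u: "u \<in> carrier_vec (v' m)" and i: "i < v m" for m u i
  proof -
    have "B.coord m i (1\<^sub>m (v' m) *\<^sub>v u) = (\<Sum>k<v' m. vec_index u k * B.coord m i (col (1\<^sub>m (v' m)) k))"
      by (rule linear_form_mult_mat_vec[OF B.linear_form_coord[OF m] one_carrier_mat u])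
    moreover have "vec_index (M m *\<^sub>v u) i = (\<Sum>k<v' m. B.coord m i (unit_vec (v' m) k) * vec_index u k)"
      using i u by (auto simp: M_def scalar_prod_def lessThan_atLeast0)
    ultimately show ?thesis using u by (simp add: mult.commute)
  qed
  have coord: "A.coord m i (\<phi> m *\<^sub>v u) = B.coord m i u"
    if m: "m \<in> vertices n" and u: "u \<in> carrier_vec (v' m)" for m u i
  proof -
    have "\<phi> m *\<^sub>v u = P m *\<^sub>v (M m *\<^sub>v u)"
      unfolding \<phi>_def by (rule assoc_mult_mat_vec[OF P(1)[OF m] M u])
    moreover have "M m *\<^sub>v u \<in> carrier_vec (v m)" using M u by (meson mult_mat_vec_carrier)
    ultimately have "A.coord m i (\<phi> m *\<^sub>v u) = (if i < v m then vec_index (M m *\<^sub>v u) i else 0)"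
      using P(2)[OF m] by simp
    then show ?thesis using Mu[OF m u] Q0[OF m u] le[OF m] by auto
  qed
  have \<phi>u: "\<phi> m *\<^sub>v u \<in> carrier_vec (v m)" if "m \<in> vertices n" "u \<in> carrier_vec (v' m)" for m u
    using \<phi>c that by (meson mult_mat_vec_carrier)
  have frame: "\<phi> m \<in> frames (v m) (v' m)" if m: "m \<in> vertices n" for m
  proof -
    have "inj_on (\<lambda>u. \<phi> m *\<^sub>v u) (carrier_vec (v' m))"
    proof (rule inj_onI)
      fix u w assume u: "u \<in> carrier_vec (v' m)" and w: "w \<in> carrier_vec (v' m)"
        and eq: "\<phi> m *\<^sub>v u = \<phi> m *\<^sub>v w"
      show "u = w"
        by (rule B.coord_separates[OF m u w]) (use coord[OF m u] coord[OF m w] eq in metis)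
    qed
    then show ?thesis using \<phi>c[OF m] by (simp add: frames_def)
  qed
  have span: "col_span (v' m) (\<phi> m) = {u \<in> carrier_vec (v m). \<forall>i\<ge>v' m. A.coord m i u = 0}"
    if m: "m \<in> vertices n" for m
  proof (intro equalityI subsetI)
    fix u assume "u \<in> col_span (v' m) (\<phi> m)"
    then obtain c where c: "c \<in> carrier_vec (v' m)" "u = \<phi> m *\<^sub>v c" by (auto simp: col_span_def)
    then show "u \<in> {u \<in> carrier_vec (v m). \<forall>i\<ge>v' m. A.coord m i u = 0}"
      using coord[OF m c(1)] \<phi>u[OF m c(1)] Q0[OF m c(1)] by auto
  next
    fix u assume "u \<in> {u \<in> carrier_vec (v m). \<forall>i\<ge>v' m. A.coord m i u = 0}"
    then have u: "u \<in> carrier_vec (v m)" "\<And>i. v' m \<le> i \<Longrightarrow> A.coord m i u = 0" by auto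
    define c where "c = Matrix.vec (v' m) (\<lambda>i. A.coord m i u)"
    have c: "c \<in> carrier_vec (v' m)" by (simp add: c_def)
    have Qc: "Q m *\<^sub>v c \<in> carrier_vec (v' m)" using Q(1)[OF m] c by (meson mult_mat_vec_carrier)
    have "u = \<phi> m *\<^sub>v (Q m *\<^sub>v c)"
    proof (rule A.coord_separates[OF m u(1) \<phi>u[OF m Qc]])
      show "A.coord m i u = A.coord m i (\<phi> m *\<^sub>v (Q m *\<^sub>v c))" for i
        unfolding coord[OF m Qc] Q(2)[OF m c] using u(2) by (auto simp: c_def)
    qed
    then show "u \<in> col_span (v' m) (\<phi> m)" using Qc by (auto simp: col_span_def)
  qed
  have inter: "x h * \<phi> (fst h) = \<phi> (snd h) * x' h" if h: "h \<in> edges n" for h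
  proof -
    note V = edge_vertices[OF h]
    have xc: "x h \<in> carrier_mat (v (snd h)) (v (fst h))" by (rule rep_carrier[OF A.x_rep h])
    have xc': "x' h \<in> carrier_mat (v' (snd h)) (v' (fst h))" by (rule rep_carrier[OF B.x_rep h])
    show ?thesis
    proof (rule mat_eq_by_vectors)
      show "x h * \<phi> (fst h) \<in> carrier_mat (v (snd h)) (v' (fst h))" using xc \<phi>c[OF V(1)] by simp
      show "\<phi> (snd h) * x' h \<in> carrier_mat (v (snd h)) (v' (fst h))" using xc' \<phi>c[OF V(2)] by simp
      fix u :: "complex Matrix.vec" assume u: "u \<in> carrier_vec (v' (fst h))"
      have x'u: "x' h *\<^sub>v u \<in> carrier_vec (v' (snd h))" using xc' u by (meson mult_mat_vec_carrier)
      have pu: "\<phi> (fst h) *\<^sub>v u \<in> carrier_vec (v (fst h))" by (rule \<phi>u[OF V(1) u])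
      have "x h *\<^sub>v (\<phi> (fst h) *\<^sub>v u) = \<phi> (snd h) *\<^sub>v (x' h *\<^sub>v u)"
      proof (rule A.coord_separates[OF V(2)])
        show "x h *\<^sub>v (\<phi> (fst h) *\<^sub>v u) \<in> carrier_vec (v (snd h))" using xc pu by (meson mult_mat_vec_carrier)
        show "\<phi> (snd h) *\<^sub>v (x' h *\<^sub>v u) \<in> carrier_vec (v (snd h))" by (rule \<phi>u[OF V(2) x'u])
        fix a
        show "A.coord (snd h) a (x h *\<^sub>v (\<phi> (fst h) *\<^sub>v u)) = A.coord (snd h) a (\<phi> (snd h) *\<^sub>v (x' h *\<^sub>v u))"
        proof (cases "\<exists>b. arrow h a b")
          case True
          then obtain b where b: "arrow h a b" by auto
          show ?thesis
            unfolding coord[OF V(2) x'u] A.coord_arrow[OF h pu b] B.coord_arrow[OF h u b] coord[OF V(1) u] ..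
        next
          case False
          then have b: "\<And>b. \<not> arrow h a b" by auto
          show ?thesis
            unfolding coord[OF V(2) x'u] A.coord_no_arrow[OF h pu b] B.coord_no_arrow[OF h u b] ..
        qed
      qed
      then show "x h * \<phi> (fst h) *\<^sub>v u = \<phi> (snd h) * x' h *\<^sub>v u"
        using assoc_mult_mat_vec[OF xc \<phi>c[OF V(1)] u] assoc_mult_mat_vec[OF \<phi>c[OF V(2)] xc' u] by simp
    qed
  qed
  have fram: "j' m = j m * \<phi> m" if m: "m \<in> vertices n" for m
  proof (rule mat_eq_by_vectors)
    have jc: "j m \<in> carrier_mat (unit_dim tip m) (v m)" by (rule framing_carrier[OF A.j_framing m])
    show jc': "j' m \<in> carrier_mat (unit_dim tip m) (v' m)" by (rule framing_carrier[OF B.j_framing m])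
    show "j m * \<phi> m \<in> carrier_mat (unit_dim tip m) (v' m)" using jc \<phi>c[OF m] by simp
    fix u :: "complex Matrix.vec" assume u: "u \<in> carrier_vec (v' m)"
    show "j' m *\<^sub>v u = j m * \<phi> m *\<^sub>v u"
    proof (rule eq_vecI)
      show "dim_vec (j' m *\<^sub>v u) = dim_vec (j m * \<phi> m *\<^sub>v u)" using jc jc' by simp
      fix a assume "a < dim_vec (j m * \<phi> m *\<^sub>v u)"
      then have "a < unit_dim tip m" using jc by simp
      then have a: "a = 0" "m = tip" by (auto simp: unit_dim_def split: if_splits)
      have "vec_index (j tip *\<^sub>v (\<phi> tip *\<^sub>v u)) 0 = vec_index (j' tip *\<^sub>v u) 0"
        using coord[OF m u, of 0] a by (simp add: A.coord_simps B.coord_simps)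
      moreover have "j m * \<phi> m *\<^sub>v u = j m *\<^sub>v (\<phi> m *\<^sub>v u)" by (rule assoc_mult_mat_vec[OF jc \<phi>c[OF m] u])
      ultimately show "vec_index (j' m *\<^sub>v u) a = vec_index (j m * \<phi> m *\<^sub>v u) a" using a by simp
    qed
  qed
  show thesis
    by (rule that[OF frame coord span inter fram])
qed

text \<open>Restriction to a subrepresentation preserves all defining conditions, because each of them can be
tested after applying the injective maps \<open>\<phi>\<close>.  The case of invertible \<open>\<phi>\<close> is the invariance under
\<open>G\<^sub>V\<close>.\<close>

lemma Lambda_st_restrict:
  assumes st: "(x, j) \<in> Lambda_st n v w" and x': "x' \<in> rep_space n v'" and j': "j' \<in> framing_space n v' w"
    and fr: "\<And>m. m \<in> vertices n \<Longrightarrow> \<phi> m \<in> frames (v m) (v' m)"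
    and inter: "\<And>h. h \<in> edges n \<Longrightarrow> x h * \<phi> (fst h) = \<phi> (snd h) * x' h"
    and fram: "\<And>m. m \<in> vertices n \<Longrightarrow> j' m = j m * \<phi> m"
  shows "(x', j') \<in> Lambda_st n v' w"
proof -
  have x: "x \<in> rep_space n v" and j: "j \<in> framing_space n v w" and nil: "nilpotent_rep n v x"
    and mom: "\<And>i a b. i \<in> vertices n \<Longrightarrow> a < v i \<Longrightarrow> b < v i \<Longrightarrow>
      (\<Sum>h\<in>{h \<in> edges n. snd h = i}. eps n h * (x h * x (opp h)) $$ (a, b)) = 0"
    and stab: "\<And>S. graded_subspace n v S \<Longrightarrow> rep_stable n x S \<Longrightarrow>
      \<forall>i\<in>vertices n. \<forall>u\<in>S i. j i *\<^sub>v u = 0\<^sub>v (w i) \<Longrightarrow> \<forall>i\<in>vertices n. S i = {0\<^sub>v (v i)}"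
    using st by (auto simp: Lambda_st_def Lambda_def)
  have \<phi>: "\<phi> m \<in> carrier_mat (v m) (v' m)" if "m \<in> vertices n" for m
    using fr[OF that] by (simp add: frames_def)
  have X: "x h \<in> carrier_mat (v (snd h)) (v (fst h))" "x' h \<in> carrier_mat (v' (snd h)) (v' (fst h))"
    "\<phi> (fst h) \<in> carrier_mat (v (fst h)) (v' (fst h))" "\<phi> (snd h) \<in> carrier_mat (v (snd h)) (v' (snd h))"
    if "h \<in> edges n" for h
    using rep_carrier[OF x that] rep_carrier[OF x' that] edge_vertices[OF that] \<phi> by auto
  let ?path = "\<lambda>x v hs. fold (\<lambda>h A. x h * A) hs (1\<^sub>m (v (fst (hd hs))))"
  have path: "?path x v hs * \<phi> (fst (hd hs)) = \<phi> (snd (last hs)) * ?path x' v' hs"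
    if "hs \<noteq> []" "set hs \<subseteq> edges n" "successively (\<lambda>h h'. snd h = fst h') hs" for hs
    using that
  proof (induction hs rule: rev_nonempty_induct)
    case (single h)
    then show ?case using inter[of h] X[of h] by simp
  next
    case (snoc h hs)
    have hs: "set hs \<subseteq> edges n" "successively (\<lambda>h h'. snd h = fst h') hs" "h \<in> edges n" "snd (last hs) = fst h"
      using snoc.prems snoc.hyps by (auto simp: successively_append_iff)
    have c: "?path x v hs \<in> carrier_mat (v (fst h)) (v (fst (hd hs)))"
      "?path x' v' hs \<in> carrier_mat (v' (fst h)) (v' (fst (hd hs)))"
      using path_product_carrier[OF x snoc.hyps hs(1,2)] path_product_carrier[OF x' snoc.hyps hs(1,2)] hs(4)
      by auto
    have hd: "hd hs \<in> edges n" using hs(1) snoc.hyps by auto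
    have "x h * ?path x v hs * \<phi> (fst (hd hs)) = x h * (?path x v hs * \<phi> (fst (hd hs)))"
      by (rule assoc_mult_mat[OF X(1)[OF hs(3)] c(1) X(3)[OF hd]])
    also have "\<dots> = x h * (\<phi> (fst h) * ?path x' v' hs)" using snoc.IH hs by simp
    also have "\<dots> = x h * \<phi> (fst h) * ?path x' v' hs"
      by (rule assoc_mult_mat[symmetric, OF X(1)[OF hs(3)] X(3)[OF hs(3)] c(2)])
    also have "\<dots> = \<phi> (snd h) * x' h * ?path x' v' hs" using inter[OF hs(3)] by simp
    also have "\<dots> = \<phi> (snd h) * (x' h * ?path x' v' hs)"
      by (rule assoc_mult_mat[OF X(4)[OF hs(3)] X(2)[OF hs(3)] c(2)])
    finally show ?case using snoc.hyps by simp
  qed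
  have "nilpotent_rep n v' x'"
  proof -
    obtain N where N: "N \<ge> 1" "\<And>hs. length hs = N \<Longrightarrow> set hs \<subseteq> edges n \<Longrightarrow>
        successively (\<lambda>h h'. snd h = fst h') hs \<Longrightarrow> ?path x v hs = 0\<^sub>m (v (snd (last hs))) (v (fst (hd hs)))"
      using nil unfolding nilpotent_rep_def by blast
    have "?path x' v' hs = 0\<^sub>m (v' (snd (last hs))) (v' (fst (hd hs)))"
      if hs: "length hs = N" "set hs \<subseteq> edges n" "successively (\<lambda>h h'. snd h = fst h') hs" for hs
    proof -
      have ne: "hs \<noteq> []" using hs(1) N(1) by auto
      then have e: "hd hs \<in> edges n" "last hs \<in> edges n" using hs(2) by auto
      note V = edge_vertices[OF e(1)] edge_vertices[OF e(2)]
      show ?thesis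
      proof (rule frame_cancel_left[OF fr[OF V(4)]])
        show "?path x' v' hs \<in> carrier_mat (v' (snd (last hs))) (v' (fst (hd hs)))"
          by (rule path_product_carrier[OF x' ne hs(2,3)])
        show "\<phi> (snd (last hs)) * ?path x' v' hs = \<phi> (snd (last hs)) * 0\<^sub>m (v' (snd (last hs))) (v' (fst (hd hs)))"
          unfolding path[OF ne hs(2,3), symmetric] N(2)[OF hs] using \<phi>[OF V(1)] \<phi>[OF V(4)] by simp
      qed simp
    qed
    then show ?thesis unfolding nilpotent_rep_def using N(1) by blast
  qed
  moreover have "(\<Sum>h\<in>{h \<in> edges n. snd h = i}. eps n h * (x' h * x' (opp h)) $$ (a, b)) = 0"
    if i: "i \<in> vertices n" and a: "a < v' i" and b: "b < v' i" for i a b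
  proof -
    let ?E = "{h \<in> edges n. snd h = i}"
    define M' where "M' = Matrix.mat (v' i) (v' i) (\<lambda>(a, b). \<Sum>h\<in>?E. eps n h * (x' h * x' (opp h)) $$ (a, b))"
    have loop: "x h * x (opp h) * \<phi> i = \<phi> i * (x' h * x' (opp h))" if h: "h \<in> ?E" for h
    proof -
      have c: "x h \<in> carrier_mat (v i) (v (fst h))" "x' h \<in> carrier_mat (v' i) (v' (fst h))"
        "x (opp h) \<in> carrier_mat (v (fst h)) (v i)" "x' (opp h) \<in> carrier_mat (v' (fst h)) (v' i)"
        "\<phi> (fst h) \<in> carrier_mat (v (fst h)) (v' (fst h))"
        using X[of h] X[of "opp h"] h by auto
      have "x h * x (opp h) * \<phi> i = x h * (x (opp h) * \<phi> i)"
        by (rule assoc_mult_mat[OF c(1,3) \<phi>[OF i]])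
      also have "x (opp h) * \<phi> i = \<phi> (fst h) * x' (opp h)" using inter[of "opp h"] h by simp
      also have "x h * \<dots> = x h * \<phi> (fst h) * x' (opp h)" by (rule assoc_mult_mat[symmetric, OF c(1,5,4)])
      also have "x h * \<phi> (fst h) = \<phi> i * x' h" using inter[of h] h by simp
      also have "\<dots> * x' (opp h) = \<phi> i * (x' h * x' (opp h))" by (rule assoc_mult_mat[OF \<phi>[OF i] c(2,4)])
      finally show ?thesis .
    qed
    have "\<phi> i * M' = \<phi> i * 0\<^sub>m (v' i) (v' i)"
    proof (rule eq_matI)
      fix a c assume "a < dim_row (\<phi> i * 0\<^sub>m (v' i) (v' i))" "c < dim_col (\<phi> i * 0\<^sub>m (v' i) (v' i))"
      then have a: "a < v i" and c: "c < v' i" using \<phi>[OF i] by auto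
      have entries: "(\<Sum>b<v' i. \<phi> i $$ (a, b) * (x' h * x' (opp h)) $$ (b, c))
          = (\<Sum>b<v i. (x h * x (opp h)) $$ (a, b) * \<phi> i $$ (b, c))" if h: "h \<in> ?E" for h
      proof -
        have d: "x h * x (opp h) \<in> carrier_mat (v i) (v i)" "x' h * x' (opp h) \<in> carrier_mat (v' i) (v' i)"
          using X[of h] X[of "opp h"] h by auto
        have "(\<phi> i * (x' h * x' (opp h))) $$ (a, c) = (\<Sum>b<v' i. \<phi> i $$ (a, b) * (x' h * x' (opp h)) $$ (b, c))"
          by (rule mult_mat_entry[OF \<phi>[OF i] d(2) a c])
        moreover have "(x h * x (opp h) * \<phi> i) $$ (a, c) = (\<Sum>b<v i. (x h * x (opp h)) $$ (a, b) * \<phi> i $$ (b, c))"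
          by (rule mult_mat_entry[OF d(1) \<phi>[OF i] a c])
        ultimately show ?thesis using loop[OF h] by simp
      qed
      have "(\<phi> i * M') $$ (a, c) = (\<Sum>b<v' i. \<phi> i $$ (a, b) * (\<Sum>h\<in>?E. eps n h * (x' h * x' (opp h)) $$ (b, c)))"
        using a c \<phi>[OF i] by (auto simp: M'_def scalar_prod_def lessThan_atLeast0)
      also have "\<dots> = (\<Sum>h\<in>?E. eps n h * (\<Sum>b<v' i. \<phi> i $$ (a, b) * (x' h * x' (opp h)) $$ (b, c)))"
        unfolding sum_distrib_left by (subst sum.swap, intro sum.cong refl) (rule mult.left_commute)
      also have "\<dots> = (\<Sum>h\<in>?E. eps n h * (\<Sum>b<v i. (x h * x (opp h)) $$ (a, b) * \<phi> i $$ (b, c)))"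
        by (rule sum.cong) (simp_all add: entries)
      also have "\<dots> = (\<Sum>b<v i. (\<Sum>h\<in>?E. eps n h * (x h * x (opp h)) $$ (a, b)) * \<phi> i $$ (b, c))"
        unfolding sum_distrib_left sum_distrib_right
        by (subst sum.swap, intro sum.cong refl) (rule mult.assoc[symmetric])
      also have "\<dots> = 0" using mom[OF i a] by (intro sum.neutral) auto
      finally show "(\<phi> i * M') $$ (a, c) = (\<phi> i * 0\<^sub>m (v' i) (v' i)) $$ (a, c)"
        using a c \<phi>[OF i] by simp
    qed (use \<phi>[OF i] in \<open>auto simp: M'_def\<close>)
    then have "M' = 0\<^sub>m (v' i) (v' i)"
      by (rule frame_cancel_left[OF fr[OF i] _ zero_carrier_mat, rotated]) (simp add: M'_def)
    then have "M' $$ (a, b) = 0" using a b by simp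
    then show ?thesis using a b by (simp add: M'_def)
  qed
  moreover have "\<forall>i\<in>vertices n. S' i = {0\<^sub>v (v' i)}"
    if S': "graded_subspace n v' S'" "rep_stable n x' S'"
      and ker: "\<forall>i\<in>vertices n. \<forall>u\<in>S' i. j' i *\<^sub>v u = 0\<^sub>v (w i)" for S'
  proof -
    have sub: "vec_subspace (v' m) (S' m)" if "m \<in> vertices n" for m
      using S'(1) that by (auto simp: graded_subspace_def)
    then have Sc: "u \<in> carrier_vec (v' m)" if "m \<in> vertices n" "u \<in> S' m" for m u
      using sub[OF that(1)] that(2) by (auto simp: vec_subspace_iff)
    define S where "S = (\<lambda>m\<in>vertices n. (\<lambda>u. \<phi> m *\<^sub>v u) ` S' m)"
    have "vec_subspace (v m) (S m)" if m: "m \<in> vertices n" for m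
    proof -
      have "\<phi> m *\<^sub>v u + \<phi> m *\<^sub>v w \<in> S m" if "u \<in> S' m" "w \<in> S' m" for u w
        using mult_add_distrib_mat_vec[OF \<phi>[OF m] Sc[OF m that(1)] Sc[OF m that(2)]] sub[OF m] that m
        by (auto simp: S_def vec_subspace_iff image_iff) (metis)
      moreover have "c \<cdot>\<^sub>v (\<phi> m *\<^sub>v u) \<in> S m" if "u \<in> S' m" for u c
        using mult_mat_vec[OF \<phi>[OF m] Sc[OF m that], of c] sub[OF m] that m
        by (auto simp: S_def vec_subspace_iff image_iff) (metis)
      moreover have "0\<^sub>v (v m) \<in> S m"
        using mult_mat_zero_vec[OF \<phi>[OF m]] sub[OF m] m
        by (auto simp: S_def vec_subspace_iff image_iff) (metis)
      moreover have "\<phi> m *\<^sub>v u \<in> carrier_vec (v m)" if "u \<in> S' m" for u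
        using \<phi>[OF m] Sc[OF m that] by (meson mult_mat_vec_carrier)
      ultimately show ?thesis using m by (auto simp: vec_subspace_iff S_def)
    qed
    then have 1: "graded_subspace n v S" by (auto simp: graded_subspace_def S_def)
    have 2: "rep_stable n x S"
      unfolding rep_stable_def
    proof (intro ballI)
      fix h u assume h: "h \<in> edges n" and "u \<in> S (fst h)"
      then obtain u' where u': "u' \<in> S' (fst h)" "u = \<phi> (fst h) *\<^sub>v u'"
        using edge_vertices[OF h] by (auto simp: S_def)
      have uc: "u' \<in> carrier_vec (v' (fst h))" using Sc edge_vertices[OF h] u' by auto
      have "x h *\<^sub>v u = (x h * \<phi> (fst h)) *\<^sub>v u'"
        unfolding u'(2) by (rule assoc_mult_mat_vec[symmetric, OF X(1,3)[OF h] uc])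
      also have "\<dots> = \<phi> (snd h) *\<^sub>v (x' h *\<^sub>v u')"
        unfolding inter[OF h] by (rule assoc_mult_mat_vec[OF X(4,2)[OF h] uc])
      finally show "x h *\<^sub>v u \<in> S (snd h)"
        using S'(2) h u'(1) edge_vertices[OF h] by (auto simp: S_def rep_stable_def)
    qed
    have 3: "\<forall>i\<in>vertices n. \<forall>u\<in>S i. j i *\<^sub>v u = 0\<^sub>v (w i)"
    proof (intro ballI)
      fix i u assume i: "i \<in> vertices n" and "u \<in> S i"
      then obtain u' where u': "u' \<in> S' i" "u = \<phi> i *\<^sub>v u'" by (auto simp: S_def)
      have "j i *\<^sub>v u = (j i * \<phi> i) *\<^sub>v u'"
        unfolding u'(2) by (rule assoc_mult_mat_vec[symmetric, OF framing_carrier[OF j i] \<phi>[OF i] Sc[OF i u'(1)]])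
      then show "j i *\<^sub>v u = 0\<^sub>v (w i)" using fram[OF i] ker i u'(1) by metis
    qed
    have zero: "\<forall>i\<in>vertices n. S i = {0\<^sub>v (v i)}" by (rule stab[OF 1 2 3])
    show ?thesis
    proof
      fix i assume i: "i \<in> vertices n"
      have only_zero: "u = 0\<^sub>v (v' i)" if "u \<in> S' i" for u
      proof -
        have "\<phi> i *\<^sub>v u \<in> S i" using that i by (simp add: S_def)
        then have "\<phi> i *\<^sub>v u = \<phi> i *\<^sub>v 0\<^sub>v (v' i)"
          using zero i mult_mat_zero_vec[OF \<phi>[OF i]] by simp
        moreover have "inj_on (\<lambda>u. \<phi> i *\<^sub>v u) (carrier_vec (v' i))" using fr[OF i] by (simp add: frames_def)
        ultimately show ?thesis using Sc[OF i that] by (metis inj_onD zero_carrier_vec)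
      qed
      show "S' i = {0\<^sub>v (v' i)}"
      proof
        show "S' i \<subseteq> {0\<^sub>v (v' i)}"
        proof
          fix u assume "u \<in> S' i"
          then show "u \<in> {0\<^sub>v (v' i)}" using only_zero by (metis singletonI)
        qed
        show "{0\<^sub>v (v' i)} \<subseteq> S' i" using sub[OF i] by (simp add: vec_subspace_iff)
      qed
    qed
  qed
  ultimately have nil': "nilpotent_rep n v' x'"
    and mom': "\<forall>i\<in>vertices n. \<forall>a<v' i. \<forall>b<v' i.
      (\<Sum>h\<in>{h \<in> edges n. snd h = i}. eps n h * (x' h * x' (opp h)) $$ (a, b)) = 0"
    and stab': "\<forall>S. graded_subspace n v' S \<and> rep_stable n x' S \<and>
      (\<forall>i\<in>vertices n. \<forall>u\<in>S i. j' i *\<^sub>v u = 0\<^sub>v (w i)) \<longrightarrow> (\<forall>i\<in>vertices n. S i = {0\<^sub>v (v' i)})"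
    by blast+
  then show ?thesis using x' j' by (simp add: Lambda_st_def Lambda_def)
qed

end

section \<open>Orbits of stable points and of flags\<close>

lemma mat_inv_props:
  assumes "A \<in> Units (ring_mat TYPE(complex) m ())"
  shows "A \<in> carrier_mat m m" and "mat_inv m A \<in> carrier_mat m m"
    and "A * mat_inv m A = 1\<^sub>m m" and "mat_inv m A * A = 1\<^sub>m m"
proof -
  interpret R: Ring.ring "ring_mat TYPE(complex) m ()" by (rule ring_mat)
  show "A \<in> carrier_mat m m" using R.Units_closed[OF assms] by (simp add: ring_mat_simps)
  show "mat_inv m A \<in> carrier_mat m m"
    using R.Units_inv_closed[OF assms] by (simp add: mat_inv_def ring_mat_simps)
  show "A * mat_inv m A = 1\<^sub>m m"
    using R.Units_r_inv[OF assms] by (simp add: mat_inv_def ring_mat_simps)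
  show "mat_inv m A * A = 1\<^sub>m m"
    using R.Units_l_inv[OF assms] by (simp add: mat_inv_def ring_mat_simps)
qed

lemma mat_Units_I:
  assumes "A \<in> carrier_mat m m" "B \<in> carrier_mat m m" "A * B = 1\<^sub>m m" "B * A = 1\<^sub>m m"
  shows "A \<in> Units (ring_mat TYPE(complex) m ())"
  using assms by (auto simp: Units_def ring_mat_simps)

lemma GV_D:
  assumes "g \<in> GV n v" "m \<in> vertices n"
  shows "g m \<in> carrier_mat (v m) (v m)" and "mat_inv (v m) (g m) \<in> carrier_mat (v m) (v m)"
    and "g m * mat_inv (v m) (g m) = 1\<^sub>m (v m)" and "mat_inv (v m) (g m) * g m = 1\<^sub>m (v m)"
  using mat_inv_props[of "g m" "v m"] assms by (auto simp: GV_def PiE_iff)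

lemma invertible_frame:
  assumes A: "A \<in> carrier_mat m m" and B: "B \<in> carrier_mat m m" and BA: "B * A = 1\<^sub>m m"
  shows "A \<in> frames m m"
proof -
  have "u = w" if u: "u \<in> carrier_vec m" and w: "w \<in> carrier_vec m" and eq: "A *\<^sub>v u = A *\<^sub>v w" for u w
  proof -
    have "u = B * A *\<^sub>v u" "w = B * A *\<^sub>v w" using BA u w by auto
    then show ?thesis using assoc_mult_mat_vec[OF B A u] assoc_mult_mat_vec[OF B A w] eq by metis
  qed
  then show ?thesis using A by (auto simp: frames_def inj_on_def)
qed

lemma frame_mult:
  assumes A: "A \<in> frames l m" and B: "B \<in> frames m d"
  shows "A * B \<in> frames l d" and "col_span d (A * B) = (\<lambda>u. A *\<^sub>v u) ` col_span d B"
proof -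
  have c: "A \<in> carrier_mat l m" "B \<in> carrier_mat m d" using assms by (auto simp: frames_def)
  have AB: "A * B *\<^sub>v u = A *\<^sub>v (B *\<^sub>v u)" if "u \<in> carrier_vec d" for u
    by (rule assoc_mult_mat_vec[OF c that])
  show "A * B \<in> frames l d"
  proof -
    have iA: "inj_on (\<lambda>u. A *\<^sub>v u) (carrier_vec m)" and iB: "inj_on (\<lambda>u. B *\<^sub>v u) (carrier_vec d)"
      using assms by (auto simp: frames_def)
    have "inj_on (\<lambda>u. A * B *\<^sub>v u) (carrier_vec d)"
    proof (rule inj_onI)
      fix u w assume uw: "u \<in> carrier_vec d" "w \<in> carrier_vec d" and eq: "A * B *\<^sub>v u = A * B *\<^sub>v w"
      then have "A *\<^sub>v (B *\<^sub>v u) = A *\<^sub>v (B *\<^sub>v w)" using AB by simp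
      moreover have "B *\<^sub>v u \<in> carrier_vec m" "B *\<^sub>v w \<in> carrier_vec m"
        using c(2) uw by (meson mult_mat_vec_carrier)+
      ultimately have "B *\<^sub>v u = B *\<^sub>v w" using inj_onD[OF iA] by blast
      then show "u = w" using inj_onD[OF iB] uw by blast
    qed
    then show ?thesis using c by (simp add: frames_def)
  qed
  show "col_span d (A * B) = (\<lambda>u. A *\<^sub>v u) ` col_span d B"
    unfolding col_span_def image_image by (rule image_cong[OF refl AB])
qed

lemma topspace_mat_topology: "topspace (mat_topology r c) = carrier_mat r c"
  by (auto simp: mat_topology_def topspace_pullback_topology)

context type_D
begin

lemma orbit_in_Lambda_st:
  assumes st: "(x, j) \<in> Lambda_st n v w" and g: "g \<in> GV n v"
  shows "(act_rep n v g x, act_framing n v g j) \<in> Lambda_st n v w"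
proof (rule Lambda_st_restrict[OF st])
  let ?i = "\<lambda>m. mat_inv (v m) (g m)"
  have x: "x \<in> rep_space n v" and j: "j \<in> framing_space n v w"
    using st by (auto simp: Lambda_st_def Lambda_def)
  have xc: "g (snd h) * x h * ?i (fst h) \<in> carrier_mat (v (snd h)) (v (fst h))" if h: "h \<in> edges n" for h
    using GV_D[OF g edge_vertices(1)[OF h]] GV_D[OF g edge_vertices(2)[OF h]] rep_carrier[OF x h]
    by (intro mult_carrier_mat)
  then show "act_rep n v g x \<in> rep_space n v" by (auto simp: act_rep_def rep_space_def)
  have jc: "j m * ?i m \<in> carrier_mat (w m) (v m)" if m: "m \<in> vertices n" for m
    using GV_D[OF g m] framing_carrier[OF j m] by (intro mult_carrier_mat)
  then show "act_framing n v g j \<in> framing_space n v w" by (auto simp: act_framing_def framing_space_def)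
  show "?i m \<in> frames (v m) (v m)" if "m \<in> vertices n" for m
    using GV_D[OF g that] by (intro invertible_frame[of _ _ "g m"])
  show "act_framing n v g j m = j m * ?i m" if "m \<in> vertices n" for m
    using that by (simp add: act_framing_def)
  show "x h * ?i (fst h) = ?i (snd h) * act_rep n v g x h" if h: "h \<in> edges n" for h
  proof -
    note F = GV_D[OF g edge_vertices(1)[OF h]] and S = GV_D[OF g edge_vertices(2)[OF h]]
    have xi: "x h * ?i (fst h) \<in> carrier_mat (v (snd h)) (v (fst h))"
      using rep_carrier[OF x h] F(2) by (intro mult_carrier_mat)
    have "?i (snd h) * (g (snd h) * x h * ?i (fst h)) = ?i (snd h) * (g (snd h) * (x h * ?i (fst h)))"
      using assoc_mult_mat[OF S(1) rep_carrier[OF x h] F(2)] by simp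
    also have "\<dots> = ?i (snd h) * g (snd h) * (x h * ?i (fst h))"
      by (rule assoc_mult_mat[symmetric, OF S(2,1) xi])
    also have "\<dots> = x h * ?i (fst h)" unfolding S(4) by (rule left_mult_one_mat[OF xi])
    finally show ?thesis using h by (simp add: act_rep_def)
  qed
qed

lemma transporter:
  assumes A: "(x, j) \<in> Lambda_st n v (unit_dim tip)" and B: "(x', j') \<in> Lambda_st n v (unit_dim tip)"
  obtains g where "g \<in> GV n v" and "act_rep n v g x = x'" and "act_framing n v g j = j'"
    and "\<And>m u i. m \<in> vertices n \<Longrightarrow> u \<in> carrier_vec (v m) \<Longrightarrow>
      stable_point.coord n s x' j' m i (g m *\<^sub>v u) = stable_point.coord n s x j m i u"
proof -
  have sA: "stable_point n s v x j" and sB: "stable_point n s v x' j'"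
    using A B type_D_axioms by (auto simp: stable_point_def stable_point_axioms_def)
  interpret A: stable_point n s v x j by fact
  interpret B: stable_point n s v x' j' by fact
  obtain \<phi> where \<phi>: "\<And>m. m \<in> vertices n \<Longrightarrow> \<phi> m \<in> frames (v m) (v m)"
    "\<And>m u i. m \<in> vertices n \<Longrightarrow> u \<in> carrier_vec (v m) \<Longrightarrow> B.coord m i (\<phi> m *\<^sub>v u) = A.coord m i u"
    "\<And>h. h \<in> edges n \<Longrightarrow> x' h * \<phi> (fst h) = \<phi> (snd h) * x h"
    "\<And>m. m \<in> vertices n \<Longrightarrow> j m = j' m * \<phi> m"
    by (rule comparison[OF sB sA order_refl]) blast
  obtain \<psi> where \<psi>: "\<And>m. m \<in> vertices n \<Longrightarrow> \<psi> m \<in> frames (v m) (v m)"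
    "\<And>m u i. m \<in> vertices n \<Longrightarrow> u \<in> carrier_vec (v m) \<Longrightarrow> A.coord m i (\<psi> m *\<^sub>v u) = B.coord m i u"
    by (rule comparison[OF sA sB order_refl]) blast
  have c: "\<phi> m \<in> carrier_mat (v m) (v m)" "\<psi> m \<in> carrier_mat (v m) (v m)" if "m \<in> vertices n" for m
    using \<phi>(1)[OF that] \<psi>(1)[OF that] by (auto simp: frames_def)
  have inv1: "\<phi> m * \<psi> m = 1\<^sub>m (v m)" if m: "m \<in> vertices n" for m
  proof (rule mat_eq_by_vectors)
    fix u :: "complex Matrix.vec" assume u: "u \<in> carrier_vec (v m)"
    have pu: "\<psi> m *\<^sub>v u \<in> carrier_vec (v m)" using c[OF m] u by (meson mult_mat_vec_carrier)
    have ppu: "\<phi> m *\<^sub>v (\<psi> m *\<^sub>v u) \<in> carrier_vec (v m)" using c[OF m] pu by (meson mult_mat_vec_carrier)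
    have "\<phi> m *\<^sub>v (\<psi> m *\<^sub>v u) = u"
      by (rule B.coord_separates[OF m ppu u]) (simp only: \<phi>(2)[OF m pu] \<psi>(2)[OF m u])
    then show "\<phi> m * \<psi> m *\<^sub>v u = 1\<^sub>m (v m) *\<^sub>v u"
      using assoc_mult_mat_vec[OF c(1,2)[OF m] u] u by simp
  qed (use c[OF m] in auto)
  have inv2: "\<psi> m * \<phi> m = 1\<^sub>m (v m)" if m: "m \<in> vertices n" for m
  proof (rule mat_eq_by_vectors)
    fix u :: "complex Matrix.vec" assume u: "u \<in> carrier_vec (v m)"
    have pu: "\<phi> m *\<^sub>v u \<in> carrier_vec (v m)" using c[OF m] u by (meson mult_mat_vec_carrier)
    have ppu: "\<psi> m *\<^sub>v (\<phi> m *\<^sub>v u) \<in> carrier_vec (v m)" using c[OF m] pu by (meson mult_mat_vec_carrier)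
    have "\<psi> m *\<^sub>v (\<phi> m *\<^sub>v u) = u"
      by (rule A.coord_separates[OF m ppu u]) (simp only: \<phi>(2)[OF m u] \<psi>(2)[OF m pu])
    then show "\<psi> m * \<phi> m *\<^sub>v u = 1\<^sub>m (v m) *\<^sub>v u"
      using assoc_mult_mat_vec[OF c(2,1)[OF m] u] u by simp
  qed (use c[OF m] in auto)
  define g where "g = (\<lambda>m\<in>vertices n. \<phi> m)"
  have gV: "g \<in> GV n v"
    using mat_Units_I[OF c inv1 inv2] by (auto simp: GV_def g_def)
  have g: "g m = \<phi> m" if "m \<in> vertices n" for m using that by (simp add: g_def)
  have "act_rep n v g x = x'"
  proof
    fix h
    show "act_rep n v g x h = x' h"
    proof (cases "h \<in> edges n")
      case True
      note V = edge_vertices[OF True] and F = GV_D[OF gV edge_vertices(1)[OF True]]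
      have x'c: "x' h \<in> carrier_mat (v (snd h)) (v (fst h))" by (rule rep_carrier[OF B.x_rep True])
      have "g (snd h) * x h * mat_inv (v (fst h)) (g (fst h)) = x' h * g (fst h) * mat_inv (v (fst h)) (g (fst h))"
        using \<phi>(3)[OF True] g[OF V(1)] g[OF V(2)] by simp
      also have "\<dots> = x' h * (g (fst h) * mat_inv (v (fst h)) (g (fst h)))"
        by (rule assoc_mult_mat[OF x'c F(1,2)])
      also have "\<dots> = x' h" unfolding F(3) using x'c by simp
      finally show ?thesis using True by (simp add: act_rep_def)
    next
      case False
      then show ?thesis using B.x_rep by (cases h) (auto simp: act_rep_def rep_space_def PiE_def extensional_def)
    qed
  qed
  moreover have "act_framing n v g j = j'"
  proof
    fix m
    show "act_framing n v g j m = j' m"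
    proof (cases "m \<in> vertices n")
      case True
      note F = GV_D[OF gV True]
      have j'c: "j' m \<in> carrier_mat (unit_dim tip m) (v m)" by (rule framing_carrier[OF B.j_framing True])
      have "j m * mat_inv (v m) (g m) = j' m * g m * mat_inv (v m) (g m)"
        using \<phi>(4)[OF True] g[OF True] by simp
      also have "\<dots> = j' m * (g m * mat_inv (v m) (g m))" by (rule assoc_mult_mat[OF j'c F(1,2)])
      also have "\<dots> = j' m" unfolding F(3) using j'c by simp
      finally show ?thesis using True by (simp add: act_framing_def)
    next
      case False
      then show ?thesis using B.j_framing
        by (auto simp: act_framing_def framing_space_def PiE_def extensional_def)
    qed
  qed
  ultimately show thesis
    by (intro that[of g] gV) (auto simp: g \<phi>(2))
qed

lemma orbit_eq_Lambda_st:
  assumes "(x, j) \<in> Lambda_st n v (unit_dim tip)"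
  shows "orbit n v (x, j) = Lambda_st n v (unit_dim tip)"
proof (intro equalityI subsetI)
  fix y assume "y \<in> orbit n v (x, j)"
  then show "y \<in> Lambda_st n v (unit_dim tip)"
    using orbit_in_Lambda_st[OF assms] by (auto simp: orbit_def)
next
  fix y assume y: "y \<in> Lambda_st n v (unit_dim tip)"
  obtain x' j' where xj: "y = (x', j')" by (cases y)
  obtain g where "g \<in> GV n v" "act_rep n v g x = x'" "act_framing n v g j = j'"
    by (rule transporter[OF assms y[unfolded xj]]) blast
  then show "y \<in> orbit n v (x, j)" unfolding xj orbit_def by auto
qed

lemma quiver_variety_eq:
  "quiver_variety n v (unit_dim tip) =
     (if Lambda_st n v (unit_dim tip) = {} then {} else {Lambda_st n v (unit_dim tip)})"
proof -
  have "orbit n v y = Lambda_st n v (unit_dim tip)" if "y \<in> Lambda_st n v (unit_dim tip)" for y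
    using orbit_eq_Lambda_st[of "fst y" "snd y"] that by simp
  then show ?thesis by (auto simp: quiver_variety_def)
qed

lemma Lambda_st_nonempty_iff: "Lambda_st n v (unit_dim tip) \<noteq> {} \<longleftrightarrow> admissible v"
proof
  assume "Lambda_st n v (unit_dim tip) \<noteq> {}"
  then obtain x j where "(x, j) \<in> Lambda_st n v (unit_dim tip)" by auto
  then interpret stable_point n s v x j by unfold_locales
  show "admissible v" by (rule dim_admissible)
qed (use staircase_in_Lambda_st in auto)

lemma stable_pointI: "(x, j) \<in> Lambda_st n v (unit_dim tip) \<Longrightarrow> stable_point n s v x j"
  by unfold_locales

lemma flag_subspace_frame:
  assumes "(x, j, S) \<in> flag_triples n v (unit_dim tip) v''" and m: "m \<in> vertices n"
  shows "\<exists>A \<in> frames (v m) ((v - v'') m). col_span ((v - v'') m) A = S m"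
proof -
  have "stable_point n s v x j" using assms(1) by (auto simp: flag_triples_def intro: stable_pointI)
  then interpret stable_point n s v x j .
  obtain A where "adapted_frame m ((v - v'') m) (S m) A"
    using adapted_frame_of_dim[of S "v - v''" m] assms by (auto simp: flag_triples_def)
  then show ?thesis using adapted_frameD by blast
qed

lemma orbit3_in_flag_triples:
  assumes fl: "(x, j, S) \<in> flag_triples n v (unit_dim tip) v''" and g: "g \<in> GV n v"
  shows "(act_rep n v g x, act_framing n v g j, act_sub n g S) \<in> flag_triples n v (unit_dim tip) v''"
proof -
  have st: "(x, j) \<in> Lambda_st n v (unit_dim tip)" and le: "v'' \<le> v" and S: "rep_stable n x S"
    using fl by (auto simp: flag_triples_def)
  have x: "x \<in> rep_space n v" using st by (auto simp: Lambda_st_def Lambda_def)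
  have fr: "\<exists>A \<in> frames (v m) ((v - v'') m). col_span ((v - v'') m) A = act_sub n g S m"
    if m: "m \<in> vertices n" for m
  proof -
    obtain A where A: "A \<in> frames (v m) ((v - v'') m)" "col_span ((v - v'') m) A = S m"
      using flag_subspace_frame[OF fl m] by blast
    have gm: "g m \<in> frames (v m) (v m)"
      using GV_D[OF g m] by (intro invertible_frame[of _ _ "mat_inv (v m) (g m)"])
    show ?thesis
      by (rule bexI[of _ "g m * A"]) (use frame_mult[OF gm A(1)] A(2) m in \<open>auto simp: act_sub_def\<close>)
  qed
  have 1: "graded_subspace n v (act_sub n g S)"
    unfolding graded_subspace_def
  proof (intro conjI ballI)
    show "act_sub n g S \<in> extensional (vertices n)" by (simp add: act_sub_def)
    fix m assume m: "m \<in> vertices n"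
    obtain A where "A \<in> frames (v m) ((v - v'') m)" "col_span ((v - v'') m) A = act_sub n g S m"
      using fr[OF m] by blast
    then show "vec_subspace (v m) (act_sub n g S m)"
      using col_span_subspace[of A "v m" "(v - v'') m"] by (simp add: frames_def)
  qed
  have 2: "has_graded_dim n v (act_sub n g S) (v - v'')"
    unfolding has_graded_dim_def
  proof
    fix m assume m: "m \<in> vertices n"
    obtain A where "A \<in> frames (v m) ((v - v'') m)" "col_span ((v - v'') m) A = act_sub n g S m"
      using fr[OF m] by blast
    then show "vectorspace.dim class_ring (module_vec TYPE(complex) (v m)\<lparr>carrier := act_sub n g S m\<rparr>) = (v - v'') m"
      using dim_col_span_frame by metis
  qed
  have 3: "rep_stable n (act_rep n v g x) (act_sub n g S)"
    unfolding rep_stable_def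
  proof (intro ballI)
    fix h u assume h: "h \<in> edges n" and u: "u \<in> act_sub n g S (fst h)"
    note V = edge_vertices[OF h]
    note F = GV_D[OF g V(1)] and T = GV_D[OF g V(2)]
    obtain w where w: "w \<in> S (fst h)" "u = g (fst h) *\<^sub>v w" using u V by (auto simp: act_sub_def)
    have "S (fst h) \<subseteq> carrier_vec (v (fst h))"
      using fl V by (auto simp: flag_triples_def graded_subspace_def vec_subspace_iff)
    then have wc: "w \<in> carrier_vec (v (fst h))" using w by auto
    have xc: "x h \<in> carrier_mat (v (snd h)) (v (fst h))" by (rule rep_carrier[OF x h])
    have gx: "g (snd h) * x h \<in> carrier_mat (v (snd h)) (v (fst h))" using T(1) xc by (rule mult_carrier_mat)
    have gw: "g (fst h) *\<^sub>v w \<in> carrier_vec (v (fst h))" using F(1) wc by (rule mult_mat_vec_carrier)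
    have "act_rep n v g x h *\<^sub>v u = g (snd h) * x h * mat_inv (v (fst h)) (g (fst h)) *\<^sub>v (g (fst h) *\<^sub>v w)"
      using h w by (simp add: act_rep_def)
    also have "\<dots> = g (snd h) * x h *\<^sub>v (mat_inv (v (fst h)) (g (fst h)) *\<^sub>v (g (fst h) *\<^sub>v w))"
      by (rule assoc_mult_mat_vec[OF gx F(2) gw])
    also have "mat_inv (v (fst h)) (g (fst h)) *\<^sub>v (g (fst h) *\<^sub>v w) = w"
      using assoc_mult_mat_vec[OF F(2,1) wc] F(4) wc by simp
    also have "g (snd h) * x h *\<^sub>v w = g (snd h) *\<^sub>v (x h *\<^sub>v w)" by (rule assoc_mult_mat_vec[OF T(1) xc wc])
    finally show "act_rep n v g x h *\<^sub>v u \<in> act_sub n g S (snd h)"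
      using S h w(1) V by (auto simp: act_sub_def rep_stable_def)
  qed
  show ?thesis
    using orbit_in_Lambda_st[OF st g] 1 2 3 le by (simp add: flag_triples_def)
qed

lemma orbit3_eq_flag_triples:
  assumes fl: "(x, j, S) \<in> flag_triples n v (unit_dim tip) v''"
  shows "orbit3 n v (x, j, S) = flag_triples n v (unit_dim tip) v''"
proof (intro equalityI subsetI)
  fix t assume "t \<in> orbit3 n v (x, j, S)"
  then show "t \<in> flag_triples n v (unit_dim tip) v''"
    using orbit3_in_flag_triples[OF fl] by (auto simp: orbit3_def)
next
  fix t assume t: "t \<in> flag_triples n v (unit_dim tip) v''"
  obtain x' j' S' where t_eq: "t = (x', j', S')" by (cases t) auto
  have A: "(x, j) \<in> Lambda_st n v (unit_dim tip)" and B: "(x', j') \<in> Lambda_st n v (unit_dim tip)"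
    and S: "graded_subspace n v S" "rep_stable n x S" "has_graded_dim n v S (v - v'')"
    and S': "graded_subspace n v S'" "rep_stable n x' S'" "has_graded_dim n v S' (v - v'')"
    using fl t t_eq by (auto simp: flag_triples_def)
  interpret A: stable_point n s v x j by (rule stable_pointI[OF A])
  interpret B: stable_point n s v x' j' by (rule stable_pointI[OF B])
  obtain g where g: "g \<in> GV n v" "act_rep n v g x = x'" "act_framing n v g j = j'"
    and coord: "\<And>m u i. m \<in> vertices n \<Longrightarrow> u \<in> carrier_vec (v m) \<Longrightarrow>
      B.coord m i (g m *\<^sub>v u) = A.coord m i u"
    by (rule transporter[OF A B]) blast
  have "act_sub n g S = S'"
  proof
    fix m
    show "act_sub n g S m = S' m"
    proof (cases "m \<in> vertices n")
      case m: True
      note G = GV_D[OF g(1) m]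
      have gu: "g m *\<^sub>v u \<in> carrier_vec (v m)" if "u \<in> carrier_vec (v m)" for u
        using G(1) that by (rule mult_mat_vec_carrier)
      show ?thesis
      proof (intro equalityI subsetI)
        fix u assume "u \<in> act_sub n g S m"
        then obtain w where w: "w \<in> S m" "u = g m *\<^sub>v w" using m by (auto simp: act_sub_def)
        then show "u \<in> S' m"
          using gu coord[OF m] unfolding A.stable_subspace_eq[OF S m] B.stable_subspace_eq[OF S' m] by auto
      next
        fix u assume "u \<in> S' m"
        then have u: "u \<in> carrier_vec (v m)" "\<And>i. (v - v'') m \<le> i \<Longrightarrow> B.coord m i u = 0"
          unfolding B.stable_subspace_eq[OF S' m] by auto
        define w where "w = mat_inv (v m) (g m) *\<^sub>v u"
        have w: "w \<in> carrier_vec (v m)" unfolding w_def using G(2) u(1) by (rule mult_mat_vec_carrier)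
        have gw: "g m *\<^sub>v w = u"
          unfolding w_def assoc_mult_mat_vec[OF G(1,2) u(1), symmetric] G(3) using u(1) by simp
        then have "w \<in> S m"
          unfolding A.stable_subspace_eq[OF S m] using w coord[OF m w] u(2) by auto
        then show "u \<in> act_sub n g S m" using gw m by (auto simp: act_sub_def)
      qed
    next
      case False
      then show ?thesis using S'(1) by (auto simp: act_sub_def graded_subspace_def extensional_def)
    qed
  qed
  then show "t \<in> orbit3 n v (x, j, S)" unfolding t_eq orbit3_def using g by auto
qed

text \<open>The flag is the image of a stable point of the smaller dimension.\<close>

lemma flag_triples_exists:
  assumes "admissible v" and "admissible (v - v'')" and "v'' \<le> v"
  shows "flag_triples n v (unit_dim tip) v'' \<noteq> {}"
proof -
  let ?d = "v - v''"
  obtain x j where A: "(x, j) \<in> Lambda_st n v (unit_dim tip)"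
    using staircase_in_Lambda_st[OF assms(1)] by blast
  obtain x' j' where B: "(x', j') \<in> Lambda_st n ?d (unit_dim tip)"
    using staircase_in_Lambda_st[OF assms(2)] by blast
  have x: "x \<in> rep_space n v" and x': "x' \<in> rep_space n ?d"
    using A B by (auto simp: Lambda_st_def Lambda_def)
  obtain \<phi> where \<phi>: "\<And>m. m \<in> vertices n \<Longrightarrow> \<phi> m \<in> frames (v m) (?d m)"
    "\<And>h. h \<in> edges n \<Longrightarrow> x h * \<phi> (fst h) = \<phi> (snd h) * x' h"
  proof (rule comparison[OF stable_pointI[OF A] stable_pointI[OF B]])
    show "?d m \<le> v m" for m by simp
  qed blast
  have \<phi>c: "\<phi> m \<in> carrier_mat (v m) (?d m)" if "m \<in> vertices n" for m
    using \<phi>(1)[OF that] by (simp add: frames_def)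
  define S where "S = (\<lambda>m\<in>vertices n. col_span (?d m) (\<phi> m))"
  have "rep_stable n x S"
    unfolding rep_stable_def
  proof (intro ballI)
    fix h u assume h: "h \<in> edges n" and "u \<in> S (fst h)"
    note V = edge_vertices[OF h]
    obtain c where c: "c \<in> carrier_vec (?d (fst h))" "u = \<phi> (fst h) *\<^sub>v c"
      using \<open>u \<in> S (fst h)\<close> V by (auto simp: S_def col_span_def)
    have x'c: "x' h \<in> carrier_mat (?d (snd h)) (?d (fst h))" by (rule rep_carrier[OF x' h])
    have "x h *\<^sub>v u = x h * \<phi> (fst h) *\<^sub>v c"
      unfolding c(2) by (rule assoc_mult_mat_vec[symmetric, OF rep_carrier[OF x h] \<phi>c[OF V(1)] c(1)])
    also have "\<dots> = \<phi> (snd h) *\<^sub>v (x' h *\<^sub>v c)"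
      unfolding \<phi>(2)[OF h] by (rule assoc_mult_mat_vec[OF \<phi>c[OF V(2)] x'c c(1)])
    finally show "x h *\<^sub>v u \<in> S (snd h)"
      using V mult_mat_vec_carrier[OF x'c c(1)] by (auto simp: S_def col_span_def)
  qed
  moreover have "graded_subspace n v S"
    using col_span_subspace[OF \<phi>c] by (auto simp: graded_subspace_def S_def)
  moreover have "has_graded_dim n v S ?d"
    using dim_col_span_frame[OF \<phi>(1)] by (auto simp: has_graded_dim_def S_def)
  ultimately have "(x, j, S) \<in> flag_triples n v (unit_dim tip) v''"
    using A assms(3) by (simp add: flag_triples_def)
  then show ?thesis by blast
qed

lemma topspace_flag_variety:
  "topspace (flag_variety n v (unit_dim tip) v'') =
     (if flag_triples n v (unit_dim tip) v'' = {} then {} else {flag_triples n v (unit_dim tip) v''})"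
proof -
  let ?F = "flag_triples n v (unit_dim tip) v''"
  have sub: "?F \<subseteq> (\<Pi>\<^sub>E h\<in>edges n. carrier_mat (v (snd h)) (v (fst h))) \<times>
      (\<Pi>\<^sub>E i\<in>vertices n. carrier_mat (unit_dim tip i) (v i)) \<times>
      (\<Pi>\<^sub>E i\<in>vertices n. col_span ((v - v'') i) ` frames (v i) ((v - v'') i))"
  proof
    fix t assume t: "t \<in> ?F"
    obtain x j S where t_eq: "t = (x, j, S)" by (cases t) auto
    have "x \<in> rep_space n v" "j \<in> framing_space n v (unit_dim tip)" "S \<in> extensional (vertices n)"
      using t unfolding t_eq by (auto simp: flag_triples_def Lambda_st_def Lambda_def graded_subspace_def)
    moreover have "S m \<in> col_span ((v - v'') m) ` frames (v m) ((v - v'') m)" if "m \<in> vertices n" for m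
      using flag_subspace_frame[OF t[unfolded t_eq] that] by blast
    ultimately show "t \<in> (\<Pi>\<^sub>E h\<in>edges n. carrier_mat (v (snd h)) (v (fst h))) \<times>
      (\<Pi>\<^sub>E i\<in>vertices n. carrier_mat (unit_dim tip i) (v i)) \<times>
      (\<Pi>\<^sub>E i\<in>vertices n. col_span ((v - v'') i) ` frames (v i) ((v - v'') i))"
      unfolding t_eq by (auto simp: rep_space_def framing_space_def PiE_iff)
  qed
  have gr: "topspace (grassmannian m d) = col_span d ` frames m d" for m d
  proof -
    have "frames m d \<subseteq> carrier_mat m d" by (auto simp: frames_def)
    then show ?thesis
      by (simp add: grassmannian_def topspace_quotient_topology topspace_mat_topology Int_absorb1)
  qed
  have "topspace (flag_variety n v (unit_dim tip) v'') = orbit3 n v ` ?F"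
    using sub by (simp add: flag_variety_def topspace_quotient_topology topspace_mat_topology gr Int_absorb1)
  moreover have "orbit3 n v t = ?F" if "t \<in> ?F" for t
    using orbit3_eq_flag_triples that by (cases t) auto
  ultimately show ?thesis by auto
qed

lemma pi2_flag_triples:
  assumes "flag_triples n v (unit_dim tip) v'' \<noteq> {}"
  shows "pi2 (flag_triples n v (unit_dim tip) v'') = Lambda_st n v (unit_dim tip)"
proof -
  obtain x j S where t: "(x, j, S) \<in> flag_triples n v (unit_dim tip) v''" using assms by (metis all_not_in_conv prod_cases3)
  then have st: "(x, j) \<in> Lambda_st n v (unit_dim tip)" by (simp add: flag_triples_def)
  have "pi2 (orbit3 n v (x, j, S)) = orbit n v (x, j)"
    by (auto simp: pi2_def orbit3_def orbit_def image_def)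
  then show ?thesis using orbit3_eq_flag_triples[OF t] orbit_eq_Lambda_st[OF st] by simp
qed

text \<open>Every stable point of the smaller dimension is a restriction along the comparison map, whose image
satisfies the same equations in the coordinates as the subspace of the flag.\<close>

lemma pi1_flag_triples:
  assumes ne: "flag_triples n v (unit_dim tip) v'' \<noteq> {}"
  shows "pi1 n v (unit_dim tip) v'' (flag_triples n v (unit_dim tip) v'') = Lambda_st n (v - v'') (unit_dim tip)"
proof (intro equalityI subsetI)
  fix y assume y: "y \<in> pi1 n v (unit_dim tip) v'' (flag_triples n v (unit_dim tip) v'')"
  obtain x' j' where y_eq: "y = (x', j')" by (cases y)
  obtain x j S \<phi> where *: "x' \<in> rep_space n (v - v'')" "j' \<in> framing_space n (v - v'') (unit_dim tip)"
    "(x, j, S) \<in> flag_triples n v (unit_dim tip) v''"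
    "\<forall>i\<in>vertices n. \<phi> i \<in> frames (v i) ((v - v'') i) \<and> col_span ((v - v'') i) (\<phi> i) = S i"
    "\<forall>h\<in>edges n. x h * \<phi> (fst h) = \<phi> (snd h) * x' h" "\<forall>i\<in>vertices n. j' i = j i * \<phi> i"
    using y unfolding y_eq pi1_def by blast
  have st: "(x, j) \<in> Lambda_st n v (unit_dim tip)" using *(3) by (simp add: flag_triples_def)
  show "y \<in> Lambda_st n (v - v'') (unit_dim tip)"
    unfolding y_eq by (rule Lambda_st_restrict[OF st *(1,2)]) (use * in blast)+
next
  fix y assume y: "y \<in> Lambda_st n (v - v'') (unit_dim tip)"
  obtain x' j' where y_eq: "y = (x', j')" by (cases y)
  note B = y[unfolded y_eq]
  obtain x j S where t: "(x, j, S) \<in> flag_triples n v (unit_dim tip) v''" using ne by (metis all_not_in_conv prod_cases3)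
  then have A: "(x, j) \<in> Lambda_st n v (unit_dim tip)"
    and S: "graded_subspace n v S" "rep_stable n x S" "has_graded_dim n v S (v - v'')"
    by (auto simp: flag_triples_def)
  interpret A: stable_point n s v x j by (rule stable_pointI[OF A])
  obtain \<phi> where \<phi>: "\<And>m. m \<in> vertices n \<Longrightarrow> \<phi> m \<in> frames (v m) ((v - v'') m)"
    "\<And>m. m \<in> vertices n \<Longrightarrow> col_span ((v - v'') m) (\<phi> m) =
       {u \<in> carrier_vec (v m). \<forall>i\<ge>(v - v'') m. A.coord m i u = 0}"
    "\<And>h. h \<in> edges n \<Longrightarrow> x h * \<phi> (fst h) = \<phi> (snd h) * x' h"
    "\<And>m. m \<in> vertices n \<Longrightarrow> j' m = j m * \<phi> m"
  proof (rule comparison[OF stable_pointI[OF A] stable_pointI[OF B]])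
    show "(v - v'') m \<le> v m" for m by simp
  qed blast
  have "\<phi> i \<in> frames (v i) ((v - v'') i) \<and> col_span ((v - v'') i) (\<phi> i) = S i" if "i \<in> vertices n" for i
    using \<phi>(1,2)[OF that] A.stable_subspace_eq[OF S that] by simp
  moreover have "x' \<in> rep_space n (v - v'')" "j' \<in> framing_space n (v - v'') (unit_dim tip)"
    using B by (auto simp: Lambda_st_def Lambda_def)
  ultimately show "y \<in> pi1 n v (unit_dim tip) v'' (flag_triples n v (unit_dim tip) v'')"
    unfolding y_eq pi1_def using t \<phi>(3,4) by blast
qed

end

lemma mat_trace_comm:
  assumes A: "A \<in> carrier_mat m d" and B: "B \<in> carrier_mat d m"
  shows "mat_trace (A * B) = mat_trace (B * A)"
proof -
  have "mat_trace (A * B) = (\<Sum>a<m. \<Sum>b<d. A $$ (a, b) * B $$ (b, a))"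
    using A unfolding mat_trace_def by (auto intro!: sum.cong simp: mult_mat_entry[OF A B])
  also have "\<dots> = (\<Sum>b<d. \<Sum>a<m. B $$ (b, a) * A $$ (a, b))"
    by (subst sum.swap) (simp add: mult.commute)
  also have "\<dots> = mat_trace (B * A)"
    using B unfolding mat_trace_def by (auto intro!: sum.cong simp: mult_mat_entry[OF B A])
  finally show ?thesis .
qed

lemma mat_trace_minus:
  assumes "A \<in> carrier_mat m m" "B \<in> carrier_mat m m"
  shows "mat_trace (A - B) = mat_trace A - mat_trace B"
  using assms by (simp add: mat_trace_def sum_subtractf)

section \<open>Strict partitions and admissible dimensions\<close>

definition parts_ge :: "nat \<Rightarrow> nat list \<Rightarrow> nat" where
  "parts_ge t Y = length (filter (\<lambda>l. t \<le> l) Y)"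

text \<open>The parts are distinct, so at most one of them equals \<open>t\<close>.\<close>

lemma parts_ge_step:
  assumes "sorted_wrt (>) Y"
  shows "parts_ge (Suc t) Y \<le> parts_ge t Y" and "parts_ge t Y \<le> Suc (parts_ge (Suc t) Y)"
proof -
  have "parts_ge (Suc t) Y \<le> parts_ge t Y \<and> parts_ge t Y \<le> Suc (parts_ge (Suc t) Y)"
    using assms
  proof (induction Y)
    case Nil
    then show ?case by (simp add: parts_ge_def)
  next
    case (Cons l Y)
    show ?case
    proof (cases "l = t")
      case True
      then have "filter (\<lambda>l. t \<le> l) Y = []" "filter (\<lambda>l. Suc t \<le> l) Y = []"
        using Cons.prems by (auto simp: filter_empty_conv not_le intro: less_imp_le order.strict_trans2 simp: le_less_Suc_eq)
      then show ?thesis using True by (simp add: parts_ge_def)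
    next
      case False
      then have "t \<le> l \<longleftrightarrow> Suc t \<le> l" by auto
      then show ?thesis using Cons by (auto simp: parts_ge_def)
    qed
  qed
  then show "parts_ge (Suc t) Y \<le> parts_ge t Y" "parts_ge t Y \<le> Suc (parts_ge (Suc t) Y)" by auto
qed

lemma parts_ge_snoc: "parts_ge t (Y @ [l]) = parts_ge t Y + of_bool (t \<le> l)"
  by (simp add: parts_ge_def)

lemma strings_snoc: "strings n s (Y @ [l]) = strings n s Y @ [string_of n s (Suc (length Y)) l]"
  by (simp add: strings_def nth_append)

lemma dim_of_snoc:
  "dim_of n s (Y @ [l]) i = dim_of n s Y i + string_dim n (string_of n s (Suc (length Y)) l) i"
  by (simp add: dim_of_def strings_snoc)

context type_D
begin

lemma string_support_iff:
  assumes "1 \<le> l" "l \<le> Suc hub"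
  shows "i \<in> string_support n (string_of n s t l) \<longleftrightarrow>
    1 \<le> i \<and> i \<le> hub \<and> n - i \<le> l \<or> i = tip \<and> odd t \<or> i = cotip \<and> even t"
  using n4 assms unfolding tip_def cotip_def hub_def
  by (cases s; cases "odd t"; cases "l > 1") (auto simp: string_support_def string_of_def)

lemma strict_partition_parts:
  assumes "Y \<in> strict_partitions n" "l \<in> set Y"
  shows "1 \<le> l" "l \<le> Suc hub"
  using assms n_minus by (cases Y; force simp: strict_partitions_def)+

lemma strict_partition_snoc: "Y @ [l] \<in> strict_partitions n \<Longrightarrow> Y \<in> strict_partitions n"
  by (cases Y) (auto simp: strict_partitions_def sorted_wrt_append)

text \<open>The box in row \<open>r\<close> of colour \<open>i \<le> hub\<close> exists if the part of that row is at least \<open>n - i\<close>; the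
diagonal boxes of the rows alternate between tip and cotip.\<close>

lemma dim_of_eq:
  assumes "Y \<in> strict_partitions n"
  shows "dim_of n s Y i = (if 1 \<le> i \<and> i \<le> hub then parts_ge (n - i) Y
    else if i = tip then Suc (length Y) div 2 else if i = cotip then length Y div 2 else 0)"
  using assms
proof (induction Y rule: rev_induct)
  case Nil
  then show ?case by (simp add: dim_of_def strings_def parts_ge_def)
next
  case (snoc l Y)
  have l: "1 \<le> l" "l \<le> Suc hub" using strict_partition_parts[OF snoc.prems, of l] by auto
  have IH: "dim_of n s Y i = (if 1 \<le> i \<and> i \<le> hub then parts_ge (n - i) Y
    else if i = tip then Suc (length Y) div 2 else if i = cotip then length Y div 2 else 0)"
    by (rule snoc.IH[OF strict_partition_snoc[OF snoc.prems]])
  consider "1 \<le> i" "i \<le> hub" | "i = tip" | "i = cotip" | "\<not> (1 \<le> i \<and> i \<le> hub)" "i \<noteq> tip" "i \<noteq> cotip"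
    by blast
  then show ?case
  proof cases
    case 1
    then have "i \<noteq> tip" "i \<noteq> cotip" using tips_gt by auto
    then show ?thesis
      using 1 unfolding dim_of_snoc IH string_dim_def string_support_iff[OF l] by (simp add: parts_ge_snoc)
  next
    case 2
    then show ?thesis
      using tips_gt unfolding dim_of_snoc IH string_dim_def string_support_iff[OF l] by simp
  next
    case 3
    then show ?thesis
      using tips_gt unfolding dim_of_snoc IH string_dim_def string_support_iff[OF l] by simp
  next
    case 4
    then show ?thesis
      unfolding dim_of_snoc IH string_dim_def string_support_iff[OF l] by auto
  qed
qed

lemma dim_of_simps:
  assumes "Y \<in> strict_partitions n"
  shows "1 \<le> i \<Longrightarrow> i \<le> hub \<Longrightarrow> dim_of n s Y i = parts_ge (n - i) Y"
    and "dim_of n s Y tip = Suc (length Y) div 2" and "dim_of n s Y cotip = length Y div 2"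
    and "i \<notin> vertices n \<Longrightarrow> dim_of n s Y i = 0"
  using tips_gt by (auto simp: dim_of_eq[OF assms] vertices_iff)

lemma parts_ge_one: "Y \<in> strict_partitions n \<Longrightarrow> parts_ge 1 Y = length Y"
  using strict_partition_parts(1) by (simp add: parts_ge_def filter_id_conv[THEN iffD2])

lemma admissible_dim_of:
  assumes Y: "Y \<in> strict_partitions n"
  shows "admissible (dim_of n s Y)"
proof -
  have sorted: "sorted_wrt (>) Y" using Y by (simp add: strict_partitions_def)
  note step = parts_ge_step[OF sorted]
  have hub2: "dim_of n s Y hub = parts_ge 2 Y"
    using dim_of_simps(1)[OF Y, of hub] hub_ge Suc_hub by (metis One_nat_def Suc_1 Suc_leD add_diff_cancel_right' add_2_eq_Suc order_refl)
  have len: "parts_ge 2 Y \<le> length Y" "length Y \<le> Suc (parts_ge 2 Y)"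
    using step[of 1] parts_ge_one[OF Y] by (simp_all add: numeral_2_eq_2)
  have "dim_of n s Y 1 \<le> 1"
  proof -
    have "parts_ge n Y = 0"
      using strict_partition_parts(2)[OF Y] Suc_hub by (fastforce simp: parts_ge_def filter_empty_conv)
    then show ?thesis
      using dim_of_simps(1)[OF Y, of 1] hub_ge step(2)[of "n - 1"] n4 by simp
  qed
  moreover have "a < dim_of n s Y (snd h)"
    if h: "h \<in> edges n" and ar: "arrow h a b" and b: "b < dim_of n s Y (fst h)" for h a b
    using h
  proof (cases rule: edge_cases)
    case (right m)
    have "n - m = Suc (n - Suc m)" using right Suc_hub by simp
    then show ?thesis
      using right ar b step(1)[of "n - Suc m"] by (simp add: arrow_simps dim_of_simps[OF Y])
  next
    case (left m)
    have "n - m = Suc (n - Suc m)" using left Suc_hub by simp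
    then show ?thesis
      using left ar b step(2)[of "n - Suc m"] by (simp add: arrow_simps dim_of_simps[OF Y])
  next
    case to_tip
    then show ?thesis using ar b len by (simp add: arrow_simps dim_of_simps[OF Y] hub2; linarith)
  next
    case to_cotip
    then show ?thesis using ar b len by (simp add: arrow_simps dim_of_simps[OF Y] hub2; linarith)
  next
    case from_tip
    then show ?thesis using ar b len by (simp add: arrow_simps dim_of_simps[OF Y] hub2; linarith)
  next
    case from_cotip
    then show ?thesis using ar b len by (simp add: arrow_simps dim_of_simps[OF Y] hub2; linarith)
  qed
  ultimately show ?thesis by (auto simp: admissible_def)
qed

text \<open>Diagonal boxes and boxes of the hub are linked by arrows in both directions.  Following them from the
last box of each colour gives the four inequalities.\<close>

lemma admissible_tips:
  assumes adm: "admissible d"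
  shows "d cotip \<le> d tip" "d tip \<le> Suc (d cotip)"
    and "d hub \<le> d tip + d cotip" "d tip + d cotip \<le> Suc (d hub)"
proof -
  have ht: "2 * a < d hub \<Longrightarrow> a < d tip" and hc: "Suc (2 * a) < d hub \<Longrightarrow> a < d cotip" for a
    using admissibleD(2)[OF adm edgeI(3), of a "2 * a"] admissibleD(2)[OF adm edgeI(4), of a "Suc (2 * a)"]
    by (simp_all add: arrow_simps)
  have th: "Suc b < d tip \<Longrightarrow> Suc (2 * b) < d hub" and ch: "b < d cotip \<Longrightarrow> 2 * b < d hub" for b
    using admissibleD(2)[OF adm edgeI(5), of "Suc (2 * b)" "Suc b"] admissibleD(2)[OF adm edgeI(6), of "2 * b" b]
    by (simp_all add: arrow_simps)
  show le: "d cotip \<le> d tip"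
  proof (cases "d cotip")
    case (Suc b)
    then show ?thesis using ht[OF ch[of b]] by simp
  qed simp
  show le': "d tip \<le> Suc (d cotip)"
  proof (cases "d tip \<le> 1")
    case False
    then obtain b where "d tip = Suc (Suc b)" by (metis One_nat_def Suc_le_mono le0 not0_implies_Suc)
    then show ?thesis using hc[OF th[of b]] by simp
  qed simp
  show "d hub \<le> d tip + d cotip"
  proof (cases "d hub")
    case (Suc b)
    show ?thesis
    proof (cases "even b")
      case True
      then obtain a where "b = 2 * a" by (auto elim: evenE)
      then show ?thesis using ht[of a] Suc le' by simp
    next
      case False
      then obtain a where "b = Suc (2 * a)" by (auto elim: oddE)
      then show ?thesis using hc[of a] Suc le by simp
    qed
  qed simp
  show "d tip + d cotip \<le> Suc (d hub)"
  proof (cases "d cotip = d tip")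
    case True
    show ?thesis
    proof (cases "d cotip")
      case (Suc b)
      then show ?thesis using ch[of b] True by simp
    qed (use True in simp)
  next
    case False
    then have eq: "d tip = Suc (d cotip)" using le le' by simp
    show ?thesis
    proof (cases "d cotip")
      case (Suc b)
      then show ?thesis using th[of b] eq by simp
    qed (use eq in simp)
  qed
qed

text \<open>Counting the boxes on the diagonals at distance \<open>t - 1\<close> gives a sequence \<open>D\<close> that decreases by at most one in
each step.  The parts of the partition are the places where it decreases.\<close>

lemma admissible_dim_exists:
  assumes adm: "admissible d" and out: "\<And>i. i \<notin> vertices n \<Longrightarrow> d i = 0"
  shows "\<exists>Y\<in>strict_partitions n. dim_of n s Y = d"
proof -
  \<comment> \<open>the number of parts that have to be at least \<open>t\<close>\<close>
  define D where "D t = (if t = 1 then d tip + d cotip else d (n - t))" for t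
  note T = admissible_tips[OF adm]
  have step: "D (Suc t) \<le> D t \<and> D t \<le> Suc (D (Suc t))" if t: "1 \<le> t" "t < n" for t
  proof -
    consider "t = 1" | "t = n - 1" "t \<noteq> 1" | "2 \<le> t" "t < n - 1" using t by linarith
    then show ?thesis
    proof cases
      case 1
      then show ?thesis using T n_minus(1)[unfolded numeral_2_eq_2] by (simp add: D_def)
    next
      case 2
      have "d 0 = 0" by (rule out) (use tips_gt in \<open>simp add: vertices_iff\<close>)
      moreover have "n - (n - 1) = 1" using n4 by simp
      ultimately show ?thesis using 2 admissibleD(1)[OF adm] n4 by (simp add: D_def)
    next
      case 3
      define m where "m = n - Suc t"
      have m: "1 \<le> m" "m < hub" "n - t = Suc m" using 3 Suc_hub by (auto simp: m_def)
      have "d m \<le> d (Suc m)"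
      proof (cases "d m")
        case (Suc b)
        then show ?thesis using admissibleD(2)[OF adm edgeI(1)[OF m(1,2)], of b b] m by (simp add: arrow_simps)
      qed simp
      moreover have "d (Suc m) \<le> Suc (d m)"
      proof (cases "d (Suc m) \<le> 1")
        case False
        then obtain b where "d (Suc m) = Suc (Suc b)" by (metis One_nat_def Suc_le_mono le0 not0_implies_Suc)
        then show ?thesis using admissibleD(2)[OF adm edgeI(2)[OF m(1,2)], of b "Suc b"] m by (simp add: arrow_simps)
      qed simp
      ultimately show ?thesis using 3 m(3) by (simp add: D_def m_def[symmetric])
    qed
  qed
  define jump where "jump = filter (\<lambda>t. D t \<noteq> D (Suc t)) [1..<n]"
  define Y where "Y = rev jump"
  have Dn: "D n = 0" using out[of 0] n4 tips_gt by (simp add: D_def vertices_iff)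
  have len: "length (filter (\<lambda>t. D t \<noteq> D (Suc t)) [t..<n]) = D t" if "t \<le> n" "1 \<le> t" for t
    using that
  proof (induction rule: inc_induct)
    case base
    then show ?case using Dn by simp
  next
    case (step t)
    then show ?case using \<open>\<And>t. 1 \<le> t \<Longrightarrow> t < n \<Longrightarrow> D (Suc t) \<le> D t \<and> D t \<le> Suc (D (Suc t))\<close>[of t]
      by (auto simp: upt_conv_Cons)
  qed
  have ge: "parts_ge t Y = D t" if t: "1 \<le> t" "t \<le> n" for t
  proof -
    have "[1..<n] = [1..<t] @ [t..<n]" using t upt_add_eq_append[of 1 t "n - t"] by simp
    then have "filter (\<lambda>l. t \<le> l) [1..<n] = [t..<n]" by simp
    then have "filter (\<lambda>l. t \<le> l) jump = filter (\<lambda>t. D t \<noteq> D (Suc t)) [t..<n]"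
      unfolding jump_def filter_filter by (metis (no_types, lifting) conj_commute filter_filter filter_cong)
    then show ?thesis using len[OF t(2,1)] by (simp add: parts_ge_def Y_def rev_filter[symmetric])
  qed
  have Y: "Y \<in> strict_partitions n"
  proof -
    have "sorted_wrt (<) jump" unfolding jump_def by (intro sorted_wrt_filter) simp
    moreover have "\<forall>l\<in>set jump. 0 < l \<and> l \<le> n - 1" by (auto simp: jump_def)
    moreover have "hd Y \<in> set jump" if "Y \<noteq> []" using that by (metis Y_def hd_in_set set_rev)
    ultimately show ?thesis by (auto simp: strict_partitions_def Y_def sorted_wrt_rev)
  qed
  have "dim_of n s Y i = d i" for i
  proof -
    have len_eq: "length Y = d tip + d cotip" using ge[of 1] parts_ge_one[OF Y] n4 by (simp add: D_def)
    consider "1 \<le> i" "i \<le> hub" | "i = tip" | "i = cotip" | "i \<notin> vertices n" by (auto simp: vertices_iff)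
    then show ?thesis
    proof cases
      case 1
      have "D (n - i) = d i" using 1 Suc_hub by (auto simp: D_def)
      then show ?thesis using ge[of "n - i"] 1 Suc_hub by (simp add: dim_of_simps[OF Y])
    next
      case 2
      then show ?thesis using T len_eq by (simp add: dim_of_simps[OF Y]; linarith)
    next
      case 3
      then show ?thesis using T len_eq by (simp add: dim_of_simps[OF Y]; linarith)
    next
      case 4
      then show ?thesis using out by (simp add: dim_of_simps[OF Y])
    qed
  qed
  then show ?thesis using Y by blast
qed

section \<open>The staircase point lies on the component\<close>

lemma box_row_less_length:
  assumes Y: "Y \<in> strict_partitions n" and m: "m \<in> vertices n" and a: "a < dim_of n s Y m"
  shows "box_row m a < length Y"
proof -
  consider "1 \<le> m" "m \<le> hub" | "m = tip" | "m = cotip" using m by (auto simp: vertices_iff)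
  then show ?thesis
  proof cases
    case 1
    have "parts_ge (n - m) Y \<le> length Y" by (simp add: parts_ge_def)
    then show ?thesis using 1 a by (simp add: box_row_simps dim_of_simps[OF Y])
  next
    case 2
    then show ?thesis using a by (simp add: box_row_simps dim_of_simps[OF Y])
  next
    case 3
    then show ?thesis using a by (simp add: box_row_simps dim_of_simps[OF Y])
  qed
qed

text \<open>A further, smaller part is a new last row, so its boxes get the next free number at every vertex of its
string.\<close>

lemma box_row_new:
  assumes Yl: "Y @ [l] \<in> strict_partitions n"
    and m: "m \<in> string_support n (string_of n s (Suc (length Y)) l)"
  shows "box_row m (dim_of n s Y m) = length Y"
proof -
  note Y = strict_partition_snoc[OF Yl]
  have l: "1 \<le> l" "l \<le> Suc hub" using strict_partition_parts[OF Yl, of l] by auto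
  have gt: "\<forall>l'\<in>set Y. l < l'" using Yl by (auto simp: strict_partitions_def sorted_wrt_append)
  from m consider "1 \<le> m" "m \<le> hub" "n - m \<le> l" | "m = tip" "even (length Y)" | "m = cotip" "odd (length Y)"
    unfolding string_support_iff[OF l] by auto
  then show ?thesis
  proof cases
    case 1
    then have "filter (\<lambda>l. n - m \<le> l) Y = Y" using gt by (auto simp: filter_id_conv)
    then show ?thesis using 1 by (simp add: box_row_simps dim_of_simps[OF Y] parts_ge_def)
  next
    case 2
    then show ?thesis by (simp add: box_row_simps dim_of_simps[OF Y])
  next
    case 3
    then show ?thesis by (simp add: box_row_simps dim_of_simps[OF Y])
  qed
qed

text \<open>The numbering of the boxes at a vertex by rows is the order of the blocks.  A new row adds one block,
and no arrow along \<open>\<Omega>\<close> connects it with earlier rows.\<close>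

lemma diag_block_strings:
  assumes "Y \<in> strict_partitions n" and h: "h \<in> edges n"
  shows "diag_block_mat (map (\<lambda>a. string_rep n a h) (strings n s Y)) =
    Matrix.mat (dim_of n s Y (snd h)) (dim_of n s Y (fst h)) (\<lambda>(a, b). of_bool (h \<in> Omega n \<and> arrow h a b))"
  using assms(1)
proof (induction Y rule: rev_induct)
  case Nil
  then show ?case by (auto simp: strings_def dim_of_def)
next
  case (snoc l Y)
  note Y = strict_partition_snoc[OF snoc.prems] and V = edge_vertices[OF h]
  let ?a = "string_of n s (Suc (length Y)) l"
  let ?d = "dim_of n s Y"
  let ?A = "Matrix.mat (?d (snd h)) (?d (fst h)) (\<lambda>(a, b). of_bool (h \<in> Omega n \<and> arrow h a b) :: complex)"
  let ?B = "string_rep n ?a h"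
  have A: "diag_block_mat (map (\<lambda>a. string_rep n a h) (strings n s Y)) = ?A" by (rule snoc.IH[OF Y])
  have B: "?B = Matrix.mat (string_dim n ?a (snd h)) (string_dim n ?a (fst h)) (\<lambda>_. if h \<in> Omega n then 1 else 0)"
    using h by (simp add: string_rep_def)
  have "diag_block_mat (map (\<lambda>a. string_rep n a h) (strings n s (Y @ [l])))
      = four_block_mat ?A (0\<^sub>m (dim_row ?A) (dim_col ?B)) (0\<^sub>m (dim_row ?B) (dim_col ?A)) ?B"
    by (simp only: strings_snoc map_append list.map diag_block_mat_last A Let_def)
  also have "\<dots> = Matrix.mat (dim_of n s (Y @ [l]) (snd h)) (dim_of n s (Y @ [l]) (fst h))
      (\<lambda>(a, b). of_bool (h \<in> Omega n \<and> arrow h a b))" (is "?L = ?R")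
  proof (rule eq_matI)
    show "dim_row ?L = dim_row ?R" "dim_col ?L = dim_col ?R" by (simp_all add: B dim_of_snoc)
    fix a b assume "a < dim_row ?R" "b < dim_col ?R"
    then have a: "a < ?d (snd h) + string_dim n ?a (snd h)" and b: "b < ?d (fst h) + string_dim n ?a (fst h)"
      by (simp_all add: dim_of_snoc)
    have new: "m \<in> string_support n ?a \<and> c = ?d m \<and> string_dim n ?a m = 1 \<and> box_row m c = length Y"
      if "\<not> c < ?d m" "c < ?d m + string_dim n ?a m" for m c
    proof -
      have "m \<in> string_support n ?a" "c = ?d m" using that by (auto simp: string_dim_def split: if_splits)
      then show ?thesis using box_row_new[OF snoc.prems, of m] by (simp add: string_dim_def)
    qed
    note old = box_row_less_length[OF Y]
    have lhs: "?L $$ (a, b) = (if a < ?d (snd h) then if b < ?d (fst h) then of_bool (h \<in> Omega n \<and> arrow h a b) else 0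
        else if b < ?d (fst h) then 0 else if h \<in> Omega n then 1 else 0)"
      using a b by (auto simp: B)
    show "?L $$ (a, b) = ?R $$ (a, b)"
    proof (cases "h \<in> Omega n")
      case False
      then show ?thesis unfolding lhs using a b by (simp add: dim_of_snoc)
    next
      case True
      then have ar: "arrow h a b \<longleftrightarrow> box_row (snd h) a = box_row (fst h) b" by (simp add: arrow_def)
      show ?thesis
        unfolding lhs using a b True ar new[of a "snd h"] new[of b "fst h"] old[OF V(2), of a] old[OF V(1), of b]
        by (auto simp: dim_of_snoc)
    qed
  qed
  finally show ?case .
qed

lemma Omega_part_staircase:
  assumes Y: "Y \<in> strict_partitions n"
  shows "Omega_part n (dim_of n s Y) (staircase_rep (dim_of n s Y)) = strings_rep n s Y"
proof
  fix h
  show "Omega_part n (dim_of n s Y) (staircase_rep (dim_of n s Y)) h = strings_rep n s Y h"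
    using diag_block_strings[OF Y, of h]
    by (cases "h \<in> edges n") (auto simp: Omega_part_def strings_rep_def staircase_rep_def)
qed

text \<open>For a tangent vector given by \<open>\<xi>\<close>, cyclicity of the trace turns the symplectic pairing with \<open>x\<close> into
the sum over the vertices \<open>i\<close> of the trace of \<open>\<xi>\<^sub>i\<close> times the moment map at \<open>i\<close>.\<close>

lemma Lambda_conormal:
  assumes x: "x \<in> Lambda n v" and y: "y \<in> orbit_tangent n v (Omega_part n v x)"
  shows "symplectic_pairing n y x = 0"
proof -
  have xr: "x \<in> rep_space n v" using x by (simp add: Lambda_def)
  obtain \<xi> where \<xi>: "\<xi> \<in> (\<Pi>\<^sub>E i\<in>vertices n. carrier_mat (v i) (v i))"
    and y: "y = (\<lambda>h\<in>edges n. \<xi> (snd h) * Omega_part n v x h - Omega_part n v x h * \<xi> (fst h))"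
    using y by (auto simp: orbit_tangent_def)
  have \<xi>c: "\<xi> m \<in> carrier_mat (v m) (v m)" if "m \<in> vertices n" for m using \<xi> that by (auto simp: PiE_iff)
  define F where "F h = eps n h * mat_trace (\<xi> (snd h) * (x h * x (opp h)))" for h
  have xc: "x h \<in> carrier_mat (v (snd h)) (v (fst h))" "x (opp h) \<in> carrier_mat (v (fst h)) (v (snd h))"
    if "h \<in> edges n" for h
    using rep_carrier[OF xr, of h] rep_carrier[OF xr, of "opp h"] that by auto
  have out: "eps n h * mat_trace (y h * x (opp h)) = 0" if h: "h \<in> edges n" "h \<notin> Omega n" for h
  proof -
    note V = edge_vertices[OF h(1)]
    have "y h = 0\<^sub>m (v (snd h)) (v (fst h))"
      using h \<xi>c[OF V(1)] \<xi>c[OF V(2)] by (auto simp: y Omega_part_def)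
    then show ?thesis using xc(2)[OF h(1)] by (simp add: mat_trace_def)
  qed
  have in_Omega: "eps n h * mat_trace (y h * x (opp h)) = F h + F (opp h)" if h: "h \<in> Omega n" for h
  proof -
    have e: "h \<in> edges n" using h by (simp add: edges_iff)
    have no: "opp h \<notin> Omega n" using opp_Omega[OF e] h by simp
    note V = edge_vertices[OF e] and X = xc[OF e]
    note S = \<xi>c[OF V(2)] and T = \<xi>c[OF V(1)]
    have c: "\<xi> (snd h) * x h \<in> carrier_mat (v (snd h)) (v (fst h))" "x h * \<xi> (fst h) \<in> carrier_mat (v (snd h)) (v (fst h))"
      using S T X by auto
    have "mat_trace (y h * x (opp h)) = mat_trace (\<xi> (snd h) * x h * x (opp h) - x h * \<xi> (fst h) * x (opp h))"
      using minus_mult_distrib_mat[OF c X(2)] e h by (simp add: y Omega_part_def)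
    also have "\<dots> = mat_trace (\<xi> (snd h) * x h * x (opp h)) - mat_trace (x h * \<xi> (fst h) * x (opp h))"
      by (rule mat_trace_minus[OF mult_carrier_mat[OF c(1) X(2)] mult_carrier_mat[OF c(2) X(2)]])
    also have "\<xi> (snd h) * x h * x (opp h) = \<xi> (snd h) * (x h * x (opp h))"
      by (rule assoc_mult_mat[OF S X])
    also have "x h * \<xi> (fst h) * x (opp h) = x h * (\<xi> (fst h) * x (opp h))"
      by (rule assoc_mult_mat[OF X(1) T X(2)])
    also have "mat_trace \<dots> = mat_trace (\<xi> (fst h) * x (opp h) * x h)"
      by (rule mat_trace_comm[OF X(1) mult_carrier_mat[OF T X(2)]])
    also have "\<xi> (fst h) * x (opp h) * x h = \<xi> (fst h) * (x (opp h) * x h)"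
      by (rule assoc_mult_mat[OF T X(2,1)])
    finally show ?thesis using h no by (simp add: F_def eps_def)
  qed
  have "Omega n \<subseteq> edges n" by (auto simp: edges_iff)
  then have Om: "finite (Omega n)" "Omega n \<subseteq> edges n" using finite_subset[OF _ finite_edges] by auto
  have disj: "Omega n \<inter> opp ` Omega n = {}"
    using opp_Omega Om(2) by auto
  have inj: "inj_on opp (Omega n)" by (metis inj_onI opp_opp)
  have "symplectic_pairing n y x = (\<Sum>h\<in>Omega n. eps n h * mat_trace (y h * x (opp h)))"
    unfolding symplectic_pairing_def by (rule sum.mono_neutral_right) (use Om out in auto)
  also have "\<dots> = (\<Sum>h\<in>Omega n. F h) + (\<Sum>h\<in>Omega n. F (opp h))"
    unfolding sum.distrib[symmetric] by (rule sum.cong) (auto simp: in_Omega)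
  also have "\<dots> = (\<Sum>h\<in>edges n. F h)"
    unfolding edges_def using Om(1) disj by (subst sum.union_disjoint) (auto simp: sum.reindex[OF inj])
  also have "\<dots> = (\<Sum>i\<in>vertices n. \<Sum>h\<in>{h \<in> edges n. snd h = i}. F h)"
    by (rule sum.group[symmetric]) (use edge_vertices in \<open>auto simp: vertices_def\<close>)
  also have "\<dots> = 0"
  proof (rule sum.neutral, intro ballI)
    fix i assume i: "i \<in> vertices n"
    let ?E = "{h \<in> edges n. snd h = i}"
    have Fh: "F h = (\<Sum>a<v i. \<Sum>b<v i. \<xi> i $$ (a, b) * (eps n h * (x h * x (opp h)) $$ (b, a)))" if h: "h \<in> ?E" for h
    proof -
      have c: "x h * x (opp h) \<in> carrier_mat (v i) (v i)" using xc[of h] h by auto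
      have "mat_trace (\<xi> i * (x h * x (opp h))) = (\<Sum>a<v i. \<Sum>b<v i. \<xi> i $$ (a, b) * (x h * x (opp h)) $$ (b, a))"
        using \<xi>c[OF i] unfolding mat_trace_def by (auto intro!: sum.cong simp: mult_mat_entry[OF \<xi>c[OF i] c])
      then show ?thesis using h by (simp add: F_def sum_distrib_left mult.left_commute)
    qed
    have "(\<Sum>h\<in>?E. F h) = (\<Sum>h\<in>?E. \<Sum>a<v i. \<Sum>b<v i. \<xi> i $$ (a, b) * (eps n h * (x h * x (opp h)) $$ (b, a)))"
      by (rule sum.cong) (auto simp: Fh)
    also have "\<dots> = (\<Sum>a<v i. \<Sum>b<v i. \<xi> i $$ (a, b) * (\<Sum>h\<in>?E. eps n h * (x h * x (opp h)) $$ (b, a)))"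
      unfolding sum_distrib_left by (subst sum.swap, rule sum.cong[OF refl], rule sum.swap)
    also have "\<dots> = 0"
      using x i by (intro sum.neutral ballI) (auto simp: Lambda_def)
    finally show "(\<Sum>h\<in>?E. F h) = 0" .
  qed
  finally show ?thesis .
qed

lemma act_rep_one:
  assumes "x \<in> rep_space n v"
  shows "\<exists>g\<in>GV n v. act_rep n v g x = x"
proof
  let ?g = "\<lambda>i\<in>vertices n. 1\<^sub>m (v i)"
  show g: "?g \<in> GV n v" using mat_Units_I[of "1\<^sub>m m" m "1\<^sub>m m" for m] by (auto simp: GV_def)
  show "act_rep n v ?g x = x"
  proof
    fix h
    show "act_rep n v ?g x h = x h"
    proof (cases "h \<in> edges n")
      case True
      note V = edge_vertices[OF True] and G = GV_D[OF g edge_vertices(1)[OF True]]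
      have "mat_inv (v (fst h)) (1\<^sub>m (v (fst h))) = 1\<^sub>m (v (fst h))"
        using G(2,3) V(1) by simp
      then show ?thesis using True V rep_carrier[OF assms True] by (simp add: act_rep_def)
    next
      case False
      then show ?thesis using assms by (cases h) (auto simp: act_rep_def rep_space_def PiE_def extensional_def)
    qed
  qed
qed

text \<open>Because all stable points are conjugate, it suffices that the closure of the conormal bundle contains one of them.
The staircase representation lies in the conormal bundle itself.\<close>

lemma component_eq:
  assumes Y: "Y \<in> strict_partitions n"
  shows "component n s Y = {Lambda_st n (dim_of n s Y) (unit_dim tip)}"
proof -
  let ?v = "dim_of n s Y"
  let ?x = "staircase_rep ?v"
  let ?C = "(zariski_closure n ?v (conormal_bundle n ?v (strings_rep n s Y)) \<times> framing_space n ?v (unit_dim tip))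
    \<inter> Lambda_st n ?v (unit_dim tip)"
  have st: "(?x, staircase_framing ?v) \<in> Lambda_st n ?v (unit_dim tip)"
    by (rule staircase_in_Lambda_st[OF admissible_dim_of[OF Y]])
  then have L: "?x \<in> Lambda n ?v" by (simp add: Lambda_st_def)
  have "strings_rep n s Y \<in> rep_space n ?v"
    unfolding Omega_part_staircase[OF Y, symmetric]
    unfolding Omega_part_def rep_space_def
    by (simp add: restrict_PiE_iff rep_carrier[OF staircase_rep_space])
  then have "\<exists>g\<in>GV n ?v. act_rep n ?v g (strings_rep n s Y) = strings_rep n s Y" by (rule act_rep_one)
  then have "strings_rep n s Y \<in> {act_rep n ?v g (strings_rep n s Y) | g. g \<in> GV n ?v}"
    unfolding mem_Collect_eq by metis
  then have "?x \<in> conormal_bundle n ?v (strings_rep n s Y)"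
    unfolding conormal_bundle_def
    using staircase_rep_space[of ?v] Lambda_conormal[OF L] Omega_part_staircase[OF Y] by auto
  then have "?x \<in> zariski_closure n ?v (conormal_bundle n ?v (strings_rep n s Y))"
    using staircase_rep_space[of ?v] by (auto simp: zariski_closure_def)
  then have "(?x, staircase_framing ?v) \<in> ?C" using st staircase_framing_space by auto
  moreover have "orbit n ?v z = Lambda_st n ?v (unit_dim tip)" if "z \<in> ?C" for z
    using orbit_eq_Lambda_st[of "fst z" "snd z"] that by auto
  ultimately have "orbit n ?v ` ?C = {Lambda_st n ?v (unit_dim tip)}" by blast
  then show ?thesis by (simp add: component_def spin_w_eq Let_def)
qed

section \<open>Hecke operators between points\<close>

lemma ind_component:
  assumes "Y \<in> strict_partitions n"
  shows "quiver_variety n (dim_of n s Y) (unit_dim tip) = {Lambda_st n (dim_of n s Y) (unit_dim tip)}"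
    and "ind (quiver_variety n (dim_of n s Y) (unit_dim tip)) (component n s Y)
      = (\<lambda>y\<in>{Lambda_st n (dim_of n s Y) (unit_dim tip)}. 1)"
proof -
  show qv: "quiver_variety n (dim_of n s Y) (unit_dim tip) = {Lambda_st n (dim_of n s Y) (unit_dim tip)}"
    using Lambda_st_nonempty_iff admissible_dim_of[OF assms] by (auto simp: quiver_variety_eq)
  show "ind (quiver_variety n (dim_of n s Y) (unit_dim tip)) (component n s Y)
      = (\<lambda>y\<in>{Lambda_st n (dim_of n s Y) (unit_dim tip)}. 1)"
    unfolding qv component_eq[OF assms] ind_def by (intro restrict_ext) simp
qed

lemma quiver_variety_empty:
  assumes "\<nexists>Y. Y \<in> strict_partitions n \<and> dim_of n s Y = v" and "\<And>i. i \<notin> vertices n \<Longrightarrow> v i = 0"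
  shows "quiver_variety n v (unit_dim tip) = {}"
  using admissible_dim_exists[of v] Lambda_st_nonempty_iff[of v] assms by (auto simp: quiver_variety_eq)

text \<open>A flag exists because both dimensions are admissible, and there is only one orbit of flags
  because a stable subspace is determined by its dimension.\<close>

lemma one_point_flag_variety:
  assumes Y: "Y \<in> strict_partitions n" and Y': "Y' \<in> strict_partitions n"
    and dim: "dim_of n s Y' = dim_of n s Y + d"
  shows "topspace (flag_variety n (dim_of n s Y') (unit_dim tip) d) = {flag_triples n (dim_of n s Y') (unit_dim tip) d}"
    and "pi1 n (dim_of n s Y') (unit_dim tip) d (flag_triples n (dim_of n s Y') (unit_dim tip) d)
      = Lambda_st n (dim_of n s Y) (unit_dim tip)"
    and "pi2 (flag_triples n (dim_of n s Y') (unit_dim tip) d) = Lambda_st n (dim_of n s Y') (unit_dim tip)"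
proof -
  have diff: "dim_of n s Y' - d = dim_of n s Y" and le: "d \<le> dim_of n s Y'"
    by (auto simp: dim fun_eq_iff le_fun_def)
  have ne: "flag_triples n (dim_of n s Y') (unit_dim tip) d \<noteq> {}"
    by (rule flag_triples_exists) (simp_all add: diff le admissible_dim_of Y Y')
  show "topspace (flag_variety n (dim_of n s Y') (unit_dim tip) d) = {flag_triples n (dim_of n s Y') (unit_dim tip) d}"
    using ne by (simp add: topspace_flag_variety)
  show "pi2 (flag_triples n (dim_of n s Y') (unit_dim tip) d) = Lambda_st n (dim_of n s Y') (unit_dim tip)"
    by (rule pi2_flag_triples[OF ne])
  show "pi1 n (dim_of n s Y') (unit_dim tip) d (flag_triples n (dim_of n s Y') (unit_dim tip) d)
      = Lambda_st n (dim_of n s Y) (unit_dim tip)"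
    using pi1_flag_triples[OF ne] by (simp only: diff)
qed

lemma F_op_component:
  assumes Y: "Y \<in> strict_partitions n" and Y': "Y' \<in> strict_partitions n"
    and dim: "dim_of n s Y' = dim_of n s Y + unit_dim k"
  shows "F_op n (unit_dim tip) (dim_of n s Y') k
      (ind (quiver_variety n (dim_of n s Y) (unit_dim tip)) (component n s Y))
    = ind (quiver_variety n (dim_of n s Y') (unit_dim tip)) (component n s Y')"
  unfolding F_op_def ind_component(2)[OF Y] ind_component(2)[OF Y'] unfolding ind_component(1)[OF Y']
  by (intro restrict_ext pushforward_point[OF one_point_flag_variety(1)[OF Y Y' dim]])
    (simp_all add: one_point_flag_variety(2,3)[OF Y Y' dim])

lemma E_op_component:
  assumes Y: "Y \<in> strict_partitions n" and Y': "Y' \<in> strict_partitions n"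
    and dim: "dim_of n s Y' = dim_of n s Y + unit_dim k"
  shows "E_op n (unit_dim tip) (dim_of n s Y') k
      (ind (quiver_variety n (dim_of n s Y') (unit_dim tip)) (component n s Y'))
    = ind (quiver_variety n (dim_of n s Y) (unit_dim tip)) (component n s Y)"
proof -
  have diff: "dim_of n s Y' - unit_dim k = dim_of n s Y" by (simp add: dim fun_eq_iff)
  show ?thesis
    unfolding E_op_def diff ind_component(2)[OF Y] ind_component(2)[OF Y'] unfolding ind_component(1)[OF Y]
    by (intro restrict_ext pushforward_point[OF one_point_flag_variety(1)[OF Y Y' dim]])
      (simp_all add: one_point_flag_variety(2,3)[OF Y Y' dim])
qed

end

theorem proposition4p3:
  fixes n k :: nat and s :: spin_sign and Y :: "nat list"
  assumes "n \<ge> 4" and "Y \<in> strict_partitions n" and "1 \<le> k" and "k \<le> n"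
  shows
    "let w = spin_w n s; L = (\<lambda>v. quiver_variety n v w); v = dim_of n s Y;
         f = ind (L v) (component n s Y)
     in
       (\<forall>Y' \<in> strict_partitions n. dim_of n s Y' = v + unit_dim k \<longrightarrow>
          F_op n w (v + unit_dim k) k f = ind (L (dim_of n s Y')) (component n s Y')) \<and>
       ((\<nexists>Y'. Y' \<in> strict_partitions n \<and> dim_of n s Y' = v + unit_dim k) \<longrightarrow>
          F_op n w (v + unit_dim k) k f = (\<lambda>y\<in>L (v + unit_dim k). 0)) \<and>
       (\<forall>Y'' \<in> strict_partitions n. dim_of n s Y'' + unit_dim k = v \<longrightarrow>
          E_op n w v k f = ind (L (dim_of n s Y'')) (component n s Y'')) \<and>
       ((\<nexists>Y''. Y'' \<in> strict_partitions n \<and> dim_of n s Y'' + unit_dim k = v) \<longrightarrow>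
          E_op n w v k f = (\<lambda>y\<in>L (v - unit_dim k). 0))"
proof -
  interpret type_D n s using assms(1) by unfold_locales
  note Y = assms(2)
  let ?v = "dim_of n s Y"
  let ?f = "ind (quiver_variety n ?v (unit_dim tip)) (component n s Y)"
  have k: "k \<in> vertices n" using assms(3,4) by (simp add: vertices_def)
  have out: "?v i = 0" "unit_dim k i = 0" if "i \<notin> vertices n" for i
    using dim_of_simps(4)[OF Y that] that k by (auto simp: unit_dim_def)
  have F1: "F_op n (unit_dim tip) (?v + unit_dim k) k ?f = ind (quiver_variety n (dim_of n s Y') (unit_dim tip)) (component n s Y')"
    if "Y' \<in> strict_partitions n" "dim_of n s Y' = ?v + unit_dim k" for Y'
    using F_op_component[OF Y that] that(2) by simp
  have F0: "F_op n (unit_dim tip) (?v + unit_dim k) k ?f = (\<lambda>y\<in>quiver_variety n (?v + unit_dim k) (unit_dim tip). 0)"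
    if "\<nexists>Y'. Y' \<in> strict_partitions n \<and> dim_of n s Y' = ?v + unit_dim k"
  proof -
    have "quiver_variety n (?v + unit_dim k) (unit_dim tip) = {}"
      by (rule quiver_variety_empty[OF that]) (simp add: out)
    then show ?thesis by (simp add: F_op_def restrict_def)
  qed
  have E1: "E_op n (unit_dim tip) ?v k ?f = ind (quiver_variety n (dim_of n s Y'') (unit_dim tip)) (component n s Y'')"
    if "Y'' \<in> strict_partitions n" "dim_of n s Y'' + unit_dim k = ?v" for Y''
    using E_op_component[OF that(1) Y that(2)[symmetric]] .
  have E0: "E_op n (unit_dim tip) ?v k ?f = (\<lambda>y\<in>quiver_variety n (?v - unit_dim k) (unit_dim tip). 0)"
    if none: "\<nexists>Y''. Y'' \<in> strict_partitions n \<and> dim_of n s Y'' + unit_dim k = ?v"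
  proof (cases "?v k = 0")
    case True
    \<comment> \<open>The subtraction truncates to \<open>v\<close>, so the target variety is a point; but there are no flags.\<close>
    then have "\<not> unit_dim k \<le> ?v" by (auto simp: le_fun_def unit_dim_def intro!: exI[of _ k])
    then have "topspace (flag_variety n ?v (unit_dim tip) (unit_dim k)) = {}"
      by (simp add: topspace_flag_variety flag_triples_def)
    then show ?thesis by (simp add: E_op_def pushforward_empty)
  next
    case False
    then have "?v - unit_dim k + unit_dim k = ?v" by (auto simp: fun_eq_iff unit_dim_def)
    then have "\<nexists>Y''. Y'' \<in> strict_partitions n \<and> dim_of n s Y'' = ?v - unit_dim k"
      using none by metis
    then have "quiver_variety n (?v - unit_dim k) (unit_dim tip) = {}"
      by (rule quiver_variety_empty) (simp add: out)
    then show ?thesis by (simp add: E_op_def restrict_def)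
  qed
  show ?thesis
    unfolding Let_def spin_w_eq using F1 F0 E1 E0 by blast
qed

end
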